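(* Let $n\ge1$. For any $P_0\in\mathrm{PD}(n)$, the squared distance $f\colon\mathrm{PD}(n)\to\mathbb{R}$ to $P_0$, defined by $f(P)=d(P,P_0)^2$, is $2$-self-concordant.
   Context: $\mathrm{PD}(n)=\mathrm{PD}(n,\mathbb{C})$ is the manifold of complex positive-definite Hermitian $n\times n$ matrices, an open subset of the real vector space $\mathrm{Herm}(n)$ of Hermitian $n\times n$ matrices, so each tangent space $T_P\mathrm{PD}(n)$ is identified with $\mathrm{Herm}(n)$. It carries the affine-invariant Riemannian metric $\langle U,V\rangle_P=\operatorname{Tr}[P^{-1}UP^{-1}V]$, for which it is a Hadamard manifold. The Riemannian distance is $d(P,Q)=\|\log(P^{-1/2}QP^{-1/2})\|_{\mathrm{HS}}$, with $\|\cdot\|_{\mathrm{HS}}$ the Hilbert–Schmidt (Frobenius) norm. Self-concordance: on a Riemannian manifold $M$ with Levi-Civita connection $\nabla$, let $\nabla^2f$ be the Hessian and $\nabla^3f=\nabla(\nabla^2f)$, $(\nabla^3f)_p(u,v,w)=(\nabla_u(\nabla^2f))_p(v,w)$. For $\alpha>0$, a smooth (geodesically) convex function $f\colon M\to\mathbb{R}$ is $\alpha$-self-concordant if for all $p\in M$ and $u,v,w\in T_pM$, $$|(\nabla^3f)_p(u,v,w)|\le\frac{2}{\sqrt\alpha}\sqrt{(\nabla^2f)_p(u,u)}\sqrt{(\nabla^2f)_p(v,v)}\sqrt{(\nabla^2f)_p(w,w)}.$$ *)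

theory Defs
  imports "HOL-Analysis.Analysis"
begin

section \<open>Hermitian matrices as a Euclidean space\<close>

definition ctranspose :: "complex ^ 'n ^ 'm \<Rightarrow> complex ^ 'm ^ 'n" where
  "ctranspose A = (\<chi> i j. cnj (A $ j $ i))"

definition hermitian_mats :: "(complex ^ 'n ^ 'n) set" where
  "hermitian_mats = {A. ctranspose A = A}"

typedef (overloaded) 'n herm = "hermitian_mats :: (complex ^ 'n ^ 'n::finite) set"
  morphisms mat_of_herm Herm
  by (rule exI[of _ 0]) (simp add: hermitian_mats_def ctranspose_def vec_eq_iff)

lemma subspace_hermitian_mats: "subspace (hermitian_mats :: (complex ^ 'n ^ 'n::finite) set)"
  by (auto simp: subspace_def hermitian_mats_def ctranspose_def vec_eq_iff)

lemma mat_of_herm_in [simp]: "mat_of_herm A \<in> hermitian_mats"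
  by (rule mat_of_herm)

instantiation herm :: (finite) real_vector
begin

definition zero_herm :: "'a herm" where
  "zero_herm = Herm 0"
definition plus_herm :: "'a herm \<Rightarrow> 'a herm \<Rightarrow> 'a herm" where
  "plus_herm A B = Herm (mat_of_herm A + mat_of_herm B)"
definition minus_herm :: "'a herm \<Rightarrow> 'a herm \<Rightarrow> 'a herm" where
  "minus_herm A B = Herm (mat_of_herm A - mat_of_herm B)"
definition uminus_herm :: "'a herm \<Rightarrow> 'a herm" where
  "uminus_herm A = Herm (- mat_of_herm A)"
definition scaleR_herm :: "real \<Rightarrow> 'a herm \<Rightarrow> 'a herm" where
  "scaleR_herm r A = Herm (r *\<^sub>R mat_of_herm A)"

lemma mat_of_herm_simps:
  fixes A B :: "'a herm"
  shows "mat_of_herm (0 :: 'a herm) = 0"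
    and "mat_of_herm (A + B) = mat_of_herm A + mat_of_herm B"
    and "mat_of_herm (A - B) = mat_of_herm A - mat_of_herm B"
    and "mat_of_herm (- A) = - mat_of_herm A"
    and "mat_of_herm (scaleR r A) = r *\<^sub>R mat_of_herm A"
  by (simp_all add: zero_herm_def plus_herm_def minus_herm_def uminus_herm_def scaleR_herm_def
      Herm_inverse subspace_hermitian_mats subspace_0 subspace_add subspace_diff subspace_neg
      subspace_scale)

instance
  by standard (simp_all add: mat_of_herm_inject[symmetric] mat_of_herm_simps
      scaleR_add_left scaleR_add_right)

end

instantiation herm :: (finite) real_inner
begin

definition inner_herm :: "'a herm \<Rightarrow> 'a herm \<Rightarrow> real" where
  "inner_herm A B = inner (mat_of_herm A) (mat_of_herm B)"
definition norm_herm :: "'a herm \<Rightarrow> real" where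
  "norm_herm A = norm (mat_of_herm A)"
definition dist_herm :: "'a herm \<Rightarrow> 'a herm \<Rightarrow> real" where
  "dist_herm A B = dist (mat_of_herm A) (mat_of_herm B)"
definition sgn_herm :: "'a herm \<Rightarrow> 'a herm" where
  "sgn_herm A = A /\<^sub>R norm (mat_of_herm A)"
definition uniformity_herm :: "('a herm \<times> 'a herm) filter" where
  "uniformity_herm =
     (INF e\<in>{0 <..}. principal {(x, y). dist (mat_of_herm x) (mat_of_herm y) < e})"
definition open_herm :: "'a herm set \<Rightarrow> bool" where
  "open_herm U \<longleftrightarrow> (\<forall>x\<in>U. eventually (\<lambda>(x', y). x' = x \<longrightarrow> y \<in> U) uniformity)"

instance
proof
  fix A B C :: "'a herm" and r :: real
  show "sgn A = A /\<^sub>R norm A"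
    by (simp add: sgn_herm_def norm_herm_def)
  show "dist A B = norm (A - B)"
    by (simp add: dist_herm_def norm_herm_def dist_norm mat_of_herm_simps)
  show "(uniformity :: ('a herm \<times> 'a herm) filter)
      = (INF e\<in>{0 <..}. principal {(x, y). dist x y < e})"
    by (simp add: uniformity_herm_def dist_herm_def)
  show "open U \<longleftrightarrow> (\<forall>x\<in>U. eventually (\<lambda>(x', y). x' = x \<longrightarrow> y \<in> U) uniformity)"
    for U :: "'a herm set"
    by (rule open_herm_def)
  show "inner A B = inner B A"
    by (simp add: inner_herm_def inner_commute)
  show "inner (A + B) C = inner A C + inner B C" "inner (r *\<^sub>R A) B = r * inner A B"
    by (simp_all add: inner_herm_def inner_add_left mat_of_herm_simps)
  show "0 \<le> inner A A" "inner A A = 0 \<longleftrightarrow> A = 0"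
    by (simp_all add: inner_herm_def mat_of_herm_inject[symmetric] mat_of_herm_simps)
  show "norm A = sqrt (inner A A)"
    unfolding inner_herm_def norm_herm_def by (rule norm_eq_sqrt_inner)
qed

end

lemma ex_orthonormal_basis_herm:
  "\<exists>B :: 'n::finite herm set. B \<noteq> {} \<and> finite B
      \<and> (\<forall>u\<in>B. \<forall>v\<in>B. inner u v = (if u = v then 1 else 0))
      \<and> (\<forall>x. (\<forall>u\<in>B. inner x u = 0) \<longleftrightarrow> x = 0)"
proof -
  let ?S = "hermitian_mats :: (complex ^ 'n ^ 'n) set"
  obtain B where B: "B \<subseteq> ?S" "pairwise orthogonal B" "\<And>x. x \<in> B \<Longrightarrow> norm x = 1"
      "independent B" "card B = dim ?S" and span_B: "span B = ?S"
    by (rule orthonormal_basis_subspace[OF subspace_hermitian_mats]) blast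
  define B' where "B' = Herm ` B"
  have rep: "mat_of_herm (Herm b) = b" if "b \<in> B" for b
    using B(1) that by (auto simp: Herm_inverse)
  have 1: "inner (Herm u) (Herm v) = (if Herm u = Herm v then 1 else 0)"
    if "u \<in> B" "v \<in> B" for u v
  proof (cases "u = v")
    case True
    with that B(3) show ?thesis
      by (simp add: inner_herm_def rep dot_square_norm)
  next
    case False
    with that B(2) have "inner u v = 0"
      by (auto simp: pairwise_def orthogonal_def)
    moreover have "Herm u \<noteq> Herm v"
      using False rep that by metis
    ultimately show ?thesis
      using that by (simp add: inner_herm_def rep)
  qed
  have 2: "x = 0" if "\<forall>u\<in>B'. inner x u = 0" for x
  proof -
    have "\<forall>u\<in>B. orthogonal (mat_of_herm x) u"
      using that by (auto simp: B'_def inner_herm_def rep orthogonal_def)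
    then have "orthogonal (mat_of_herm x) (mat_of_herm x)"
      using orthogonal_to_span[of "mat_of_herm x" B "mat_of_herm x"] by (simp add: span_B)
    then show ?thesis
      by (simp add: orthogonal_def mat_of_herm_inject[symmetric] mat_of_herm_simps)
  qed
  have 3: "B \<noteq> {}"
  proof
    assume "B = {}"
    with span_B have "?S = {0}"
      by (metis span_empty)
    moreover have "(mat 1 :: complex ^ 'n ^ 'n) \<in> ?S"
      by (simp add: hermitian_mats_def ctranspose_def mat_def vec_eq_iff)
    ultimately have "(mat 1 :: complex ^ 'n ^ 'n) = 0"
      by blast
    then have "(mat 1 :: complex ^ 'n ^ 'n) $ undefined $ undefined = 0"
      by simp
    then show False
      by (simp add: mat_def)
  qed
  have 4: "B' \<noteq> {}" "finite B'"
    using 3 independent_imp_finite[OF B(4)] by (simp_all add: B'_def)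
  have 5: "\<forall>u\<in>B'. \<forall>v\<in>B'. inner u v = (if u = v then 1 else 0)"
    unfolding B'_def using 1 by blast
  have 6: "\<forall>x. (\<forall>u\<in>B'. inner x u = 0) \<longleftrightarrow> x = 0"
    using 2 by (metis inner_zero_left)
  from 4 5 6 show ?thesis
    by blast
qed

instantiation herm :: (finite) euclidean_space
begin

definition Basis_herm :: "'a herm set" where
  "Basis_herm = (SOME B. B \<noteq> {} \<and> finite B
      \<and> (\<forall>u\<in>B. \<forall>v\<in>B. inner u v = (if u = v then 1 else 0))
      \<and> (\<forall>x. (\<forall>u\<in>B. inner x u = 0) \<longleftrightarrow> x = 0))"

instance
proof
  note * = someI_ex[OF ex_orthonormal_basis_herm[where 'n = 'a], folded Basis_herm_def]
  show "(Basis :: 'a herm set) \<noteq> {}" "finite (Basis :: 'a herm set)"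
    using * by auto
  show "inner u v = (if u = v then 1 else 0)"
    if "u \<in> Basis" "v \<in> Basis" for u v :: "'a herm"
    using * that by blast
  show "(\<forall>u\<in>Basis. inner x u = 0) \<longleftrightarrow> x = 0" for x :: "'a herm"
    using * by blast
qed

end


section \<open>Riemannian geometry of an open subset of a Euclidean space\<close>

text \<open>
  Throughout, the manifold \<open>M\<close> is an open subset of a vector space \<open>'a\<close>, every tangent space is
  identified with \<open>'a\<close>, and a vector field is a map \<open>'a \<Rightarrow> 'a\<close> of which only the values on \<open>M\<close>
  matter. A Riemannian metric is a function \<open>g\<close> with \<open>g p u v = \<langle>u, v\<rangle>\<^sub>p\<close>.
\<close>

fun Ck_on :: "nat \<Rightarrow> 'a::euclidean_space set \<Rightarrow> ('a \<Rightarrow> 'b::real_normed_vector) \<Rightarrow> bool" where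
  "Ck_on 0 S f \<longleftrightarrow> continuous_on S f"
| "Ck_on (Suc k) S f \<longleftrightarrow> (\<forall>x\<in>S. f differentiable (at x))
      \<and> (\<forall>v. Ck_on k S (\<lambda>x. frechet_derivative f (at x) v))"

definition smooth_on :: "'a::euclidean_space set \<Rightarrow> ('a \<Rightarrow> 'b::real_normed_vector) \<Rightarrow> bool" where
  "smooth_on S f \<longleftrightarrow> (\<forall>k. Ck_on k S f)"

definition lie_bracket :: "('a \<Rightarrow> 'a) \<Rightarrow> ('a \<Rightarrow> 'a) \<Rightarrow> 'a \<Rightarrow> 'a::euclidean_space" where
  "lie_bracket X Y p =
     frechet_derivative Y (at p) (X p) - frechet_derivative X (at p) (Y p)"

text \<open>
  On an open subset of a vector space, every affine connection differs from the flat one by a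
  field \<open>\<Gamma>\<close> of bilinear maps (its Christoffel symbols), and conversely every smooth such field
  gives a connection. We represent a connection by \<open>\<Gamma>\<close>; \<open>cov_deriv \<Gamma> X Y\<close> is \<open>\<nabla>\<^sub>X Y\<close>.
\<close>

definition cov_deriv ::
    "('a \<Rightarrow> 'a \<Rightarrow> 'a \<Rightarrow> 'a) \<Rightarrow> ('a \<Rightarrow> 'a) \<Rightarrow> ('a \<Rightarrow> 'a) \<Rightarrow> 'a \<Rightarrow> 'a::euclidean_space" where
  "cov_deriv \<Gamma> X Y p = frechet_derivative Y (at p) (X p) + \<Gamma> p (X p) (Y p)"

definition affine_connection_on ::
    "'a::euclidean_space set \<Rightarrow> ('a \<Rightarrow> 'a \<Rightarrow> 'a \<Rightarrow> 'a) \<Rightarrow> bool" where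
  "affine_connection_on M \<Gamma> \<longleftrightarrow>
     (\<forall>p\<in>M. bilinear (\<Gamma> p)) \<and> (\<forall>u v. smooth_on M (\<lambda>p. \<Gamma> p u v))"

definition torsion_free_on ::
    "'a::euclidean_space set \<Rightarrow> ('a \<Rightarrow> 'a \<Rightarrow> 'a \<Rightarrow> 'a) \<Rightarrow> bool" where
  "torsion_free_on M \<Gamma> \<longleftrightarrow>
     (\<forall>X Y. smooth_on M X \<longrightarrow> smooth_on M Y \<longrightarrow>
        (\<forall>p\<in>M. cov_deriv \<Gamma> X Y p - cov_deriv \<Gamma> Y X p = lie_bracket X Y p))"

definition metric_compatible_on ::
    "'a::euclidean_space set \<Rightarrow> ('a \<Rightarrow> 'a \<Rightarrow> 'a \<Rightarrow> real) \<Rightarrow> ('a \<Rightarrow> 'a \<Rightarrow> 'a \<Rightarrow> 'a) \<Rightarrow> bool" where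
  "metric_compatible_on M g \<Gamma> \<longleftrightarrow>
     (\<forall>X Y Z. smooth_on M X \<longrightarrow> smooth_on M Y \<longrightarrow> smooth_on M Z \<longrightarrow>
        (\<forall>p\<in>M. frechet_derivative (\<lambda>q. g q (Y q) (Z q)) (at p) (X p) =
           g p (cov_deriv \<Gamma> X Y p) (Z p) + g p (Y p) (cov_deriv \<Gamma> X Z p)))"

text \<open>For a Riemannian metric \<open>g\<close>, the values of \<open>levi_civita M g\<close> at points of \<open>M\<close> are unique.\<close>

definition levi_civita ::
    "'a::euclidean_space set \<Rightarrow> ('a \<Rightarrow> 'a \<Rightarrow> 'a \<Rightarrow> real) \<Rightarrow> 'a \<Rightarrow> 'a \<Rightarrow> 'a \<Rightarrow> 'a" where
  "levi_civita M g =
     (SOME \<Gamma>. affine_connection_on M \<Gamma> \<and> torsion_free_on M \<Gamma> \<and> metric_compatible_on M g \<Gamma>)"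

text \<open>
  Covariant derivatives of a covector field \<open>\<omega>\<close> and of a 2-tensor field \<open>T\<close> in direction \<open>u\<close>,
  i.e. the Leibniz rule \<open>(\<nabla>\<^sub>u T)(v, w) = u(T(V, W)) - T(\<nabla>\<^sub>u V, w) - T(v, \<nabla>\<^sub>u W)\<close> evaluated on the
  constant vector fields \<open>V = v\<close> and \<open>W = w\<close>, for which \<open>\<nabla>\<^sub>u V = \<Gamma>\<^sub>p(u, v)\<close>.
\<close>

definition cov_deriv1 ::
    "('a \<Rightarrow> 'a \<Rightarrow> 'a \<Rightarrow> 'a) \<Rightarrow> ('a \<Rightarrow> 'a \<Rightarrow> real) \<Rightarrow> 'a::euclidean_space \<Rightarrow> 'a \<Rightarrow> 'a \<Rightarrow> real" where
  "cov_deriv1 \<Gamma> \<omega> p u v = frechet_derivative (\<lambda>q. \<omega> q v) (at p) u - \<omega> p (\<Gamma> p u v)"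

definition cov_deriv2 ::
    "('a \<Rightarrow> 'a \<Rightarrow> 'a \<Rightarrow> 'a) \<Rightarrow> ('a \<Rightarrow> 'a \<Rightarrow> 'a \<Rightarrow> real)
      \<Rightarrow> 'a::euclidean_space \<Rightarrow> 'a \<Rightarrow> 'a \<Rightarrow> 'a \<Rightarrow> real" where
  "cov_deriv2 \<Gamma> T p u v w =
     frechet_derivative (\<lambda>q. T q v w) (at p) u - T p (\<Gamma> p u v) w - T p v (\<Gamma> p u w)"

definition hessian ::
    "'a::euclidean_space set \<Rightarrow> ('a \<Rightarrow> 'a \<Rightarrow> 'a \<Rightarrow> real) \<Rightarrow> ('a \<Rightarrow> real)
      \<Rightarrow> 'a \<Rightarrow> 'a \<Rightarrow> 'a \<Rightarrow> real" where
  "hessian M g f = cov_deriv1 (levi_civita M g) (\<lambda>p. frechet_derivative f (at p))"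

definition third_cov_deriv ::
    "'a::euclidean_space set \<Rightarrow> ('a \<Rightarrow> 'a \<Rightarrow> 'a \<Rightarrow> real) \<Rightarrow> ('a \<Rightarrow> real)
      \<Rightarrow> 'a \<Rightarrow> 'a \<Rightarrow> 'a \<Rightarrow> 'a \<Rightarrow> real" where
  "third_cov_deriv M g f = cov_deriv2 (levi_civita M g) (hessian M g f)"

text \<open>The geodesic equation \<open>\<nabla>\<^bsub>\<gamma>'\<^esub> \<gamma>' = 0\<close> reads \<open>\<gamma>'' = - \<Gamma>\<^sub>\<gamma>(\<gamma>', \<gamma>')\<close>.\<close>

definition geodesic_on ::
    "real set \<Rightarrow> 'a::euclidean_space set \<Rightarrow> ('a \<Rightarrow> 'a \<Rightarrow> 'a \<Rightarrow> real) \<Rightarrow> (real \<Rightarrow> 'a) \<Rightarrow> bool" where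
  "geodesic_on I M g \<gamma> \<longleftrightarrow> \<gamma> ` I \<subseteq> M \<and>
     (\<exists>\<gamma>'. \<forall>t\<in>I. (\<gamma> has_vector_derivative \<gamma>' t) (at t within I) \<and>
        (\<gamma>' has_vector_derivative - levi_civita M g (\<gamma> t) (\<gamma>' t) (\<gamma>' t)) (at t within I))"

definition geodesically_convex_on ::
    "'a::euclidean_space set \<Rightarrow> ('a \<Rightarrow> 'a \<Rightarrow> 'a \<Rightarrow> real) \<Rightarrow> ('a \<Rightarrow> real) \<Rightarrow> bool" where
  "geodesically_convex_on M g f \<longleftrightarrow>
     (\<forall>\<gamma>. geodesic_on {0..1} M g \<gamma> \<longrightarrow> convex_on {0..1} (\<lambda>t. f (\<gamma> t)))"

definition self_concordant_on ::
    "'a::euclidean_space set \<Rightarrow> ('a \<Rightarrow> 'a \<Rightarrow> 'a \<Rightarrow> real) \<Rightarrow> real \<Rightarrow> ('a \<Rightarrow> real) \<Rightarrow> bool" where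
  "self_concordant_on M g \<alpha> f \<longleftrightarrow>
     \<alpha> > 0 \<and> smooth_on M f \<and> geodesically_convex_on M g f \<and>
     (\<forall>p\<in>M. \<forall>u v w. \<bar>third_cov_deriv M g f p u v w\<bar> \<le>
        2 / sqrt \<alpha> * sqrt (hessian M g f p u u) * sqrt (hessian M g f p v v)
          * sqrt (hessian M g f p w w))"


section \<open>The manifold of positive-definite matrices\<close>

text \<open>For a Hermitian matrix \<open>A\<close> the number \<open>x\<^sup>* A x\<close> is real.\<close>

definition PD :: "'n::finite herm set" where
  "PD = {A. \<forall>x. x \<noteq> 0 \<longrightarrow> 0 < Re (\<Sum>i\<in>UNIV. cnj (x $ i) * (mat_of_herm A *v x) $ i)}"

definition affine_inv_metric :: "'n::finite herm \<Rightarrow> 'n herm \<Rightarrow> 'n herm \<Rightarrow> real" where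
  "affine_inv_metric P U V =
     Re (trace (matrix_inv (mat_of_herm P) ** mat_of_herm U
             ** matrix_inv (mat_of_herm P) ** mat_of_herm V))"

text \<open>
  On square matrices \<open>*\<close> and \<open>^\<close> are componentwise, so powers are iterated from \<open>**\<close>.
\<close>

definition mat_exp :: "complex ^ 'n ^ 'n \<Rightarrow> complex ^ 'n ^ 'n::finite" where
  "mat_exp A = (\<Sum>k. (((**) A) ^^ k) (mat 1) /\<^sub>R fact k)"

text \<open>The logarithm on \<open>PD\<close> is the inverse of the bijection \<open>exp\<close> from Hermitian matrices to \<open>PD\<close>.\<close>

definition pd_log :: "'n::finite herm \<Rightarrow> 'n herm" where
  "pd_log A = (THE X. mat_exp (mat_of_herm X) = mat_of_herm A)"

definition pd_sqrt :: "'n::finite herm \<Rightarrow> 'n herm" where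
  "pd_sqrt A = (THE B. B \<in> PD \<and> mat_of_herm B ** mat_of_herm B = mat_of_herm A)"

text \<open>
  The norm on \<open>complex ^ 'n ^ 'n\<close>, hence the one on \<open>'n herm\<close>, is the Hilbert--Schmidt norm.
\<close>

definition pd_dist :: "'n::finite herm \<Rightarrow> 'n herm \<Rightarrow> real" where
  "pd_dist P Q =
     (let R = matrix_inv (mat_of_herm (pd_sqrt P))
      in norm (pd_log (Herm (R ** mat_of_herm Q ** R))))"

end

theory Submission
  imports Defs
begin

text \<open>
  Fix \<open>P0\<close> and \<open>P\<close> and diagonalise them simultaneously: \<open>P0 = k k\<^sup>*\<close> and \<open>P = k diag(p) k\<^sup>*\<close>
  with \<open>p\<^sub>a > 0\<close>. Put \<open>x\<^sub>a = ln p\<^sub>a\<close>; then the squared distance is the sum of the \<open>x\<^sub>a\<^sup>2\<close>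
  (\<open>pd_dist_power2\<close>). Tangent vectors \<open>U, V, W\<close> are written in the same basis, as matrices
  \<open>u, v, w\<close>.

  Eigenvalues and eigenvectors are awkward to differentiate. The logarithm of \<open>P P0\<^sup>-\<^sup>1\<close> is
  therefore written as the integral over \<open>t\<close> in \<open>[0, 1]\<close> of \<open>(P - P0) R\<^sub>t\<close>, where
  \<open>R\<^sub>t\<close> is the inverse of \<open>(1 - t) P0 + t P\<close>. The integrand is a rational function of \<open>P\<close>, so
  smoothness and all derivatives follow from matrix calculus under the integral sign, and the
  simultaneous diagonalisation is used only at a fixed point, to evaluate the formulas.

  The Levi-Civita connection has the Christoffel symbols \<open>- (U P\<^sup>-\<^sup>1 V + V P\<^sup>-\<^sup>1 U) / 2\<close>
  (\<open>levi_civita_PD\<close>). In the Hessian of the squared distance the terms containing the logarithm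
  cancel, and what remains is twice the integral of the real part of
  \<open>tr (P\<^sup>-\<^sup>1 P0 R\<^sub>t U R\<^sub>t V)\<close> (\<open>hessian_pd_dist\<close>). After rescaling \<open>u\<^sub>a\<^sub>b\<close> by
  \<open>(p\<^sub>a p\<^sub>b)\<^sup>-\<^sup>1\<^sup>/\<^sup>2\<close>, this is the quadratic form with weights
  \<open>\<phi>\<^sub>a\<^sub>b = (x\<^sub>a - x\<^sub>b) coth ((x\<^sub>a - x\<^sub>b) / 2)\<close>. The weights are positive, whence geodesic
  convexity.

  Differentiating once more, and again collecting the Christoffel terms, the third covariant
  derivative becomes the real part of the sum of \<open>\<kappa>\<^sub>a\<^sub>b\<^sub>c u\<^sub>a\<^sub>b v\<^sub>b\<^sub>c w\<^sub>c\<^sub>a\<close>. Here \<open>\<kappa>\<^sub>a\<^sub>b\<^sub>c\<close> is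
  the integral that gives \<open>\<phi>\<^sub>a\<^sub>b\<close> with the additional factor \<open>(1 - t - t p\<^sub>c) / (1 - t + t p\<^sub>c)\<close>,
  which lies between \<open>-1\<close> and \<open>1\<close> (\<open>third_kernel_identity\<close>). Hence
  \<open>\<bar>\<kappa>\<^sub>a\<^sub>b\<^sub>c\<bar> \<le> \<phi>\<^sub>a\<^sub>b\<close>. The function \<open>\<tau> coth (\<tau>/2)\<close> is at least \<open>2\<close> and lies
  between \<open>\<bar>\<tau>\<bar>\<close> and \<open>\<bar>\<tau>\<bar> + 2\<close>, so that
  \<open>\<phi>\<^sub>a\<^sub>b \<le> \<phi>\<^sub>b\<^sub>c + \<phi>\<^sub>c\<^sub>a + 2 \<le> 2 \<phi>\<^sub>b\<^sub>c \<phi>\<^sub>c\<^sub>a\<close> (\<open>coth_product_bound\<close>). Therefore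
  \<open>\<bar>\<kappa>\<^sub>a\<^sub>b\<^sub>c\<bar>\<close> is at most \<open>\<surd>2\<close> times the square root of \<open>\<phi>\<^sub>a\<^sub>b \<phi>\<^sub>b\<^sub>c \<phi>\<^sub>c\<^sub>a\<close>, and the
  Cauchy-Schwarz inequality, used twice, gives the claim with the constant \<open>\<surd>2 = 2 / \<surd>2\<close>.
\<close>

section \<open>Matrix algebra\<close>

lemma bounded_bilinear_matrix_mult:
  "bounded_bilinear ((**) :: complex^'n::finite^'m::finite \<Rightarrow> complex^'p::finite^'n \<Rightarrow> _)"
proof -
  have "bilinear ((**) :: complex^'n^'m \<Rightarrow> complex^'p^'n \<Rightarrow> _)"
    by (auto simp: bilinear_def linear_iff matrix_matrix_mult_def vec_eq_iff
        sum.distrib scaleR_sum_right algebra_simps)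
  then show ?thesis
    by (simp add: bilinear_conv_bounded_bilinear)
qed

lemma bounded_linear_trace: "bounded_linear (trace :: complex^'n::finite^'n \<Rightarrow> complex)"
proof -
  have "linear (trace :: complex^'n^'n \<Rightarrow> complex)"
    by (auto simp: linear_iff trace_def sum.distrib scaleR_sum_right)
  then show ?thesis
    by (rule linear_conv_bounded_linear[THEN iffD1])
qed

lemmas bounded_linear_Re_trace = bounded_linear_compose[OF bounded_linear_Re bounded_linear_trace]

interpretation mm: bounded_bilinear "(**) :: complex^'n::finite^'m::finite \<Rightarrow> complex^'p::finite^'n \<Rightarrow> _"
  by (rule bounded_bilinear_matrix_mult)

lemma ctranspose_add: "ctranspose (A + B) = ctranspose A + ctranspose B"
  by (simp add: ctranspose_def vec_eq_iff)

lemma ctranspose_scaleR: "ctranspose (r *\<^sub>R A) = r *\<^sub>R ctranspose A"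
  by (simp add: ctranspose_def vec_eq_iff)

lemma ctranspose_mult: "ctranspose (A ** B) = ctranspose B ** ctranspose A"
  by (simp add: ctranspose_def matrix_matrix_mult_def vec_eq_iff mult.commute)

lemma ctranspose_ctranspose [simp]: "ctranspose (ctranspose A) = A"
  by (simp add: ctranspose_def vec_eq_iff)

lemma ctranspose_mat_1 [simp]: "ctranspose (mat 1) = mat 1"
  by (simp add: ctranspose_def mat_def vec_eq_iff)

lemma trace_ctranspose: "trace (ctranspose A) = cnj (trace A)"
  by (simp add: trace_def ctranspose_def)

lemma matrix_inv_right:
  fixes A :: "complex^'n::finite^'n"
  assumes "invertible A"
  shows "A ** matrix_inv A = mat 1"
  using assms unfolding invertible_def matrix_inv_def by (rule someI2_ex) simp

lemma matrix_inv_left: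
  fixes A :: "complex^'n::finite^'n"
  assumes "invertible A"
  shows "matrix_inv A ** A = mat 1"
  using assms matrix_inv_right matrix_left_right_inverse by blast

lemma matrix_inv_unique:
  fixes A B :: "complex^'n::finite^'n"
  assumes "A ** B = mat 1"
  shows "matrix_inv A = B"
proof -
  have inv: "invertible A"
    using assms invertible_right_inverse by blast
  have "matrix_inv A = matrix_inv A ** (A ** B)"
    using assms by simp
  also have "\<dots> = (matrix_inv A ** A) ** B"
    by (simp only: matrix_mul_assoc)
  finally show ?thesis
    using inv by (simp add: matrix_inv_left)
qed

section \<open>Maps of class C^k on open sets\<close>

text \<open>
  Both maps have the same derivatives at the point, so the choice made by \<open>frechet_derivative\<close> is
  the same for both, even where there is no derivative.
\<close>

lemma frechet_derivative_cong_open: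
  assumes "open S" "x \<in> S" "\<And>y. y \<in> S \<Longrightarrow> f y = g y"
  shows "frechet_derivative f (at x) = frechet_derivative g (at x)"
proof -
  have "(f has_derivative D) (at x) \<longleftrightarrow> (g has_derivative D) (at x)" for D
    using has_derivative_transform_within_open[OF _ assms(1,2)] assms(3) by metis
  then show ?thesis
    by (simp add: frechet_derivative_def)
qed

lemma Ck_on_cong:
  assumes S: "open S" and "\<And>x. x \<in> S \<Longrightarrow> f x = g x" and "Ck_on k S f"
  shows "Ck_on k S g"
  using assms(2,3)
proof (induction k arbitrary: f g)
  case 0
  then show ?case
    by (simp cong: continuous_on_cong)
next
  case (Suc k)
  have "frechet_derivative f (at x) = frechet_derivative g (at x)" if "x \<in> S" for x
    using frechet_derivative_cong_open[OF S that] Suc.prems(1) by blast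
  moreover have "g differentiable (at x)" if "x \<in> S" for x
    using Suc.prems has_derivative_transform_within_open[OF _ S that] that
    unfolding Ck_on.simps differentiable_def by metis
  ultimately show ?case
    using Suc.prems(2) Suc.IH[of "\<lambda>x. frechet_derivative f (at x) v"
        "\<lambda>x. frechet_derivative g (at x) v" for v] by auto
qed

lemma Ck_on_SucI:
  assumes S: "open S"
    and f': "\<And>x. x \<in> S \<Longrightarrow> (f has_derivative f' x) (at x)"
    and Ck: "\<And>v. Ck_on k S (\<lambda>x. f' x v)"
  shows "Ck_on (Suc k) S f"
proof -
  have "f' x = frechet_derivative f (at x)" if "x \<in> S" for x
    using f'[OF that] by (rule frechet_derivative_at)
  then have "Ck_on k S (\<lambda>x. frechet_derivative f (at x) v)" for v
    using Ck_on_cong[OF S _ Ck[of v], of "\<lambda>x. frechet_derivative f (at x) v"] by simp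
  then show ?thesis
    using f' by (auto simp: differentiable_def)
qed

lemma Ck_on_derivative:
  assumes "Ck_on (Suc k) S f" "x \<in> S"
  shows "(f has_derivative frechet_derivative f (at x)) (at x)"
  using assms frechet_derivative_works by auto

lemma Ck_on_Suc_imp_Ck_on: "Ck_on (Suc k) S f \<Longrightarrow> Ck_on k S f"
proof (induction k arbitrary: f)
  case 0
  then have "\<forall>x\<in>S. isCont f x"
    using differentiable_imp_continuous_within by auto
  then show ?case
    by (simp add: continuous_at_imp_continuous_on)
next
  case (Suc k)
  have "f differentiable at x" if "x \<in> S" for x
    using Suc.prems that unfolding Ck_on.simps(2)[of "Suc k"] by blast
  moreover have "Ck_on k S (\<lambda>x. frechet_derivative f (at x) v)" for v
    using Suc.prems unfolding Ck_on.simps(2)[of "Suc k"] by (intro Suc.IH) blast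
  ultimately show ?case
    by simp
qed

lemma Ck_on_const: "Ck_on k S (\<lambda>x. c)"
  by (induction k arbitrary: c) (auto simp: frechet_derivative_const)

lemma Ck_on_bounded_linear:
  assumes S: "open S" and h: "bounded_linear h" and "Ck_on k S f"
  shows "Ck_on k S (\<lambda>x. h (f x))"
  using assms(3)
proof (induction k arbitrary: f)
  case 0
  then show ?case
    by (simp add: bounded_linear.continuous_on[OF h])
next
  case (Suc k)
  show ?case
  proof (rule Ck_on_SucI[OF S])
    show "((\<lambda>x. h (f x)) has_derivative (\<lambda>v. h (frechet_derivative f (at x) v))) (at x)"
      if "x \<in> S" for x
      using Ck_on_derivative[OF Suc.prems that] by (rule bounded_linear.has_derivative[OF h])
    show "Ck_on k S (\<lambda>x. h (frechet_derivative f (at x) v))" for v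
      using Suc.prems by (intro Suc.IH) simp
  qed
qed

lemma Ck_on_add:
  assumes S: "open S" and "Ck_on k S f" "Ck_on k S g"
  shows "Ck_on k S (\<lambda>x. f x + g x)"
  using assms(2,3)
proof (induction k arbitrary: f g)
  case 0
  then show ?case
    by (simp add: continuous_on_add)
next
  case (Suc k)
  show ?case
  proof (rule Ck_on_SucI[OF S])
    show "((\<lambda>x. f x + g x) has_derivative
        (\<lambda>v. frechet_derivative f (at x) v + frechet_derivative g (at x) v)) (at x)"
      if "x \<in> S" for x
      using Ck_on_derivative[OF Suc.prems(1) that] Ck_on_derivative[OF Suc.prems(2) that]
      by (rule has_derivative_add)
    show "Ck_on k S (\<lambda>x. frechet_derivative f (at x) v + frechet_derivative g (at x) v)" for v
      using Suc.prems by (intro Suc.IH) simp_all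
  qed
qed

text \<open>
  By the Leibniz rule the derivative is a sum of two products of the same kind, with factors of one
  class less.
\<close>

lemma Ck_on_bounded_bilinear:
  assumes S: "open S" and h: "bounded_bilinear h" and "Ck_on k S f" "Ck_on k S g"
  shows "Ck_on k S (\<lambda>x. h (f x) (g x))"
  using assms(3,4)
proof (induction k arbitrary: f g)
  case 0
  then show ?case
    by (simp add: bounded_bilinear.continuous_on[OF h])
next
  case (Suc k)
  have "Ck_on k S f" "Ck_on k S g"
    by (rule Ck_on_Suc_imp_Ck_on[OF Suc.prems(1)], rule Ck_on_Suc_imp_Ck_on[OF Suc.prems(2)])
  then have "Ck_on k S (\<lambda>x. h (f x) (frechet_derivative g (at x) v)
        + h (frechet_derivative f (at x) v) (g x))" for v
    using Suc.prems by (intro Ck_on_add[OF S] Suc.IH) auto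
  moreover have "((\<lambda>x. h (f x) (g x)) has_derivative (\<lambda>v. h (f x) (frechet_derivative g (at x) v)
        + h (frechet_derivative f (at x) v) (g x))) (at x)" if "x \<in> S" for x
    using Ck_on_derivative[OF Suc.prems(1) that] Ck_on_derivative[OF Suc.prems(2) that]
    by (rule bounded_bilinear.FDERIV[OF h])
  ultimately show ?case
    by (intro Ck_on_SucI[OF S])
qed

lemma Ck_on_linear:
  assumes "open S" "bounded_linear h"
  shows "Ck_on k S h"
proof (cases k)
  case 0
  then show ?thesis
    using assms by (simp add: linear_continuous_on)
next
  case (Suc m)
  have "Ck_on (Suc m) S h"
    using assms Ck_on_const
    by (intro Ck_on_SucI[where f' = "\<lambda>_. h"])
      (auto intro: bounded_linear_imp_has_derivative)
  then show ?thesis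
    using Suc by simp
qed

section \<open>Matrix inversion\<close>

text \<open>
  Multiplication by an invertible matrix is bounded below, and this persists for nearby matrices;
  so the inverses of nearby matrices stay bounded, from which continuity and then
  differentiability of inversion follow by the resolvent identity.
\<close>

lemma matrix_inv_bounded_near:
  fixes A :: "complex^'n::finite^'n"
  assumes A: "invertible A"
  obtains d C where "d > 0" "C > 0" 
    "\<And>B. dist B A < d \<Longrightarrow> invertible B \<and> norm (matrix_inv B) \<le> C"
proof -
  obtain K where K: "K > 0" "\<And>(X :: complex^'n^'n) (Y :: complex^'n^'n). norm (X ** Y) \<le> norm X * norm Y * K"
    using mm.pos_bounded by blast
  have "inj (\<lambda>X :: complex^'n^'n. A ** X)"
    using A by (metis (no_types, lifting) injI matrix_inv_left matrix_mul_assoc matrix_mul_lid)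
  moreover have "linear (\<lambda>X :: complex^'n^'n. A ** X)"
    by (rule bounded_linear.linear[OF mm.bounded_linear_right])
  ultimately obtain c where c: "c > 0" "\<And>X :: complex^'n^'n. c * norm X \<le> norm (A ** X)"
    using linear_inj_bounded_below_pos by blast
  have below: "c / 2 * norm X \<le> norm (B ** X)" if "dist B A < c / (2 * K)" for B X :: "complex^'n^'n"
  proof -
    have "norm ((A - B) ** X) \<le> norm (A - B) * norm X * K"
      by (rule K(2))
    also have "\<dots> \<le> c / (2 * K) * norm X * K"
      using that K(1) by (intro mult_right_mono) (auto simp: dist_norm norm_minus_commute)
    finally have "norm ((A - B) ** X) \<le> c / 2 * norm X"
      using K(1) by (simp add: field_simps)
    moreover have "norm (A ** X) \<le> norm (B ** X) + norm ((A - B) ** X)"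
      using norm_triangle_ineq[of "B ** X" "(A - B) ** X"] by (simp add: mm.diff_left)
    ultimately show ?thesis
      using c(2)[of X] by (simp add: field_simps)
  qed
  have "invertible B \<and> norm (matrix_inv B) \<le> 2 / c * norm (mat 1 :: complex^'n^'n)"
    if B: "dist B A < c / (2 * K)" for B
  proof
    have "linear (\<lambda>X :: complex^'n^'n. B ** X)"
      by (rule bounded_linear.linear[OF mm.bounded_linear_right])
    moreover have "inj (\<lambda>X :: complex^'n^'n. B ** X)"
    proof (subst linear_injective_0[OF calculation], intro allI impI)
      fix X :: "complex^'n^'n"
      assume "B ** X = 0"
      then show "X = 0"
        using below[OF B, of X] c(1) by (simp add: zero_le_mult_iff mult_le_0_iff)
    qed
    ultimately have "surj (\<lambda>X :: complex^'n^'n. B ** X)"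
      by (rule linear_inj_imp_surj)
    then obtain X where "B ** X = mat 1"
      by (metis surjD)
    then show inv: "invertible B"
      using invertible_right_inverse by blast
    show "norm (matrix_inv B) \<le> 2 / c * norm (mat 1 :: complex^'n^'n)"
      using below[OF B, of "matrix_inv B"] c(1) by (simp add: matrix_inv_right[OF inv] field_simps)
  qed
  moreover have "norm (mat 1 :: complex^'n^'n) > 0"
    by (auto simp: mat_def vec_eq_iff)
  ultimately show ?thesis
    using that[of "c / (2 * K)" "2 / c * norm (mat 1 :: complex^'n^'n)"] c(1) K(1) by simp
qed

lemma open_invertible: "open {A :: complex^'n::finite^'n. invertible A}"
  unfolding open_dist using matrix_inv_bounded_near by (metis mem_Collect_eq)

lemma matrix_inv_diff:
  fixes A B :: "complex^'n::finite^'n"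
  assumes "invertible A" "invertible B"
  shows "matrix_inv B - matrix_inv A = - (matrix_inv B ** (B - A) ** matrix_inv A)"
  using assms
  by (simp add: mm.diff_left mm.diff_right matrix_inv_left matrix_inv_right matrix_mul_assoc[symmetric])

lemma continuous_matrix_inv:
  fixes A :: "complex^'n::finite^'n"
  assumes A: "invertible A"
  shows "matrix_inv \<midarrow>A\<rightarrow> matrix_inv A"
proof -
  obtain d C where dC: "d > 0" "C > 0" 
    "\<And>B. dist B A < d \<Longrightarrow> invertible B \<and> norm (matrix_inv B) \<le> C"
    using matrix_inv_bounded_near[OF A] by blast
  obtain K where K: "K > 0" "\<And>(X :: complex^'n^'n) (Y :: complex^'n^'n). norm (X ** Y) \<le> norm X * norm Y * K"
    using mm.pos_bounded by blast
  have ev: "eventually (\<lambda>B. dist B A < d) (at A)"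
    using dC(1) unfolding eventually_at by auto
  have "((\<lambda>B. matrix_inv B - matrix_inv A) \<longlongrightarrow> 0) (at A)"
  proof (rule Lim_null_comparison)
    show "\<forall>\<^sub>F B in at A. norm (matrix_inv B - matrix_inv A)
        \<le> C * norm (B - A) * K * norm (matrix_inv A) * K"
      using ev
    proof eventually_elim
      case (elim B)
      note B = dC(3)[OF elim]
      have "norm (matrix_inv B - matrix_inv A) = norm (matrix_inv B ** (B - A) ** matrix_inv A)"
        using B A by (simp add: matrix_inv_diff)
      also have "\<dots> \<le> norm (matrix_inv B ** (B - A)) * norm (matrix_inv A) * K"
        by (rule K(2))
      also have "\<dots> \<le> (norm (matrix_inv B) * norm (B - A) * K) * norm (matrix_inv A) * K"
        by (intro mult_right_mono K(2)) (use K in auto)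
      also have "\<dots> \<le> (C * norm (B - A) * K) * norm (matrix_inv A) * K"
        using B by (intro mult_right_mono) (use K in auto)
      finally show ?case .
    qed
    show "((\<lambda>B. C * norm (B - A) * K * norm (matrix_inv A) * K) \<longlongrightarrow> 0) (at A)"
      by (rule tendsto_eq_intros LIM_zero tendsto_ident_at refl tendsto_norm_zero| simp)+
  qed
  then show ?thesis
    by (simp add: LIM_zero_iff)
qed

lemma has_derivative_matrix_inv:
  fixes A :: "complex^'n::finite^'n"
  assumes A: "invertible A"
  shows "(matrix_inv has_derivative (\<lambda>H. - (matrix_inv A ** H ** matrix_inv A))) (at A)"
  unfolding has_derivative_at_within
proof (intro conjI)
  show "bounded_linear (\<lambda>H. - (matrix_inv A ** H ** matrix_inv A))"
    by (intro bounded_linear_minus bounded_linear_compose[OF mm.bounded_linear_left]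
        mm.bounded_linear_right)
  obtain K where K: "K > 0" "\<And>(X :: complex^'n^'n) (Y :: complex^'n^'n). norm (X ** Y) \<le> norm X * norm Y * K"
    using mm.pos_bounded by blast
  have ev: "eventually (\<lambda>B. invertible B) (at A)"
    using topological_tendstoD[OF tendsto_ident_at open_invertible] A by simp
  show "((\<lambda>B. (matrix_inv B - matrix_inv A - - (matrix_inv A ** (B - A) ** matrix_inv A))
      /\<^sub>R norm (B - A)) \<longlongrightarrow> 0) (at A)"
  proof (rule Lim_null_comparison)
    show "\<forall>\<^sub>F B in at A. norm ((matrix_inv B - matrix_inv A - - (matrix_inv A ** (B - A) ** matrix_inv A))
      /\<^sub>R norm (B - A)) \<le> norm (matrix_inv A - matrix_inv B) * K * norm (matrix_inv A) * K"
      using ev eventually_neq_at_within[of A A UNIV]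
    proof eventually_elim
      case (elim B)
      have "matrix_inv B - matrix_inv A - - (matrix_inv A ** (B - A) ** matrix_inv A)
          = (matrix_inv A - matrix_inv B) ** (B - A) ** matrix_inv A"
        using matrix_inv_diff[OF A elim(1)] by (simp add: mm.diff_left)
      also have "norm \<dots> \<le> norm ((matrix_inv A - matrix_inv B) ** (B - A)) * norm (matrix_inv A) * K"
        by (rule K(2))
      also have "\<dots> \<le> (norm (matrix_inv A - matrix_inv B) * norm (B - A) * K) * norm (matrix_inv A) * K"
        by (intro mult_right_mono K(2)) (use K in auto)
      finally show ?case
        using elim by (subst norm_scaleR) (simp add: field_simps)
    qed
    have "((\<lambda>B. matrix_inv A - matrix_inv B) \<longlongrightarrow> 0) (at A)"
      using tendsto_diff[OF tendsto_const continuous_matrix_inv[OF A], of "matrix_inv A"] by simp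
    then show "((\<lambda>B. norm (matrix_inv A - matrix_inv B) * K * norm (matrix_inv A) * K) \<longlongrightarrow> 0) (at A)"
      by (intro tendsto_mult_left_zero tendsto_norm_zero)
  qed
qed

lemma has_derivative_matrix_inv_compose:
  fixes A :: "'a::real_normed_vector \<Rightarrow> complex^'n::finite^'n"
  assumes "(A has_derivative A') (at x within S)" "invertible (A x)"
  shows "((\<lambda>x. matrix_inv (A x)) has_derivative
    (\<lambda>v. - (matrix_inv (A x) ** A' v ** matrix_inv (A x)))) (at x within S)"
  using has_derivative_compose[OF assms(1) has_derivative_matrix_inv[OF assms(2)]] .

text \<open>
  The derivative of the inverse is built from the inverse itself and the derivative of \<open>A\<close>, so each
  derivative of \<open>A\<close> gains one derivative of the inverse.
\<close>

lemma Ck_on_matrix_inv: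
  fixes A :: "'a::euclidean_space \<Rightarrow> complex^'n::finite^'n"
  assumes S: "open S" and inv: "\<And>x. x \<in> S \<Longrightarrow> invertible (A x)" and "Ck_on k S A"
  shows "Ck_on k S (\<lambda>x. matrix_inv (A x))"
  using assms(3)
proof (induction k)
  case 0
  show ?case
    unfolding Ck_on.simps continuous_on_def
  proof
    fix x assume x: "x \<in> S"
    have "isCont matrix_inv (A x)"
      using continuous_matrix_inv[OF inv[OF x]] by (simp add: isCont_def)
    moreover have "(A \<longlongrightarrow> A x) (at x within S)"
      using 0 x by (simp add: continuous_on_def)
    ultimately show "((\<lambda>x. matrix_inv (A x)) \<longlongrightarrow> matrix_inv (A x)) (at x within S)"
      by (rule isCont_tendsto_compose)
  qed
next
  case (Suc k)
  note IH = Suc.IH[OF Ck_on_Suc_imp_Ck_on[OF Suc.prems]]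
  have "Ck_on k S (\<lambda>x. frechet_derivative A (at x) v)" for v
    using Suc.prems by simp
  then have "Ck_on k S (\<lambda>x. - (matrix_inv (A x) ** frechet_derivative A (at x) v ** matrix_inv (A x)))" for v
    using IH by (intro Ck_on_bounded_linear[OF S bounded_linear_minus[OF bounded_linear_ident]]
      Ck_on_bounded_bilinear[OF S bounded_bilinear_matrix_mult])
  with has_derivative_matrix_inv_compose[OF Ck_on_derivative[OF Suc.prems] inv]
  show ?case
    by (rule Ck_on_SucI[OF S])
qed

section \<open>Integrals depending on a parameter\<close>

lemma has_derivative_integral_parameter:
  fixes G :: "real \<times> 'a::euclidean_space \<Rightarrow> 'b::euclidean_space"
  assumes S: "open S" and sub: "{0..1} \<times> S \<subseteq> W" and G: "Ck_on (Suc 0) W G" and x: "x \<in> S"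
  shows "((\<lambda>x. integral {0..1} (\<lambda>t. G (t, x))) has_derivative
    (\<lambda>v. integral {0..1} (\<lambda>t. frechet_derivative G (at (t, x)) (0, v)))) (at x)"
proof -
  obtain e where e: "e > 0" "ball x e \<subseteq> S"
    using S x openE by blast
  define D where "D y t = Blinfun (\<lambda>v. frechet_derivative G (at (t, y)) (0, v))" for y t
  have G': "(G has_derivative frechet_derivative G (at (t, y))) (at (t, y))"
    if "y \<in> S" "t \<in> {0..1}" for y t
    using Ck_on_derivative[OF G] sub that by blast
  have G2: "((\<lambda>y. G (t, y)) has_derivative (\<lambda>v. frechet_derivative G (at (t, y)) (0, v))) (at y)"
    if "y \<in> S" "t \<in> {0..1}" for y t
    using has_derivative_compose[OF has_derivative_Pair[OF has_derivative_const has_derivative_ident]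
        G'[OF that]] .
  have D: "blinfun_apply (D y t) = (\<lambda>v. frechet_derivative G (at (t, y)) (0, v))"
    if "y \<in> S" "t \<in> {0..1}" for y t
    unfolding D_def using has_derivative_bounded_linear[OF G2[OF that]]
    by (rule bounded_linear_Blinfun_apply)
  have contG: "continuous_on {0..1} (\<lambda>t. G (t, y))" if "y \<in> S" for y
    using Ck_on_Suc_imp_Ck_on[OF G] sub that
    by (auto intro!: continuous_on_compose2[of W G] continuous_intros)
  have cont: "continuous_on (S \<times> {0..1}) (\<lambda>(y, t). D y t)"
  proof (rule continuous_on_blinfun_componentwise)
    fix i :: 'a
    have "continuous_on W (\<lambda>z. frechet_derivative G (at z) (0, i))"
      using G by auto
    then have "continuous_on (S \<times> {0..1}) (\<lambda>p. frechet_derivative G (at (snd p, fst p)) (0, i))"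
      by (rule continuous_on_compose2) (use sub in \<open>auto intro!: continuous_intros\<close>)
    then show "continuous_on (S \<times> {0..1}) (\<lambda>p. blinfun_apply (case p of (y, t) \<Rightarrow> D y t) i)"
      by (rule continuous_on_eq) (auto simp: D)
  qed
  have *: "((\<lambda>x. integral (cbox 0 1) (\<lambda>t. G (t, x))) has_derivative
      blinfun_apply (integral (cbox 0 1) (D x))) (at x within ball x e)"
  proof (rule leibniz_rule)
    show "((\<lambda>x. G (t, x)) has_derivative blinfun_apply (D y t)) (at y within ball x e)"
      if "y \<in> ball x e" "t \<in> cbox 0 1" for y t
    proof -
      have y: "y \<in> S" "t \<in> {0..1}"
        using that e(2) by auto
      show ?thesis
        unfolding D[OF y] by (rule has_derivative_at_withinI[OF G2[OF y]])
    qed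
    show "(\<lambda>t. G (t, y)) integrable_on cbox 0 1" if "y \<in> ball x e" for y
      using contG[OF subsetD[OF e(2) that]] by (auto intro: integrable_continuous_real)
    show "continuous_on (ball x e \<times> cbox 0 1) (\<lambda>(y, t). D y t)"
      by (rule continuous_on_subset[OF cont]) (use e(2) in auto)
  qed (use e in auto)
  have "blinfun_apply (integral (cbox 0 1) (D x)) v
      = integral {0..1} (\<lambda>t. frechet_derivative G (at (t, x)) (0, v))" for v
  proof -
    have "continuous_on {0..1} (D x)"
    proof -
      have "continuous_on {0..1} (\<lambda>t. case (x, t) of (y, t) \<Rightarrow> D y t)"
        by (rule continuous_on_compose2[OF cont continuous_on_Pair[OF continuous_on_const
            continuous_on_id]]) (use x in auto)
      then show ?thesis by simp
    qed
    then have "blinfun_apply (integral {0..1} (D x)) v = integral {0..1} (\<lambda>t. blinfun_apply (D x t) v)"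
      by (intro blinfun_apply_integral integrable_continuous_real)
    also have "\<dots> = integral {0..1} (\<lambda>t. frechet_derivative G (at (t, x)) (0, v))"
      by (rule integral_cong) (simp add: D x)
    finally show ?thesis by simp
  qed
  then have "blinfun_apply (integral (cbox 0 1) (D x))
      = (\<lambda>v. integral {0..1} (\<lambda>t. frechet_derivative G (at (t, x)) (0, v)))"
    by (rule ext)
  with * show ?thesis
    using e(1) by (simp add: at_within_open[of x "ball x e"])
qed

text \<open>
  The integrand is a map on an open subset of the product space. Its derivative in a direction
  \<open>(0, v)\<close> is then an integrand of the same kind, which lets the induction on \<open>k\<close> go through.
\<close>

lemma Ck_on_integral:
  fixes G :: "real \<times> 'a::euclidean_space \<Rightarrow> 'b::euclidean_space"
  assumes S: "open S" and sub: "{0..1} \<times> S \<subseteq> W" and "Ck_on k W G"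
  shows "Ck_on k S (\<lambda>x. integral {0..1} (\<lambda>t. G (t, x)))"
  using assms(3)
proof (induction k arbitrary: G)
  case 0
  have "continuous_on (S \<times> cbox 0 1) (\<lambda>(x, t). G (t, x))"
    unfolding split_beta
    by (rule continuous_on_compose2[of W G]) (use 0 sub in \<open>auto intro!: continuous_intros\<close>)
  then show ?case
    using integral_continuous_on_param[of S 0 1 "\<lambda>x t. G (t, x)"] by simp
next
  case (Suc k)
  have G1: "Ck_on (Suc 0) W G"
    using Suc.prems
  proof (induction k)
    case (Suc k)
    show ?case
      by (rule Suc.IH[OF Ck_on_Suc_imp_Ck_on[OF Suc.prems]])
  qed
  show ?case
  proof (rule Ck_on_SucI[OF S has_derivative_integral_parameter[OF S sub G1]])
    show "Ck_on k S (\<lambda>x. integral {0..1} (\<lambda>t. frechet_derivative G (at (t, x)) (0, v)))" for v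
      using Suc.IH[of "\<lambda>z. frechet_derivative G (at z) (0, v)"] Suc.prems by simp
  qed 
qed

section \<open>Simultaneous diagonalisation of Hermitian matrices\<close>

definition hform :: "complex^'n^'n \<Rightarrow> complex^'n \<Rightarrow> complex^'n \<Rightarrow> complex" where
  "hform A x y = (\<Sum>i\<in>UNIV. cnj (x $ i) * (A *v y) $ i)"

definition diagm :: "('n \<Rightarrow> real) \<Rightarrow> complex^'n^'n" where
  "diagm d = (\<chi> i j. if i = j then of_real (d i) else 0)"

lemma hform_add_left: "hform A (x + y) z = hform A x z + hform A y z"
  by (simp add: hform_def sum.distrib ring_distribs)

lemma hform_add_right: "hform A x (y + z) = hform A x y + hform A x z"
  by (simp add: hform_def sum.distrib ring_distribs matrix_vector_right_distrib)

lemma hform_diff_right: "hform A x (y - z) = hform A x y - hform A x z"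
  by (simp add: hform_def sum_subtractf ring_distribs matrix_vector_mult_diff_distrib)

lemma hform_scale_left: "hform A (c *s x) y = cnj c * hform A x y"
  by (simp add: hform_def sum_distrib_left mult_ac)

lemma hform_scale_right: "hform A x (c *s y) = c * hform A x y"
  by (simp add: hform_def sum_distrib_left matrix_vector_mult_def mult_ac)

lemma hform_zero_right [simp]: "hform A x 0 = 0"
  by (simp add: hform_def)

lemma hform_sum_right: "hform A x (\<Sum>i\<in>S. f i) = (\<Sum>i\<in>S. hform A x (f i))"
  by (induction S rule: infinite_finite_induct) (simp_all add: hform_add_right)

lemma hform_diff_matrix: "hform (A - B) x y = hform A x y - hform B x y"
  by (simp add: hform_def matrix_vector_mult_diff_rdistrib ring_distribs sum_subtractf)

lemma scaleR_matrix_vector_mult: "(r *\<^sub>R A) *v y = complex_of_real r *s (A *v y)"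
  unfolding vec_eq_iff vector_smult_component matrix_vector_mult_def
  by (simp only: vec_lambda_beta vector_scaleR_component sum_distrib_left)
    (simp add: scaleR_conv_of_real mult.assoc)

lemma hform_scaleR_matrix: "hform (r *\<^sub>R A) x y = of_real r * hform A x y"
  by (simp add: hform_def scaleR_matrix_vector_mult sum_distrib_left mult_ac)

lemma hform_scaleR_right: "hform A x (r *\<^sub>R y) = r *\<^sub>R hform A x y"
proof -
  have "(A *v (r *\<^sub>R y)) $ i = of_real r * (A *v y) $ i" for i
    by (simp only: matrix_vector_mult_def vec_lambda_beta vector_scaleR_component sum_distrib_left)
      (simp add: scaleR_conv_of_real mult_ac)
  then show ?thesis
    by (simp add: hform_def sum_distrib_left mult_ac scaleR_conv_of_real)
qed

lemma hform_commute:
  assumes "ctranspose A = A"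
  shows "hform A y x = cnj (hform A x y)"
proof -
  have "cnj (A $ i $ j) = A $ j $ i" for i j
    using assms by (metis (no_types, lifting) ctranspose_def vec_lambda_beta)
  then have "cnj (hform A x y) = (\<Sum>i\<in>UNIV. \<Sum>j\<in>UNIV. cnj (y $ j) * A $ j $ i * x $ i)"
    by (simp add: hform_def matrix_vector_mult_def sum_distrib_left mult_ac)
  also have "\<dots> = hform A y x"
    by (subst sum.swap) (simp add: hform_def matrix_vector_mult_def sum_distrib_left mult_ac)
  finally show ?thesis ..
qed

lemma Re_hform: "Re (hform A x y) = x \<bullet> (A *v y)"
  by (simp add: hform_def inner_vec_def inner_complex_def)

lemma hform_diag_real:
  assumes "ctranspose A = A"
  shows "hform A x x = of_real (Re (hform A x x))"
  using hform_commute[OF assms, of x x] by (simp add: complex_eq_iff)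

text \<open>
  Congruence by \<open>h\<close> yields the Gram matrix of the form on the columns of \<open>h\<close>.
\<close>

lemma congruence_nth: "(ctranspose h ** A ** h) $ i $ j = hform A (column i h) (column j h)"
  unfolding matrix_mul_assoc[symmetric]
  by (simp add: hform_def matrix_matrix_mult_def matrix_vector_mult_def ctranspose_def column_def)

text \<open>
  A vector on which a form that is non-negative on a subspace vanishes is orthogonal to that
  subspace: otherwise the form would become negative along a suitable direction.
\<close>

lemma semidefinite_null_orthogonal:
  fixes Q :: "complex^'n::finite^'n"
  assumes Q: "ctranspose Q = Q"
    and nonneg: "\<And>c. Re (hform Q (x + c *s y) (x + c *s y)) \<ge> 0"
    and null: "hform Q x x = 0"
  shows "hform Q y x = 0"
proof -
  define z where "z = hform Q y x"
  define q where "q = Re (hform Q y y)"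
  define s where "s = 1 / (\<bar>q\<bar> + 1)"
  have s: "s > 0" "s * q < 2"
    by (auto simp: s_def field_simps)
  have cz: "(cmod z)\<^sup>2 = Re z * Re z + Im z * Im z"
    using cmod_power2[of z] by (simp only: power2_eq_square)
  have "0 \<le> Re (hform Q (x + (- (of_real s * z)) *s y) (x + (- (of_real s * z)) *s y))"
    by (rule nonneg)
  also have "\<dots> = (s * q - 2) * (s * (cmod z)\<^sup>2)"
    using hform_commute[OF Q, of x y] hform_diag_real[OF Q, of y] null
    unfolding hform_add_left hform_add_right hform_scale_left hform_scale_right cz
    by (simp add: z_def[symmetric] q_def[symmetric] algebra_simps)
  finally have "s * (cmod z)\<^sup>2 \<le> 0"
    using s(2) by (simp add: zero_le_mult_iff)
  then show ?thesis
    using s(1) by (simp add: mult_le_0_iff z_def)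
qed

text \<open>
  The values of the forms \<open>hform A (v i)\<close> are the coordinates of a linear endomorphism whose
  \<open>j\<close>-th coordinate vanishes. It is not surjective and hence not injective.
\<close>

lemma ex_nonzero_orthogonal:
  fixes A :: "complex^'n::finite^'n" and S :: "'n set"
  assumes "j \<notin> S"
  obtains x where "x \<noteq> 0" "\<And>i. i \<in> S \<Longrightarrow> hform A (v i) x = 0"
proof -
  define f :: "complex^'n \<Rightarrow> complex^'n"
    where "f x = (\<chi> i. if i \<in> S then hform A (v i) x else 0)" for x
  have "linear f"
    by (auto simp: linear_iff f_def vec_eq_iff hform_add_right hform_scaleR_right)
  moreover have "\<not> surj f"
  proof
    assume "surj f"
    then obtain x where "f x = axis j 1"
      by (metis surjD)
    then have "f x $ j = 1"
      by simp
    then show False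
      using assms by (simp add: f_def)
  qed
  ultimately have "\<not> inj f"
    using linear_inj_imp_surj by blast
  then obtain x where x: "f x = 0" "x \<noteq> 0"
    using linear_injective_0[OF \<open>linear f\<close>] by blast
  have "hform A (v i) x = 0" if "i \<in> S" for i
    using x(1) that by (simp add: f_def vec_eq_iff split: if_splits) 
  with x(2) show ?thesis
    using that by blast
qed

text \<open>
  The next eigenvector of the pencil \<open>(A, B)\<close> maximises the Rayleigh quotient of \<open>A\<close> relative to
  \<open>B\<close> among the vectors that are \<open>B\<close>-orthogonal to the eigenvectors found so far.
\<close>

lemma pencil_eigenvectors:
  fixes A B :: "complex^'n::finite^'n" and S :: "'n set"
  assumes A: "ctranspose A = A" and B: "ctranspose B = B"
    and pos: "\<And>x. x \<noteq> 0 \<Longrightarrow> 0 < Re (hform B x x)"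
    and "finite S"
  shows "\<exists>v d. \<forall>i\<in>S. A *v v i = of_real (d i) *s (B *v v i) \<and>
           (\<forall>j\<in>S. hform B (v i) (v j) = (if i = j then 1 else 0))"
  using assms(4)
proof (induction S)
  case empty
  then show ?case by simp
next
  case (insert j S)
  then obtain v d where v: "\<And>i. i \<in> S \<Longrightarrow> A *v v i = of_real (d i) *s (B *v v i)"
    and orth: "\<And>i k. i \<in> S \<Longrightarrow> k \<in> S \<Longrightarrow> hform B (v i) (v k) = (if i = k then 1 else 0)"
    by blast
  define W where "W = {x. \<forall>i\<in>S. hform B (v i) x = 0}"
  have W_add: "x + c *s y \<in> W" if "x \<in> W" "y \<in> W" for x y c
    using that by (simp add: W_def hform_add_right hform_scale_right)
  have W_scaleR: "r *\<^sub>R x \<in> W" if "x \<in> W" for x r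
    using that by (simp add: W_def hform_scaleR_right)
  define R where "R x = Re (hform A x x) / Re (hform B x x)" for x
  have [continuous_intros]: "continuous_on X (\<lambda>x. (M *v x) $ i)" for X i and M :: "complex^'n^'n"
    by (intro continuous_on_component linear_continuous_on matrix_vector_mul_bounded_linear)
  have "closed W"
  proof -
    have "W = (\<Inter>i\<in>S. {x. hform B (v i) x = 0})"
      by (auto simp: W_def)
    then show ?thesis
      unfolding hform_def
      by (auto intro!: closed_INT closed_Collect_eq continuous_intros simp only:)
  qed
  then have "compact (W \<inter> sphere 0 1)"
    by (intro closed_Int_compact) auto
  moreover have "W \<inter> sphere 0 1 \<noteq> {}"
  proof -
    obtain x where x: "x \<noteq> 0" "\<And>i. i \<in> S \<Longrightarrow> hform B (v i) x = 0"
      using ex_nonzero_orthogonal[OF insert.hyps(2)] by metis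
    then have "(1 / norm x) *\<^sub>R x \<in> W \<inter> sphere 0 1"
      by (intro IntI W_scaleR) (auto simp: W_def)
    then show ?thesis by blast
  qed
  moreover have "continuous_on (W \<inter> sphere 0 1) R"
    unfolding R_def Re_hform
    by (intro continuous_intros linear_continuous_on matrix_vector_mul_bounded_linear)
      (metis IntE Re_hform less_numeral_extra(3) norm_zero pos sphere_def mem_sphere_0 zero_neq_one)
  ultimately obtain x where x': "x \<in> W \<inter> sphere 0 1" "\<forall>y\<in>W \<inter> sphere 0 1. R y \<le> R x"
    using continuous_attains_sup[of "W \<inter> sphere 0 1" R] by metis
  then have x: "x \<in> W" "norm x = 1"
    by auto
  have max: "R y \<le> R x" if "y \<in> W" "norm y = 1" for y
    using x'(2) that by auto
  \<comment> \<open>The form of \<open>Q\<close> is non-negative on \<open>W\<close> and vanishes at the maximiser \<open>x\<close>.\<close>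
  define Q where "Q = R x *\<^sub>R B - A"
  have "x \<noteq> 0"
    using x(2) by auto
  have Q: "ctranspose Q = Q"
    using A B by (simp add: Q_def ctranspose_def vec_eq_iff)
  have hQ: "hform Q y z = of_real (R x) * hform B y z - hform A y z" for y z
    by (simp add: Q_def hform_diff_matrix hform_scaleR_matrix)
  have nonneg: "Re (hform Q y y) \<ge> 0" if "y \<in> W" for y
  proof (cases "y = 0")
    case False
    define u where "u = (1 / norm y) *\<^sub>R y"
    have "R u = R y"
      using False unfolding R_def u_def Re_hform inner_scaleR_left
      unfolding Re_hform[symmetric] hform_scaleR_right by simp
    moreover have "R u \<le> R x"
      using False that by (intro max) (auto simp: u_def W_scaleR)
    ultimately have "Re (hform A y y) / Re (hform B y y) \<le> R x"
      by (simp add: R_def)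
    then show ?thesis
      using pos[OF False] by (simp add: hQ field_simps)
  qed (simp add: hform_def)
  have "Re (hform Q x x) = 0"
    using pos[OF \<open>x \<noteq> 0\<close>] by (simp add: hQ R_def)
  then have null: "hform Q x x = 0"
    using hform_diag_real[OF Q, of x] by simp
  have orthW: "hform Q y x = 0" if "y \<in> W" for y
    by (rule semidefinite_null_orthogonal[OF Q nonneg[OF W_add[OF x(1) that]] null])
  have orthv: "hform Q (v i) x = 0" if "i \<in> S" for i
  proof -
    have "hform A x (v i) = of_real (d i) * hform B x (v i)"
      using v[OF that] by (simp add: hform_def sum_distrib_left mult_ac)
    moreover have "hform B x (v i) = 0" "hform B (v i) x = 0"
      using x(1) that hform_commute[OF B, of "v i" x] by (simp_all add: W_def)
    ultimately show ?thesis
      using hform_commute[OF A, of "v i" x] by (simp add: hQ)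
  qed
  have "hform Q y x = 0" for y
  proof -
    \<comment> \<open>Every vector is the sum of a vector in \<open>W\<close> and a combination of the eigenvectors found so far.\<close>
    define w where "w = y - (\<Sum>i\<in>S. hform B (v i) y *s v i)"
    have "w \<in> W"
      unfolding W_def mem_Collect_eq
    proof
      fix k assume k: "k \<in> S"
      have "(\<Sum>i\<in>S. hform B (v i) y * (if k = i then 1 else 0)) = hform B (v k) y"
        using k insert.hyps(1) by (simp add: if_distrib cong: if_cong)
      then show "hform B (v k) w = 0"
        using k orth by (simp add: w_def hform_diff_right hform_sum_right hform_scale_right)
    qed
    have "hform Q x w = 0"
      using orthW[OF \<open>w \<in> W\<close>] hform_commute[OF Q, of w x] by simp
    moreover have "hform Q x (v i) = 0" if "i \<in> S" for i
      using orthv[OF that] hform_commute[OF Q, of "v i" x] by simp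
    ultimately have "hform Q x y = 0"
      by (simp add: w_def hform_diff_right hform_sum_right hform_scale_right)
    then show ?thesis
      using hform_commute[OF Q, of x y] by simp
  qed
  from this[of "Q *v x"] have "Q *v x = 0"
    by (metis Re_hform inner_eq_zero_iff zero_complex.sel(1))
  then have eig: "A *v x = of_real (R x) *s (B *v x)"
    by (simp add: Q_def matrix_vector_mult_diff_rdistrib scaleR_matrix_vector_mult)
  define b where "b = Re (hform B x x)"
  have b: "b > 0" "hform B x x = of_real b"
    using pos[OF \<open>x \<noteq> 0\<close>] hform_diag_real[OF B, of x] by (simp_all add: b_def)
  define c where "c = complex_of_real (1 / sqrt b)"
  have c: "cnj c = c" "c * (c * of_real b) = 1"
    using b(1) by (simp_all add: c_def flip: of_real_mult)
  define v' where "v' = v(j := c *s x)"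
  define d' where "d' = d(j := R x)"
  have "A *v v' i = of_real (d' i) *s (B *v v' i)" if "i \<in> insert j S" for i
    using that v eig insert.hyps(2)
    by (auto simp: v'_def d'_def vector_scalar_commute mult_ac vec_eq_iff)
  moreover have "hform B (v' i) (v' k) = (if i = k then 1 else 0)"
    if "i \<in> insert j S" "k \<in> insert j S" for i k
  proof -
    have "hform B (v i) x = 0" "hform B x (v i) = 0" if "i \<in> S" for i
      using x(1) that hform_commute[OF B, of "v i" x] by (simp_all add: W_def)
    then show ?thesis
      using that orth insert.hyps(2) b(2) c
      by (auto simp: v'_def hform_scale_left hform_scale_right)
  qed
  ultimately show ?case
    by blast
qed

text \<open>
  The columns of \<open>h\<close> are a full system of \<open>B\<close>-orthonormal eigenvectors of the pencil.
\<close>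

theorem simultaneous_diagonalisation:
  fixes A B :: "complex^'n::finite^'n"
  assumes "ctranspose A = A" "ctranspose B = B"
    and "\<And>x. x \<noteq> 0 \<Longrightarrow> 0 < Re (hform B x x)"
  obtains h :: "complex^'n^'n" and d where "ctranspose h ** B ** h = mat 1" "ctranspose h ** A ** h = diagm d"
proof -
  have "\<exists>(v :: 'n \<Rightarrow> _) d. \<forall>i\<in>UNIV. A *v v i = of_real (d i) *s (B *v v i) \<and>
           (\<forall>j\<in>UNIV. hform B (v i) (v j) = (if i = j then 1 else 0))"
    by (rule pencil_eigenvectors) (use assms in auto)
  then obtain v :: "'n \<Rightarrow> complex^'n" and d where v: "\<And>i. A *v v i = of_real (d i) *s (B *v v i)"
    and orth: "\<And>i j. hform B (v i) (v j) = (if i = j then 1 else 0)"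
    by blast
  define h :: "complex^'n^'n" where "h = (\<chi> a i. v i $ a)"
  have h: "column i h = v i" for i
    by (simp add: h_def column_def vec_eq_iff)
  have "hform A (v i) (v j) = of_real (d j) * hform B (v i) (v j)" for i j
    using v[of j] by (simp add: hform_def sum_distrib_left mult_ac)
  then have "ctranspose h ** A ** h = diagm d"
    by (auto simp: vec_eq_iff congruence_nth h orth diagm_def)
  moreover have "ctranspose h ** B ** h = mat 1"
    by (auto simp: vec_eq_iff congruence_nth h orth mat_def)
  ultimately show ?thesis
    using that by blast
qed

section \<open>Positive-definite matrices\<close>

lemma diagm_nth: "diagm d $ i $ j = (if i = j then of_real (d i) else 0)"
  by (simp add: diagm_def)

lemma diagm_mult_nth: "(diagm d ** X) $ i $ j = of_real (d i) * X $ i $ j"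
  for X :: "complex^'n::finite^'n"
  by (simp add: diagm_def matrix_matrix_mult_def if_distrib[of "\<lambda>c. c * _"] cong: if_cong)

lemma mult_diagm_nth: "(X ** diagm d) $ i $ j = X $ i $ j * of_real (d j)"
  for X :: "complex^'n::finite^'n"
  by (simp add: diagm_def matrix_matrix_mult_def if_distrib cong: if_cong)

lemma diagm_mult: "diagm a ** diagm b = diagm (\<lambda>i :: 'n::finite. a i * b i)"
  by (simp add: vec_eq_iff diagm_mult_nth diagm_nth)

lemma ctranspose_diagm [simp]: "ctranspose (diagm d) = diagm d"
  by (simp add: ctranspose_def diagm_def vec_eq_iff)

lemma diagm_one: "diagm (\<lambda>i. 1) = mat 1"
  by (simp add: vec_eq_iff diagm_nth mat_def)

lemma bounded_linear_mat_of_herm: "bounded_linear (mat_of_herm :: 'n::finite herm \<Rightarrow> _)"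
  by (rule bounded_linear_intro[where K = 1]) (simp_all add: mat_of_herm_simps norm_herm_def)

lemma ctranspose_mat_of_herm [simp]: "ctranspose (mat_of_herm A) = mat_of_herm A"
  using mat_of_herm[of A] by (simp add: hermitian_mats_def)

lemma mat_of_herm_Herm: "ctranspose A = A \<Longrightarrow> mat_of_herm (Herm A) = A"
  by (simp add: Herm_inverse hermitian_mats_def)

lemma PD_iff: "P \<in> PD \<longleftrightarrow> (\<forall>x. x \<noteq> 0 \<longrightarrow> 0 < Re (hform (mat_of_herm P) x x))"
  by (simp add: PD_def hform_def)

lemma hform_add_matrix: "hform (A + B) x y = hform A x y + hform B x y"
  by (simp add: hform_def matrix_vector_mult_add_rdistrib ring_distribs sum.distrib)

lemma convex_PD: "convex (PD :: 'n::finite herm set)"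
  unfolding convex_def PD_iff
proof (intro ballI allI impI)
  fix P Q :: "'n herm" and u v :: real and x :: "complex^'n"
  assume P: "P \<in> PD" and Q: "Q \<in> PD" and uv: "0 \<le> u" "0 \<le> v" "u + v = 1" and x: "x \<noteq> 0"
  have "u > 0 \<or> v > 0"
    using uv by linarith
  moreover have "Re (hform (mat_of_herm P) x x) > 0" "Re (hform (mat_of_herm Q) x x) > 0"
    using P Q x by (auto simp: PD_iff)
  ultimately show "0 < Re (hform (mat_of_herm (u *\<^sub>R P + v *\<^sub>R Q)) x x)"
    using uv(1,2)
    by (auto simp: mat_of_herm_simps hform_add_matrix hform_scaleR_matrix
        intro: add_pos_nonneg add_nonneg_pos)
qed

text \<open>
  On the unit sphere the form of \<open>P\<close> is bounded below by some \<open>m > 0\<close>, and a perturbation of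
  operator norm less than \<open>m\<close> preserves its positivity.
\<close>

lemma open_PD: "open (PD :: 'n::finite herm set)"
proof -
  have bil: "bounded_bilinear ((*v) :: complex^'n^'n \<Rightarrow> complex^'n \<Rightarrow> complex^'n)"
    unfolding bilinear_conv_bounded_bilinear[symmetric] bilinear_def
    by (auto intro!: linearI simp: matrix_vector_mult_add_rdistrib matrix_vector_right_distrib
        vec_eq_iff matrix_vector_mult_def scaleR_sum_right
        sum.distrib ring_distribs)
  obtain K where K: "K > 0" "\<And>(A :: complex^'n^'n) x. norm (A *v x) \<le> norm A * norm x * K"
    using bounded_bilinear.pos_bounded[OF bil] by blast
  show ?thesis
    unfolding open_dist
  proof
    fix P :: "'n herm"
    assume P: "P \<in> PD"
    have "continuous_on (sphere 0 1) (\<lambda>x. x \<bullet> (mat_of_herm P *v x))"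
      by (intro continuous_intros linear_continuous_on matrix_vector_mul_bounded_linear)
    then obtain x0 where x0: "x0 \<in> sphere 0 1"
      "\<forall>x\<in>sphere 0 1. x0 \<bullet> (mat_of_herm P *v x0) \<le> x \<bullet> (mat_of_herm P *v x)"
      using continuous_attains_inf[of "sphere 0 1 :: (complex^'n) set"
          "\<lambda>x. x \<bullet> (mat_of_herm P *v x)"] by (auto simp: sphere_eq_empty)
    define m where "m = x0 \<bullet> (mat_of_herm P *v x0)"
    have "x0 \<noteq> 0"
      using x0(1) by auto
    then have m: "m > 0"
      using P by (auto simp: PD_iff Re_hform m_def)
    have lower: "x \<bullet> (mat_of_herm P *v x) \<ge> m * (norm x)\<^sup>2" for x
    proof (cases "x = 0")
      case False
      define u where "u = (1 / norm x) *\<^sub>R x"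
      have "m \<le> u \<bullet> (mat_of_herm P *v u)"
      proof -
        have "u \<in> sphere 0 1"
          using False by (simp add: u_def)
        then show ?thesis
          using x0(2) unfolding m_def by blast
      qed
      also have "\<dots> = (x \<bullet> (mat_of_herm P *v x)) / (norm x)\<^sup>2"
        unfolding u_def inner_scaleR_left
        unfolding Re_hform[symmetric] hform_scaleR_right by (simp add: power2_eq_square)
      finally show ?thesis
        using False by (simp add: field_simps)
    qed simp
    have "Q \<in> PD" if Q: "dist Q P < m / K" for Q
      unfolding PD_iff
    proof (intro allI impI)
      fix x :: "complex^'n"
      assume x: "x \<noteq> 0"
      have "\<bar>x \<bullet> ((mat_of_herm Q - mat_of_herm P) *v x)\<bar>
          \<le> norm x * norm ((mat_of_herm Q - mat_of_herm P) *v x)"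
        by (rule Cauchy_Schwarz_ineq2)
      also have "\<dots> \<le> norm x * (dist Q P * norm x * K)"
        using K(2)[of "mat_of_herm Q - mat_of_herm P" x]
        by (intro mult_left_mono) (simp_all add: dist_herm_def dist_norm)
      also have "\<dots> < m * (norm x)\<^sup>2"
        using Q K(1) x by (simp add: field_simps power2_eq_square)
      finally have "\<bar>x \<bullet> (mat_of_herm Q *v x) - x \<bullet> (mat_of_herm P *v x)\<bar> < m * (norm x)\<^sup>2"
        by (simp add: matrix_vector_mult_diff_rdistrib inner_diff_right)
      then show "0 < Re (hform (mat_of_herm Q) x x)"
        using lower[of x] unfolding Re_hform by linarith
    qed
    then show "\<exists>e>0. \<forall>Q. dist Q P < e \<longrightarrow> Q \<in> PD"
      using m K(1) by (intro exI[of _ "m / K"]) auto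
  qed
qed

text \<open>
  A frame \<open>h\<close> that is orthonormal for \<open>P0\<close> and orthogonal for \<open>P\<close>, with \<open>k\<close> the inverse of
  the adjoint of \<open>h\<close>. Both matrices, and those built from them below, become diagonal in this frame.
\<close>

locale simultaneous_frame =
  fixes h k :: "complex^'n::finite^'n" and p :: "'n \<Rightarrow> real" and P P0 :: "'n herm"
  assumes hk: "ctranspose h ** k = mat 1" "k ** ctranspose h = mat 1"
      "ctranspose k ** h = mat 1" "h ** ctranspose k = mat 1"
    and P0_eq: "mat_of_herm P0 = k ** ctranspose k"
    and P_eq: "mat_of_herm P = k ** diagm p ** ctranspose k"
    and p_pos: "\<And>i. p i > 0"

text \<open>
  If \<open>h\<^sup>* P0 h = 1\<close>, then \<open>P0 h\<close> is the inverse of \<open>h\<^sup>*\<close>.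
\<close>

lemma PD_simultaneous_frame:
  fixes P P0 :: "'n::finite herm"
  assumes P0: "P0 \<in> PD" and P: "P \<in> PD"
  obtains h k p where "simultaneous_frame h k p P P0"
proof -
  obtain h :: "complex^'n^'n" and p where h: "ctranspose h ** mat_of_herm P0 ** h = mat 1"
      "ctranspose h ** mat_of_herm P ** h = diagm p"
    by (rule simultaneous_diagonalisation[of "mat_of_herm P" "mat_of_herm P0"])
      (use P0 in \<open>auto simp: PD_iff\<close>)
  define k where "k = mat_of_herm P0 ** h"
  have hk1: "ctranspose h ** k = mat 1"
    using h(1) by (simp add: k_def matrix_mul_assoc)
  then have hk2: "ctranspose k ** h = mat 1"
    by (metis ctranspose_ctranspose ctranspose_mat_1 ctranspose_mult)
  note hk = hk1 matrix_left_right_inverse1[OF hk1] hk2 matrix_left_right_inverse1[OF hk2]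
  have "k ** ctranspose k = mat_of_herm P0 ** (h ** ctranspose k)"
    by (simp add: k_def matrix_mul_assoc)
  then have P0_eq: "mat_of_herm P0 = k ** ctranspose k"
    using hk by simp
  have "k ** diagm p ** ctranspose k
      = (k ** ctranspose h) ** mat_of_herm P ** (h ** ctranspose k)"
    by (simp add: h(2)[symmetric] matrix_mul_assoc)
  then have P_eq: "mat_of_herm P = k ** diagm p ** ctranspose k"
    using hk by simp
  have "p i > 0" for i
  proof -
    have "diagm p $ i $ i = hform (mat_of_herm P) (column i h) (column i h)"
      unfolding h(2)[symmetric] by (rule congruence_nth)
    from arg_cong[OF this, of Re]
    have p: "p i = Re (hform (mat_of_herm P) (column i h) (column i h))"
      by (simp add: diagm_nth)
    have "mat 1 $ i $ i = hform (mat_of_herm P0) (column i h) (column i h)"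
      unfolding h(1)[symmetric] by (rule congruence_nth)
    then have "column i h \<noteq> 0"
      by (auto simp: mat_def)
    then show ?thesis
      using P p by (simp add: PD_iff)
  qed
  then show ?thesis
    using hk P0_eq P_eq by (intro that) (unfold_locales, auto)
qed

lemma one_in_PD: "Herm (mat 1) \<in> (PD :: 'n::finite herm set)"
proof -
  have "Re (hform (mat 1) x x) = x \<bullet> x" for x :: "complex^'n"
    by (simp add: Re_hform)
  then show ?thesis
    by (auto simp: PD_iff mat_of_herm_Herm)
qed

lemma congruence_hform: "hform (ctranspose k ** A ** k) x y = hform A (k *v x) (k *v y)"
proof -
  have *: "(\<Sum>i\<in>UNIV. cnj (x $ i) * (ctranspose k *v z) $ i) = (\<Sum>i\<in>UNIV. cnj ((k *v x) $ i) * z $ i)" for z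
    unfolding matrix_vector_mult_def ctranspose_def
    by (simp add: sum_distrib_left sum_distrib_right mult_ac) (rule sum.swap)
  show ?thesis
    unfolding hform_def *[symmetric] by (simp add: matrix_vector_mul_assoc matrix_mul_assoc)
qed

lemma PD_congruence_diagm:
  fixes w w' :: "complex^'n::finite^'n"
  assumes w: "w' ** ctranspose w = mat 1" and d: "\<And>i. d i > 0"
  shows "Herm (w ** diagm d ** ctranspose w) \<in> PD"
proof -
  have "Re (hform (diagm d) z z) > 0" if z: "z \<noteq> 0" for z
  proof -
    obtain i where "z $ i \<noteq> 0"
      using z by (auto simp: vec_eq_iff)
    have "(diagm d *v z) $ i = of_real (d i) * z $ i" for i
      by (simp add: matrix_vector_mult_def diagm_def if_distrib[of "\<lambda>c. c * _"] cong: if_cong)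
    then have "Re (hform (diagm d) z z) = (\<Sum>i\<in>UNIV. d i * (cmod (z $ i))\<^sup>2)"
      unfolding hform_def cmod_power2 by (simp add: power2_eq_square algebra_simps)
    also have "\<dots> > 0"
      using d \<open>z $ i \<noteq> 0\<close> by (intro sum_pos2[of _ i]) (auto simp: less_imp_le)
    finally show ?thesis .
  qed
  moreover have "ctranspose w *v x \<noteq> 0" if "x \<noteq> 0" for x
    using that w by (metis matrix_vector_mul_assoc matrix_vector_mul_lid matrix_vector_mult_0_right)
  ultimately have "Re (hform (w ** diagm d ** ctranspose w) x x) > 0" if "x \<noteq> 0" for x
    using congruence_hform[of "ctranspose w" "diagm d" x x] that by simp
  then show ?thesis
    by (simp add: PD_iff mat_of_herm_Herm ctranspose_mult matrix_mul_assoc)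
qed

lemma invertible_PD: "P \<in> PD \<Longrightarrow> invertible (mat_of_herm P)"
proof -
  assume P: "P \<in> PD"
  have "x = 0" if "mat_of_herm P *v x = 0" for x
    using P that by (auto simp: PD_iff Re_hform)
  then show ?thesis
    using matrix_left_invertible_ker invertible_left_inverse by blast
qed

section \<open>Exponential, logarithm, square root and distance in a frame\<close>

lemma trace_diagm: "trace (diagm d) = (\<Sum>i\<in>UNIV. of_real (d i))"
  by (simp add: trace_def diagm_nth)

lemma norm_power2_eq_trace: "(norm A)\<^sup>2 = Re (trace (ctranspose A ** A))"
  for A :: "complex^'n::finite^'n"
proof -
  have "(norm A)\<^sup>2 = (\<Sum>i\<in>UNIV. \<Sum>j\<in>UNIV. (Re (A $ i $ j))\<^sup>2 + (Im (A $ i $ j))\<^sup>2)"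
    unfolding power2_norm_eq_inner by (simp add: inner_vec_def inner_complex_def power2_eq_square)
  also have "\<dots> = Re (trace (ctranspose A ** A))"
    by (subst sum.swap) (simp add: trace_def matrix_matrix_mult_def ctranspose_def power2_eq_square)
  finally show ?thesis .
qed

text \<open>
  Conjugation turns the exponential series into the image, under a linear map, of the series of the
  eigenvalues.
\<close>

lemma mat_exp_diagm:
  fixes V W :: "complex^'n::finite^'n"
  assumes VW: "V ** W = mat 1" and WV: "W ** V = mat 1"
  shows "mat_exp (W ** diagm x ** V) = W ** diagm (\<lambda>i. exp (x i)) ** V"
proof -
  have cancel: "V ** (W ** X) = X" for X :: "complex^'n^'n"
    by (simp add: matrix_mul_assoc VW)
  define \<Phi> :: "real^'n \<Rightarrow> complex^'n^'n" where "\<Phi> y = W ** diagm (\<lambda>i. y $ i) ** V" for y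
  have power: "(((**) (W ** diagm x ** V)) ^^ k) (mat 1) = \<Phi> (\<chi> i. x i ^ k)" for k
  proof (induction k)
    case 0
    then show ?case
      by (simp add: \<Phi>_def diagm_one WV)
  next
    case (Suc k)
    have "(W ** diagm x ** V) ** \<Phi> (\<chi> i. x i ^ k)
        = W ** (diagm x ** diagm (\<lambda>i. x i ^ k)) ** V"
      by (simp add: \<Phi>_def matrix_mul_assoc[symmetric] cancel)
    then show ?case
      by (simp add: Suc.IH diagm_mult \<Phi>_def)
  qed
  have diagm_linear: "linear (\<lambda>y :: real^'n. diagm (\<lambda>i. y $ i))"
    by (auto simp: linear_iff vec_eq_iff diagm_nth complex_eq_iff)
  have "bounded_linear (\<lambda>y :: real^'n. diagm (\<lambda>i. y $ i))"
    using diagm_linear by (rule linear_conv_bounded_linear[THEN iffD1])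
  then have bl: "bounded_linear \<Phi>"
    unfolding \<Phi>_def
    by (rule bounded_linear_compose[OF bounded_linear_compose[OF mm.bounded_linear_left
      mm.bounded_linear_right]])
  have "(\<lambda>k. (\<chi> i. x i ^ k /\<^sub>R fact k)) sums (\<chi> i. exp (x i))"
    unfolding sums_def
    by (rule vec_tendstoI) (use exp_converges[of "x _"] in \<open>simp add: sums_def\<close>)
  from bounded_linear.sums[OF bl this]
  have "(\<lambda>k. \<Phi> (\<chi> i. x i ^ k /\<^sub>R fact k)) sums \<Phi> (\<chi> i. exp (x i))" .
  moreover have "\<Phi> (\<chi> i. x i ^ k /\<^sub>R fact k) = \<Phi> (\<chi> i. x i ^ k) /\<^sub>R fact k" for k
  proof -
    have "(\<chi> i. x i ^ k /\<^sub>R fact k) = (\<chi> i. x i ^ k) /\<^sub>R fact k"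
      by (simp add: vec_eq_iff)
    then show ?thesis
      by (simp only: linear_scale[OF bounded_linear.linear[OF bl]])
  qed
  ultimately have "(\<lambda>k. \<Phi> (\<chi> i. x i ^ k) /\<^sub>R fact k) sums \<Phi> (\<chi> i. exp (x i))"
    by simp
  then show ?thesis
    unfolding mat_exp_def power by (simp add: sums_iff \<Phi>_def)
qed

text \<open>
  The unitary \<open>W\<^sup>* Z\<close> intertwines the two diagonal matrices of values of \<open>\<phi>\<close>. Since \<open>\<phi>\<close> is
  injective on the eigenvalues, an entry of \<open>W\<^sup>* Z\<close> can be non-zero only where the two eigenvalues
  agree, so \<open>W\<^sup>* Z\<close> intertwines the diagonal matrices of eigenvalues as well.
\<close>

lemma spectral_function_inj:
  fixes W Z :: "complex^'n::finite^'n"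
  assumes W: "ctranspose W ** W = mat 1" and Z: "ctranspose Z ** Z = mat 1"
    and eq: "W ** diagm (\<lambda>i. \<phi> (x i)) ** ctranspose W = Z ** diagm (\<lambda>i. \<phi> (y i)) ** ctranspose Z"
    and inj: "\<And>i j. \<phi> (x i) = \<phi> (y j) \<Longrightarrow> x i = y j"
  shows "W ** diagm x ** ctranspose W = Z ** diagm y ** ctranspose Z"
proof -
  have cancel: "ctranspose W ** (W ** X) = X" "W ** (ctranspose W ** X) = X"
    "ctranspose Z ** (Z ** X) = X" "Z ** (ctranspose Z ** X) = X" for X :: "complex^'n^'n"
    by (simp_all add: matrix_mul_assoc W Z matrix_left_right_inverse1[OF W]
        matrix_left_right_inverse1[OF Z])
  define M where "M = ctranspose W ** Z"
  have "diagm (\<lambda>i. \<phi> (x i)) ** M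
      = ctranspose W ** (W ** diagm (\<lambda>i. \<phi> (x i)) ** ctranspose W) ** Z"
    by (simp add: M_def cancel matrix_mul_assoc[symmetric])
  also have "\<dots> = M ** diagm (\<lambda>i. \<phi> (y i))"
    unfolding eq by (simp add: M_def matrix_mul_assoc[symmetric] Z)
  finally have "diagm (\<lambda>i. \<phi> (x i)) ** M = M ** diagm (\<lambda>i. \<phi> (y i))" .
  then have "of_real (\<phi> (x i)) * M $ i $ j = M $ i $ j * of_real (\<phi> (y j))" for i j
    by (metis diagm_mult_nth mult_diagm_nth)
  then have "of_real (x i) * M $ i $ j = M $ i $ j * of_real (y j)" for i j
    using inj[of i j] by (cases "M $ i $ j = 0") (auto simp: mult.commute)
  then have comm: "diagm x ** M = M ** diagm y"
    by (simp add: vec_eq_iff diagm_mult_nth mult_diagm_nth)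
  have "W ** diagm x ** ctranspose W = W ** (diagm x ** M) ** ctranspose Z"
    by (simp add: M_def matrix_mul_assoc[symmetric] matrix_left_right_inverse1[OF Z])
  also have "\<dots> = Z ** diagm y ** ctranspose Z"
    unfolding comm by (simp add: M_def matrix_mul_assoc[symmetric] cancel)
  finally show ?thesis .
qed

lemma herm_unitary_diagonalisation:
  fixes X :: "'n::finite herm"
  obtains W :: "complex^'n^'n" and x where "ctranspose W ** W = mat 1" "W ** ctranspose W = mat 1"
    "mat_of_herm X = W ** diagm x ** ctranspose W"
proof -
  obtain W :: "complex^'n^'n" and x where W: "ctranspose W ** mat 1 ** W = mat 1"
      "ctranspose W ** mat_of_herm X ** W = diagm x"
    by (rule simultaneous_diagonalisation[of "mat_of_herm X" "mat 1"]) (auto simp: Re_hform)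
  then have W1: "ctranspose W ** W = mat 1"
    by simp
  note W2 = matrix_left_right_inverse1[OF W1]
  have "W ** diagm x ** ctranspose W = (W ** ctranspose W) ** mat_of_herm X ** (W ** ctranspose W)"
    by (simp only: W(2)[symmetric] matrix_mul_assoc)
  then have "mat_of_herm X = W ** diagm x ** ctranspose W"
    by (simp add: W2)
  then show ?thesis
    by (rule that[OF W1 W2])
qed

lemma PD_unitary_diagonalisation:
  fixes P :: "'n::finite herm"
  assumes "P \<in> PD"
  obtains W :: "complex^'n^'n" and d where "ctranspose W ** W = mat 1" "W ** ctranspose W = mat 1"
    "mat_of_herm P = W ** diagm d ** ctranspose W" "\<forall>i. d i > 0"
proof -
  obtain h k :: "complex^'n^'n" and p where fr: "simultaneous_frame h k p P (Herm (mat 1))"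
    using PD_simultaneous_frame[OF one_in_PD assms] .
  interpret simultaneous_frame h k p P "Herm (mat 1)" by (rule fr)
  have kk: "k ** ctranspose k = mat 1"
    using P0_eq by (simp add: mat_of_herm_Herm)
  show ?thesis
    by (rule that[OF matrix_left_right_inverse1[OF kk] kk P_eq]) (simp add: p_pos)
qed

lemma mat_exp_inj_herm:
  fixes X Y :: "'n::finite herm"
  assumes "mat_exp (mat_of_herm X) = mat_exp (mat_of_herm Y)"
  shows "X = Y"
proof -
  obtain W :: "complex^'n^'n" and x where W: "ctranspose W ** W = mat 1" "W ** ctranspose W = mat 1"
      "mat_of_herm X = W ** diagm x ** ctranspose W"
    by (rule herm_unitary_diagonalisation)
  obtain Z :: "complex^'n^'n" and y where Z: "ctranspose Z ** Z = mat 1" "Z ** ctranspose Z = mat 1"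
      "mat_of_herm Y = Z ** diagm y ** ctranspose Z"
    by (rule herm_unitary_diagonalisation)
  have "W ** diagm (\<lambda>i. exp (x i)) ** ctranspose W = Z ** diagm (\<lambda>i. exp (y i)) ** ctranspose Z"
    using assms unfolding W(3) Z(3) mat_exp_diagm[OF W(1,2)] mat_exp_diagm[OF Z(1,2)] .
  then have "mat_of_herm X = mat_of_herm Y"
    unfolding W(3) Z(3) by (rule spectral_function_inj[OF W(1) Z(1)]) simp
  then show ?thesis
    by (simp add: mat_of_herm_inject)
qed

text \<open>
  The Hermitian logarithm is unique because the exponential is injective on Hermitian matrices, so
  the definite description picks the matrix with the logarithms of the eigenvalues.
\<close>

lemma mat_of_herm_pd_log:
  fixes A :: "'n::finite herm" and W :: "complex^'n^'n"
  assumes W: "ctranspose W ** W = mat 1" "W ** ctranspose W = mat 1"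
    and A: "mat_of_herm A = W ** diagm d ** ctranspose W" and d: "\<And>i. d i > 0"
  shows "mat_of_herm (pd_log A) = W ** diagm (\<lambda>i. ln (d i)) ** ctranspose W"
proof -
  let ?X = "W ** diagm (\<lambda>i. ln (d i)) ** ctranspose W"
  have X: "mat_of_herm (Herm ?X) = ?X"
    by (rule mat_of_herm_Herm) (simp add: ctranspose_mult matrix_mul_assoc)
  have exp: "mat_exp (mat_of_herm (Herm ?X)) = mat_of_herm A"
    unfolding X mat_exp_diagm[OF W] A using d by simp
  have "pd_log A = Herm ?X"
    unfolding pd_log_def
  proof (rule the_equality)
    show "mat_exp (mat_of_herm (Herm ?X)) = mat_of_herm A"
      by (rule exp)
    fix Y assume "mat_exp (mat_of_herm Y) = mat_of_herm A"
    then show "Y = Herm ?X"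
      using exp by (intro mat_exp_inj_herm) simp
  qed
  then show ?thesis
    using X by simp
qed

text \<open>
  Squaring is injective on positive numbers, hence by \<open>spectral_function_inj\<close> on \<open>PD\<close>.
\<close>

lemma pd_sqrt:
  fixes P :: "'n::finite herm"
  assumes "P \<in> PD"
  shows "pd_sqrt P \<in> PD" "mat_of_herm (pd_sqrt P) ** mat_of_herm (pd_sqrt P) = mat_of_herm P"
proof -
  obtain W :: "complex^'n^'n" and d where W: "ctranspose W ** W = mat 1" "W ** ctranspose W = mat 1"
    "mat_of_herm P = W ** diagm d ** ctranspose W" and d: "\<forall>i. d i > 0"
    by (rule PD_unitary_diagonalisation[OF assms])
  have cancel: "ctranspose U ** (U ** X) = X" if "ctranspose U ** U = mat 1"
    for U X :: "complex^'n^'n"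
    using that by (simp add: matrix_mul_assoc)
  have square: "(U ** diagm a ** ctranspose U) ** (U ** diagm a ** ctranspose U)
      = U ** diagm (\<lambda>i. a i * a i) ** ctranspose U"
    if U: "ctranspose U ** U = mat 1" for U :: "complex^'n^'n" and a
  proof -
    have "(U ** diagm a ** ctranspose U) ** (U ** diagm a ** ctranspose U)
      = U ** (diagm a ** diagm a) ** ctranspose U"
      by (simp add: matrix_mul_assoc[symmetric] cancel[OF U])
    then show ?thesis
      by (simp add: diagm_mult)
  qed
  let ?B = "W ** diagm (\<lambda>i. sqrt (d i)) ** ctranspose W"
  have B: "mat_of_herm (Herm ?B) = ?B"
    by (rule mat_of_herm_Herm) (simp add: ctranspose_mult matrix_mul_assoc)
  have ex: "Herm ?B \<in> PD \<and> mat_of_herm (Herm ?B) ** mat_of_herm (Herm ?B) = mat_of_herm P"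
    using PD_congruence_diagm[OF W(2), of "\<lambda>i. sqrt (d i)"] d
    unfolding B square[OF W(1)] W(3) by (simp add: less_imp_le)
  have "pd_sqrt P = Herm ?B"
    unfolding pd_sqrt_def
  proof (rule the_equality)
    show "Herm ?B \<in> PD \<and> mat_of_herm (Herm ?B) ** mat_of_herm (Herm ?B) = mat_of_herm P"
      by (rule ex)
    fix C :: "'n herm"
    assume "C \<in> PD \<and> mat_of_herm C ** mat_of_herm C = mat_of_herm P"
    then have C: "C \<in> PD" "mat_of_herm C ** mat_of_herm C = mat_of_herm P"
      by auto
    obtain Z :: "complex^'n^'n" and c where Z: "ctranspose Z ** Z = mat 1" "Z ** ctranspose Z = mat 1"
      "mat_of_herm C = Z ** diagm c ** ctranspose Z" and c: "\<forall>i. c i > 0"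
      by (rule PD_unitary_diagonalisation[OF C(1)])
    have "mat_of_herm C = ?B"
      unfolding Z(3)
    proof (rule spectral_function_inj[OF Z(1) W(1), where \<phi> = "\<lambda>t. t * t"])
      show "Z ** diagm (\<lambda>i. c i * c i) ** ctranspose Z
          = W ** diagm (\<lambda>i. sqrt (d i) * sqrt (d i)) ** ctranspose W"
        using C(2) d unfolding Z(3) W(3) square[OF Z(1)] by (simp add: less_imp_le)
      show "c i = sqrt (d j)" if "c i * c i = sqrt (d j) * sqrt (d j)" for i j
        using that c[rule_format, of i] d[rule_format, of j]
        by (metis less_imp_le power2_eq_iff_nonneg power2_eq_square real_sqrt_ge_zero)
    qed
    then show "C = Herm ?B"
      using B by (simp flip: mat_of_herm_inject)
  qed
  then show "pd_sqrt P \<in> PD" "mat_of_herm (pd_sqrt P) ** mat_of_herm (pd_sqrt P) = mat_of_herm P"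
    using ex by simp_all
qed

text \<open>
  With \<open>S = P\<^sup>-\<^sup>1\<^sup>/\<^sup>2\<close>, the matrix \<open>S k \<surd>p\<close> is unitary and diagonalises \<open>S P0 S\<close>, whose eigenvalues
  are therefore the numbers \<open>1/p i\<close>.
\<close>

lemma (in simultaneous_frame) pd_dist_power2:
  assumes P: "P \<in> PD"
  shows "(pd_dist P P0)\<^sup>2 = (\<Sum>i\<in>UNIV. (ln (p i))\<^sup>2)"
proof -
  define B where "B = mat_of_herm (pd_sqrt P)"
  have B: "invertible B" "B ** B = mat_of_herm P" "ctranspose B = B"
    using pd_sqrt[OF P] invertible_PD by (auto simp: B_def)
  define S where "S = matrix_inv B"
  have SB: "S ** B = mat 1" "B ** S = mat 1"
    using B(1) by (simp_all add: S_def matrix_inv_left matrix_inv_right)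
  have "B ** ctranspose S = mat 1"
    using SB(1) B(3) by (metis ctranspose_mat_1 ctranspose_mult)
  then have S: "ctranspose S = S"
    unfolding S_def by (rule matrix_inv_unique[symmetric])
  define W where "W = S ** k ** diagm (\<lambda>i. sqrt (p i))"
  have Wc: "ctranspose W = diagm (\<lambda>i. sqrt (p i)) ** ctranspose k ** S"
    by (simp add: W_def ctranspose_mult S matrix_mul_assoc)
  have WdW: "W ** diagm d ** ctranspose W = S ** (k ** diagm (\<lambda>i. p i * d i) ** ctranspose k) ** S" for d
  proof -
    have "W ** diagm d ** ctranspose W = S ** (k ** (diagm (\<lambda>i. sqrt (p i)) ** diagm d 
        ** diagm (\<lambda>i. sqrt (p i))) ** ctranspose k) ** S"
      unfolding Wc by (simp add: W_def matrix_mul_assoc)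
    moreover have "sqrt (p i) * d i * sqrt (p i) = p i * d i" for i
      using p_pos[of i] by (simp add: less_imp_le mult.assoc mult.left_commute)
    ultimately show ?thesis
      by (simp add: diagm_mult)
  qed
  have "W ** ctranspose W = S ** mat_of_herm P ** S"
    using WdW[of "\<lambda>i. 1"] by (simp add: diagm_one P_eq)
  also have "\<dots> = (S ** B) ** (B ** S)"
    by (simp add: B(2)[symmetric] matrix_mul_assoc)
  finally have W1: "W ** ctranspose W = mat 1"
    by (simp add: SB)
  note W2 = matrix_left_right_inverse1[OF W1]
  have p0: "p i \<noteq> 0" for i
    using p_pos[of i] by simp
  have "W ** diagm (\<lambda>i. 1 / p i) ** ctranspose W = S ** mat_of_herm P0 ** S"
    unfolding WdW P0_eq by (simp add: p0 diagm_one)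
  then have "mat_of_herm (Herm (S ** mat_of_herm P0 ** S))
      = W ** diagm (\<lambda>i. 1 / p i) ** ctranspose W"
    by (simp add: mat_of_herm_Herm ctranspose_mult S matrix_mul_assoc)
  from mat_of_herm_pd_log[OF W2 W1 this]
  have log: "mat_of_herm (pd_log (Herm (S ** mat_of_herm P0 ** S)))
      = W ** diagm (\<lambda>i. ln (1 / p i)) ** ctranspose W"
    using p_pos by simp
  let ?D = "\<lambda>i. ln (1 / p i)"
  have lnp: "?D i = - ln (p i)" for i
    using p_pos[of i] by (simp add: ln_div)
  have "(pd_dist P P0)\<^sup>2 = Re (trace (ctranspose (W ** diagm ?D ** ctranspose W) ** (W ** diagm ?D ** ctranspose W)))"
    unfolding pd_dist_def Let_def B_def[symmetric] S_def[symmetric] norm_herm_def log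
    by (rule norm_power2_eq_trace)
  also have "ctranspose (W ** diagm ?D ** ctranspose W) ** (W ** diagm ?D ** ctranspose W)
      = W ** diagm ?D ** (ctranspose W ** W) ** diagm ?D ** ctranspose W"
    by (simp add: ctranspose_mult matrix_mul_assoc)
  also have "\<dots> = W ** (diagm (\<lambda>i. ?D i * ?D i) ** ctranspose W)"
    by (simp add: W2 diagm_mult matrix_mul_assoc[symmetric])
  also have "trace \<dots> = trace (diagm (\<lambda>i. ?D i * ?D i) ** (ctranspose W ** W))"
    by (subst trace_mul_sym) (simp add: matrix_mul_assoc)
  also have "Re \<dots> = (\<Sum>i\<in>UNIV. (ln (p i))\<^sup>2)"
    by (simp add: W2 trace_diagm lnp power2_eq_square)
  finally show ?thesis .
qed

section \<open>The Levi-Civita connection of the affine-invariant metric\<close>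

abbreviation rtr :: "complex^'n::finite^'n \<Rightarrow> real" where
  "rtr A \<equiv> Re (trace A)"

abbreviation hinv :: "'n::finite herm \<Rightarrow> complex^'n^'n" where
  "hinv P \<equiv> matrix_inv (mat_of_herm P)"

lemma rtr_add: "rtr (A + B) = rtr A + rtr B"
  by (simp add: trace_add)

lemma rtr_diff: "rtr (A - B) = rtr A - rtr B"
  by (simp add: trace_sub)

lemma rtr_scaleR: "rtr (r *\<^sub>R A) = r * rtr A"
  using linear_scale[OF bounded_linear.linear[OF bounded_linear_Re_trace], of r A] by simp

lemma rtr_minus: "rtr (- A) = - rtr A"
  using rtr_scaleR[of "-1" A] by simp

lemma rtr_cyclic: "rtr (A ** B) = rtr (B ** A)"
  by (rule arg_cong[OF trace_mul_sym])

lemma rtr_ctranspose: "rtr (ctranspose A) = rtr A"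
  by (simp add: trace_ctranspose)

lemmas mm_simps = mm.add_left mm.add_right mm.diff_left mm.diff_right mm.minus_left mm.minus_right
  mm.scaleR_left mm.scaleR_right

lemmas rtr_simps = rtr_add rtr_diff rtr_minus rtr_scaleR

text \<open>
  The Hermitian part of a matrix. Unlike \<open>Herm\<close>, whose value at a matrix that is not Hermitian is
  arbitrary, this is a linear map on all matrices and can be composed with smooth maps.
\<close>

definition hproj :: "complex^'n::finite^'n \<Rightarrow> 'n herm" where
  "hproj A = Herm ((1/2) *\<^sub>R (A + ctranspose A))"

lemma mat_of_hproj: "mat_of_herm (hproj A) = (1/2) *\<^sub>R (A + ctranspose A)"
  unfolding hproj_def
  by (rule mat_of_herm_Herm) (simp add: ctranspose_scaleR ctranspose_add add.commute)

lemma bounded_linear_hproj: "bounded_linear (hproj :: complex^'n::finite^'n \<Rightarrow> _)"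
proof -
  have "linear (hproj :: complex^'n^'n \<Rightarrow> _)"
  proof (rule linearI)
    show "hproj (A + B) = hproj A + hproj B" for A B :: "complex^'n^'n"
      unfolding mat_of_herm_inject[symmetric] mat_of_hproj mat_of_herm_simps ctranspose_add
        scaleR_add_right by simp
    show "hproj (r *\<^sub>R A) = r *\<^sub>R hproj A" for r and A :: "complex^'n^'n"
      unfolding mat_of_herm_inject[symmetric] mat_of_hproj mat_of_herm_simps ctranspose_scaleR
        scaleR_add_right[symmetric] by (rule scaleR_left_commute)
  qed
  then show ?thesis
    by (rule linear_conv_bounded_linear[THEN iffD1])
qed

lemma ctranspose_hinv: "P \<in> PD \<Longrightarrow> ctranspose (hinv P) = hinv P"
proof -
  assume "P \<in> PD"
  from matrix_inv_left[OF invertible_PD[OF this]]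
  have "ctranspose (hinv P ** mat_of_herm P) = mat 1"
    by simp
  then have "mat_of_herm P ** ctranspose (hinv P) = mat 1"
    by (simp add: ctranspose_mult)
  then show ?thesis
    by (rule matrix_inv_unique[symmetric])
qed

lemma has_derivative_hinv:
  assumes "P \<in> PD"
  shows "(hinv has_derivative (\<lambda>U. - (hinv P ** mat_of_herm U ** hinv P))) (at P within S)"
  by (rule has_derivative_matrix_inv_compose[OF
      bounded_linear_imp_has_derivative[OF bounded_linear_mat_of_herm] invertible_PD[OF assms]])

lemma Ck_on_hinv: "Ck_on k PD hinv"
  by (rule Ck_on_matrix_inv[OF open_PD invertible_PD
      Ck_on_linear[OF open_PD bounded_linear_mat_of_herm]])

lemma smooth_on_const: "smooth_on M (\<lambda>x. c)"
  by (simp add: smooth_on_def Ck_on_const)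

lemma smooth_on_has_derivative:
  assumes "smooth_on M f" "x \<in> M"
  shows "(f has_derivative frechet_derivative f (at x)) (at x)"
  using assms Ck_on_derivative unfolding smooth_on_def by blast

text \<open>
  The difference of two torsion-free metric connections, paired with the metric, is symmetric in
  its first two arguments and antisymmetric in its last two; such a trilinear form vanishes.
\<close>

lemma levi_civita_unique:
  assumes conn: "torsion_free_on M \<Gamma>" "metric_compatible_on M g \<Gamma>"
      "torsion_free_on M \<Gamma>'" "metric_compatible_on M g \<Gamma>'"
    and p: "p \<in> M"
    and g: "bilinear (g p)" "\<And>x y. g p x y = g p y x" "\<And>x. g p x x = 0 \<Longrightarrow> x = 0"
  shows "\<Gamma> p u v = \<Gamma>' p u v"
proof -
  define D where "D u v = \<Gamma> p u v - \<Gamma>' p u v" for u v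
  have sym: "\<Gamma> p u v = \<Gamma> p v u" if "torsion_free_on M \<Gamma>" for \<Gamma> u v
    using that[unfolded torsion_free_on_def, rule_format, OF smooth_on_const smooth_on_const p, of u v]
    by (simp add: cov_deriv_def lie_bracket_def frechet_derivative_const)
  have met: "frechet_derivative (\<lambda>q. g q v w) (at p) u = g p (\<Gamma> p u v) w + g p v (\<Gamma> p u w)"
    if "metric_compatible_on M g \<Gamma>" for \<Gamma> u v w
    using that[unfolded metric_compatible_on_def, rule_format,
        OF smooth_on_const smooth_on_const smooth_on_const p, of v w u]
    by (simp add: cov_deriv_def frechet_derivative_const)
  have symD: "D u v = D v u" for u v
    using sym[OF conn(1)] sym[OF conn(3)] by (simp add: D_def)
  have antiD: "g p (D u v) w = - g p (D u w) v" for u v w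
  proof -
    have "g p (D u v) w = g p (\<Gamma> p u v) w - g p (\<Gamma>' p u v) w"
      by (simp add: D_def bilinear_lsub[OF g(1)])
    moreover have "g p (D u w) v = g p v (\<Gamma> p u w) - g p v (\<Gamma>' p u w)"
      unfolding g(2)[of _ v] by (simp add: D_def bilinear_rsub[OF g(1)])
    ultimately show ?thesis
      using met[OF conn(2), of v w u] met[OF conn(4), of v w u] by linarith
  qed
  have "g p (D u v) w = - g p (D u v) w" for w
  proof -
    have "g p (D u v) w = - g p (D w u) v"
      unfolding antiD[of u v w] symD[of u w] ..
    also have "\<dots> = g p (D v w) u"
      unfolding antiD[of w u v] symD[of w v] by simp
    also have "\<dots> = - g p (D u v) w"
      unfolding antiD[of v w u] symD[of v u] ..
    finally show ?thesis .
  qed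
  from this[of "D u v"] have "g p (D u v) (D u v) = 0"
    by simp
  from g(3)[OF this] show ?thesis
    by (simp add: D_def)
qed

definition pd_christoffel :: "'n::finite herm \<Rightarrow> 'n herm \<Rightarrow> 'n herm \<Rightarrow> 'n herm" where
  "pd_christoffel P U V = - hproj (mat_of_herm U ** hinv P ** mat_of_herm V)"

lemma mat_of_christoffel:
  assumes "P \<in> PD"
  shows "mat_of_herm (pd_christoffel P U V) = - (1/2) *\<^sub>R
    (mat_of_herm U ** hinv P ** mat_of_herm V + mat_of_herm V ** hinv P ** mat_of_herm U)"
  by (simp add: pd_christoffel_def mat_of_hproj mat_of_herm_simps ctranspose_mult
      ctranspose_hinv[OF assms] matrix_mul_assoc)

lemma affine_connection_christoffel: "affine_connection_on (PD :: 'n::finite herm set) pd_christoffel"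
proof -
  interpret hp: bounded_linear hproj by (rule bounded_linear_hproj)
  have "bilinear (pd_christoffel P)" for P :: "'n herm"
    unfolding bilinear_def linear_iff pd_christoffel_def
    by (simp add: mat_of_herm_simps mm_simps hp.add hp.scaleR)
  moreover have "Ck_on k PD (\<lambda>P. pd_christoffel P U V)" for k and U V :: "'n herm"
    unfolding pd_christoffel_def
    by (intro Ck_on_bounded_linear[OF open_PD bounded_linear_minus[OF bounded_linear_hproj]]
        Ck_on_bounded_bilinear[OF open_PD bounded_bilinear_matrix_mult] Ck_on_const Ck_on_hinv)
  ultimately show ?thesis
    by (simp add: affine_connection_on_def smooth_on_def)
qed

lemma torsion_free_christoffel: "torsion_free_on (PD :: 'n::finite herm set) pd_christoffel"
proof -
  have "pd_christoffel P U V = pd_christoffel P V U" if "P \<in> PD" for P U V :: "'n herm"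
    by (simp add: mat_of_christoffel[OF that] add.commute flip: mat_of_herm_inject)
  then show ?thesis
    by (simp add: torsion_free_on_def cov_deriv_def lie_bracket_def)
qed

lemma has_derivative_matrix_mult:
  fixes f g :: "'a::real_normed_vector \<Rightarrow> complex^'n::finite^'n"
  assumes "(f has_derivative f') (at x within S)" "(g has_derivative g') (at x within S)"
  shows "((\<lambda>x. f x ** g x) has_derivative (\<lambda>v. f x ** g' v + f' v ** g x)) (at x within S)"
  using assms by (rule bounded_bilinear.FDERIV[OF bounded_bilinear_matrix_mult])

lemma has_derivative_mat_of_herm:
  assumes "(f has_derivative f') F"
  shows "((\<lambda>x. mat_of_herm (f x)) has_derivative (\<lambda>v. mat_of_herm (f' v))) F"
  using assms by (rule bounded_linear.has_derivative[OF bounded_linear_mat_of_herm])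

text \<open>
  Differentiating the two occurrences of \<open>P\<^sup>-\<^sup>1\<close> in the metric gives two trace words, each of
  which is produced once by \<open>pd_christoffel P X Y\<close> and once, up to a cyclic shift, by
  \<open>pd_christoffel P X Z\<close>, both times with the factor one half.
\<close>

lemma metric_compatible_christoffel:
  "metric_compatible_on (PD :: 'n::finite herm set) affine_inv_metric pd_christoffel"
  unfolding metric_compatible_on_def
proof (intro allI impI ballI)
  fix X Y Z :: "'n herm \<Rightarrow> 'n herm" and P :: "'n herm"
  assume XYZ: "smooth_on PD X" "smooth_on PD Y" "smooth_on PD Z" and P: "P \<in> PD"
  let ?Y' = "frechet_derivative Y (at P)" and ?Z' = "frechet_derivative Z (at P)"
  let ?m = mat_of_herm
  note Y' = has_derivative_mat_of_herm[OF smooth_on_has_derivative[OF XYZ(2) P]]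
  note Z' = has_derivative_mat_of_herm[OF smooth_on_has_derivative[OF XYZ(3) P]]
  note I' = has_derivative_hinv[OF P]
  have "((\<lambda>Q. affine_inv_metric Q (Y Q) (Z Q)) has_derivative
      (\<lambda>v. rtr (hinv P ** ?m (Y P) ** hinv P ** ?m (?Z' v)
        + (hinv P ** ?m (Y P) ** - (hinv P ** ?m v ** hinv P)
          + (hinv P ** ?m (?Y' v) + - (hinv P ** ?m v ** hinv P) ** ?m (Y P)) ** hinv P)
          ** ?m (Z P)))) (at P)"
    unfolding affine_inv_metric_def
    by (rule bounded_linear.has_derivative[OF bounded_linear_Re_trace])
      (rule has_derivative_matrix_mult[OF has_derivative_matrix_mult[OF
         has_derivative_matrix_mult[OF I' Y'] I'] Z'])
  from frechet_derivative_at[OF this, symmetric]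
  have "frechet_derivative (\<lambda>Q. affine_inv_metric Q (Y Q) (Z Q)) (at P) (X P)
      = rtr (hinv P ** ?m (Y P) ** hinv P ** ?m (?Z' (X P))
        + (hinv P ** ?m (Y P) ** - (hinv P ** ?m (X P) ** hinv P)
          + (hinv P ** ?m (?Y' (X P)) + - (hinv P ** ?m (X P) ** hinv P) ** ?m (Y P)) ** hinv P)
          ** ?m (Z P))"
    by simp
  moreover have "rtr (hinv P ** (?m (Y P) ** (hinv P ** (?m (Z P) ** (hinv P ** ?m (X P))))))
      = rtr (hinv P ** (?m (X P) ** (hinv P ** (?m (Y P) ** (hinv P ** ?m (Z P))))))"
    using rtr_cyclic[of "hinv P ** ?m (Y P) ** hinv P ** ?m (Z P)" "hinv P ** ?m (X P)"]
    by (simp add: matrix_mul_assoc)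
  ultimately show "frechet_derivative (\<lambda>Q. affine_inv_metric Q (Y Q) (Z Q)) (at P) (X P)
      = affine_inv_metric P (cov_deriv pd_christoffel X Y P) (Z P)
        + affine_inv_metric P (Y P) (cov_deriv pd_christoffel X Z P)"
    unfolding affine_inv_metric_def cov_deriv_def
    by (simp add: mat_of_herm_simps mat_of_christoffel[OF P] mm_simps rtr_simps
        matrix_mul_assoc[symmetric] algebra_simps)
qed

lemma (in simultaneous_frame) hinv_P: "hinv P = h ** diagm (\<lambda>i. 1 / p i) ** ctranspose h"
proof (rule matrix_inv_unique)
  have p0: "p i \<noteq> 0" for i
    using p_pos[of i] by simp
  have "mat_of_herm P ** (h ** diagm (\<lambda>i. 1 / p i) ** ctranspose h)
      = k ** diagm p ** (ctranspose k ** h) ** diagm (\<lambda>i. 1 / p i) ** ctranspose h"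
    by (simp add: P_eq matrix_mul_assoc)
  also have "\<dots> = k ** (diagm p ** diagm (\<lambda>i. 1 / p i)) ** ctranspose h"
    by (simp add: hk matrix_mul_assoc)
  also have "\<dots> = mat 1"
    by (simp add: diagm_mult p0 diagm_one hk)
  finally show "mat_of_herm P ** (h ** diagm (\<lambda>i. 1 / p i) ** ctranspose h) = mat 1" .
qed

text \<open>
  In a basis that is orthonormal for \<open>P\<close>, the metric at \<open>P\<close> is the Hilbert--Schmidt product.
\<close>

lemma affine_inv_metric_definite:
  fixes P U :: "'n::finite herm"
  assumes P: "P \<in> PD" and 0: "affine_inv_metric P U U = 0"
  shows "U = 0"
proof -
  obtain h k p where fr: "simultaneous_frame h k p P P"
    using PD_simultaneous_frame[OF P P] .
  interpret simultaneous_frame h k p P P by (rule fr)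
  have inv: "hinv P = h ** ctranspose h"
  proof (rule matrix_inv_unique)
    have "mat_of_herm P ** (h ** ctranspose h) = k ** (ctranspose k ** h) ** ctranspose h"
      by (simp add: P0_eq matrix_mul_assoc)
    then show "mat_of_herm P ** (h ** ctranspose h) = mat 1"
      by (simp add: hk)
  qed
  define u where "u = ctranspose h ** mat_of_herm U ** h"
  have "affine_inv_metric P U U = rtr (h ** (ctranspose h ** mat_of_herm U ** h ** ctranspose h ** mat_of_herm U))"
    by (simp add: affine_inv_metric_def inv matrix_mul_assoc)
  also have "\<dots> = rtr (u ** u)"
    by (subst rtr_cyclic) (simp add: u_def matrix_mul_assoc)
  also have "u ** u = ctranspose u ** u"
    by (simp add: u_def ctranspose_mult matrix_mul_assoc)
  finally have "norm u = 0"
    using 0 norm_power2_eq_trace[of u] by simp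
  then have "u = 0" by simp
  have "mat_of_herm U = (k ** ctranspose h) ** mat_of_herm U ** (h ** ctranspose k)"
    by (simp add: hk)
  also have "\<dots> = k ** u ** ctranspose k"
    by (simp add: u_def matrix_mul_assoc)
  finally show "U = 0"
    using \<open>u = 0\<close> by (simp add: mat_of_herm_simps flip: mat_of_herm_inject)
qed

theorem levi_civita_PD:
  fixes P U V :: "'n::finite herm"
  assumes P: "P \<in> PD"
  shows "levi_civita PD affine_inv_metric P U V = pd_christoffel P U V"
proof -
  let ?\<Gamma> = "levi_civita PD affine_inv_metric :: 'n herm \<Rightarrow> 'n herm \<Rightarrow> 'n herm \<Rightarrow> 'n herm"
  have "affine_connection_on PD ?\<Gamma> \<and> torsion_free_on PD ?\<Gamma>
      \<and> metric_compatible_on PD affine_inv_metric ?\<Gamma>"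
    unfolding levi_civita_def
    by (rule someI[of _ pd_christoffel])
      (simp add: affine_connection_christoffel torsion_free_christoffel metric_compatible_christoffel)
  then have "torsion_free_on PD ?\<Gamma>" "metric_compatible_on PD affine_inv_metric ?\<Gamma>"
    by auto
  then show ?thesis
  proof (rule levi_civita_unique[OF _ _ torsion_free_christoffel metric_compatible_christoffel P])
    show "bilinear (affine_inv_metric P)"
      unfolding bilinear_def linear_iff affine_inv_metric_def
      by (simp add: mat_of_herm_simps mm_simps rtr_simps)
    show "affine_inv_metric P U V = affine_inv_metric P V U" for U V
      using rtr_cyclic[of "hinv P ** mat_of_herm U" "hinv P ** mat_of_herm V"]
      by (simp add: affine_inv_metric_def matrix_mul_assoc)
  qed (rule affine_inv_metric_definite[OF P])
qed

section \<open>Derivatives of the squared distance\<close>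

definition segment_mat :: "'n::finite herm \<Rightarrow> real \<times> 'n herm \<Rightarrow> complex^'n^'n" where
  "segment_mat P0 z = (1 - fst z) *\<^sub>R mat_of_herm P0 + fst z *\<^sub>R mat_of_herm (snd z)"

definition seg_resolvent :: "'n::finite herm \<Rightarrow> real \<times> 'n herm \<Rightarrow> complex^'n^'n" where
  "seg_resolvent P0 z = matrix_inv (segment_mat P0 z)"

text \<open>
  For \<open>P0\<close> in \<open>PD\<close>, an open set that contains \<open>[0, 1] \<times> PD\<close> and on which all integrands below are smooth.
\<close>

definition seg_dom :: "'n::finite herm \<Rightarrow> (real \<times> 'n herm) set" where
  "seg_dom P0 = {z. snd z \<in> PD \<and> invertible (segment_mat P0 z)}"

definition log_integrand :: "'n::finite herm \<Rightarrow> real \<times> 'n herm \<Rightarrow> complex^'n^'n" where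
  "log_integrand P0 z = (mat_of_herm (snd z) - mat_of_herm P0) ** seg_resolvent P0 z"

text \<open>This is the logarithm of \<open>P P0\<^sup>-\<^sup>1\<close>.\<close>

definition rel_log :: "'n::finite herm \<Rightarrow> 'n herm \<Rightarrow> complex^'n^'n" where
  "rel_log P0 P = integral {0..1} (\<lambda>t. log_integrand P0 (t, P))"

definition sqdist :: "'n::finite herm \<Rightarrow> 'n herm \<Rightarrow> real" where
  "sqdist P0 P = rtr (rel_log P0 P ** rel_log P0 P)"

text \<open>
  The integral of this over \<open>t\<close> is the part of the second derivative of \<open>sqdist\<close> that comes from
  differentiating the logarithm; by \<open>hessian_pd_dist\<close> it is the whole Hessian.
\<close>

definition hess_integrand ::
    "'n::finite herm \<Rightarrow> 'n herm \<Rightarrow> 'n herm \<Rightarrow> real \<times> 'n herm \<Rightarrow> real" where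
  "hess_integrand P0 V W z = 2 * rtr (hinv (snd z) ** mat_of_herm P0 ** seg_resolvent P0 z
     ** mat_of_herm V ** seg_resolvent P0 z ** mat_of_herm W)"

lemma segment_mat_eq: "segment_mat P0 (t, P) = mat_of_herm ((1 - t) *\<^sub>R P0 + t *\<^sub>R P)"
  by (simp add: segment_mat_def mat_of_herm_simps)

lemma segment_in_PD:
  assumes "P0 \<in> PD" "P \<in> PD" "t \<in> {0..1}"
  shows "(1 - t) *\<^sub>R P0 + t *\<^sub>R P \<in> PD"
  using assms convex_PD[unfolded convex_alt] by auto

lemma invertible_segment_mat:
  assumes "P0 \<in> PD" "P \<in> PD" "t \<in> {0..1}"
  shows "invertible (segment_mat P0 (t, P))"
  unfolding segment_mat_eq by (rule invertible_PD[OF segment_in_PD[OF assms]])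

lemma seg_dom_superset: "P0 \<in> PD \<Longrightarrow> {0..1} \<times> PD \<subseteq> seg_dom P0"
  using invertible_segment_mat by (fastforce simp: seg_dom_def)

lemma Ck_on_fst_linear: "open S \<Longrightarrow> Ck_on k S (\<lambda>z :: real \<times> 'a::euclidean_space. fst z)"
  by (rule Ck_on_linear[OF _ bounded_linear_fst])

lemma Ck_on_mat_snd: "open S \<Longrightarrow> Ck_on k S (\<lambda>z :: real \<times> 'n::finite herm. mat_of_herm (snd z))"
  by (rule Ck_on_linear[OF _ bounded_linear_compose[OF bounded_linear_mat_of_herm bounded_linear_snd]])

lemma Ck_on_segment_mat:
  assumes S: "open S"
  shows "Ck_on k S (segment_mat P0)"
proof -
  have "segment_mat P0 = (\<lambda>z. mat_of_herm P0 + (fst z *\<^sub>R (- mat_of_herm P0) + fst z *\<^sub>R mat_of_herm (snd z)))"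
    by (simp add: fun_eq_iff segment_mat_def algebra_simps)
  moreover have "Ck_on k S \<dots>"
    by (rule Ck_on_add[OF S Ck_on_const Ck_on_add[OF S
      Ck_on_bounded_bilinear[OF S bounded_bilinear_scaleR Ck_on_fst_linear[OF S] Ck_on_const]
      Ck_on_bounded_bilinear[OF S bounded_bilinear_scaleR Ck_on_fst_linear[OF S] Ck_on_mat_snd[OF S]]]])
  ultimately show ?thesis
    by simp
qed

lemma open_seg_dom: "open (seg_dom P0)"
proof -
  have "continuous_on UNIV (segment_mat P0)"
    using Ck_on_segment_mat[OF open_UNIV, of 0 P0] by simp
  then have "open (segment_mat P0 -` {A. invertible A})"
    using open_vimage open_invertible by blast
  moreover have "open (snd -` PD :: (real \<times> _) set)"
    by (intro open_vimage open_PD continuous_on_snd continuous_on_id)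
  moreover have "seg_dom P0 = segment_mat P0 -` {A. invertible A} \<inter> snd -` PD"
    by (auto simp: seg_dom_def)
  ultimately show ?thesis
    by auto
qed

lemma Ck_on_seg_resolvent: "Ck_on k (seg_dom P0) (seg_resolvent P0)"
  unfolding seg_resolvent_def
  by (rule Ck_on_matrix_inv[OF open_seg_dom _ Ck_on_segment_mat[OF open_seg_dom]])
    (simp add: seg_dom_def)

lemma Ck_on_log_integrand: "Ck_on k (seg_dom P0) (log_integrand P0)"
proof -
  note S = open_seg_dom[of P0]
  have "Ck_on k (seg_dom P0) (\<lambda>z. mat_of_herm (snd z) + (- mat_of_herm P0))"
    by (rule Ck_on_add[OF S Ck_on_mat_snd[OF S] Ck_on_const])
  from Ck_on_bounded_bilinear[OF S bounded_bilinear_matrix_mult this Ck_on_seg_resolvent]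
  show ?thesis
    by (simp add: log_integrand_def[abs_def])
qed

lemma Ck_on_hess_integrand: "Ck_on k (seg_dom P0) (hess_integrand P0 V W)"
proof -
  note S = open_seg_dom[of P0]
  note mult = Ck_on_bounded_bilinear[OF S bounded_bilinear_matrix_mult]
  have "Ck_on k (seg_dom P0) (\<lambda>z. hinv (snd z))"
    by (rule Ck_on_matrix_inv[OF S _ Ck_on_mat_snd[OF S]])
      (simp add: seg_dom_def invertible_PD)
  from Ck_on_bounded_linear[OF S bounded_linear_const_mult[OF bounded_linear_Re_trace, of 2]
      mult[OF mult[OF mult[OF mult[OF mult[OF this Ck_on_const] Ck_on_seg_resolvent] Ck_on_const]
        Ck_on_seg_resolvent] Ck_on_const]]
  show ?thesis
    by (simp add: hess_integrand_def[abs_def])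
qed

lemma smooth_on_sqdist:
  assumes "P0 \<in> PD"
  shows "smooth_on PD (sqdist P0)"
proof -
  have "Ck_on k PD (rel_log P0)" for k
    unfolding rel_log_def[abs_def]
    by (rule Ck_on_integral[OF open_PD seg_dom_superset[OF assms] Ck_on_log_integrand])
  then show ?thesis
    unfolding smooth_on_def sqdist_def[abs_def]
    by (intro allI Ck_on_bounded_linear[OF open_PD bounded_linear_Re_trace]
        Ck_on_bounded_bilinear[OF open_PD bounded_bilinear_matrix_mult])
qed

text \<open>
  A version of \<open>has_derivative_integral_parameter\<close> for integrands whose derivative is known
  explicitly for each fixed \<open>t\<close>.
\<close>

lemma has_derivative_integral_partial:
  fixes G :: "real \<times> 'a::euclidean_space \<Rightarrow> 'b::euclidean_space"
  assumes S: "open S" and sub: "{0..1} \<times> S \<subseteq> W" and G: "Ck_on (Suc 0) W G" and x: "x \<in> S"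
    and D: "\<And>t. t \<in> {0..1} \<Longrightarrow> ((\<lambda>y. G (t, y)) has_derivative D t) (at x)"
  shows "((\<lambda>x. integral {0..1} (\<lambda>t. G (t, x))) has_derivative
    (\<lambda>v. integral {0..1} (\<lambda>t. D t v))) (at x)"
proof -
  have "frechet_derivative G (at (t, x)) (0, v) = D t v" if t: "t \<in> {0..1}" for t v
  proof -
    have "(t, x) \<in> W"
      using sub t x by auto
    have "((\<lambda>y. G (t, y)) has_derivative (\<lambda>v. frechet_derivative G (at (t, x)) (0, v))) (at x)"
      by (rule has_derivative_compose[OF has_derivative_Pair[OF has_derivative_const has_derivative_ident]
        Ck_on_derivative[OF G \<open>(t, x) \<in> W\<close>]])
    from has_derivative_unique[OF this D[OF t]] show ?thesis
      by (rule fun_cong)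
  qed
  then have "integral {0..1} (\<lambda>t. frechet_derivative G (at (t, x)) (0, v))
      = integral {0..1} (\<lambda>t. D t v)" for v
    by (intro integral_cong)
  with has_derivative_integral_parameter[OF S sub G x] show ?thesis
    by simp
qed

lemma has_derivative_seg_resolvent:
  assumes "P0 \<in> PD" "P \<in> PD" "t \<in> {0..1}"
  shows "((\<lambda>Q. seg_resolvent P0 (t, Q)) has_derivative
    (\<lambda>U. - (seg_resolvent P0 (t, P) ** (t *\<^sub>R mat_of_herm U) ** seg_resolvent P0 (t, P)))) (at P)"
proof -
  have "((\<lambda>Q. segment_mat P0 (t, Q)) has_derivative (\<lambda>U. t *\<^sub>R mat_of_herm U)) (at P)"
    unfolding segment_mat_def fst_conv snd_conv
    using has_derivative_add[OF has_derivative_const[of "(1 - t) *\<^sub>R mat_of_herm P0"]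
        has_derivative_scaleR_right[OF has_derivative_mat_of_herm[OF has_derivative_ident]]]
    by simp
  then show ?thesis
    unfolding seg_resolvent_def by (rule has_derivative_matrix_inv_compose) (rule invertible_segment_mat[OF assms])
qed

lemma has_derivative_log_integrand:
  assumes "P0 \<in> PD" "P \<in> PD" "t \<in> {0..1}"
  shows "((\<lambda>Q. log_integrand P0 (t, Q)) has_derivative
    (\<lambda>U. mat_of_herm P0 ** seg_resolvent P0 (t, P) ** mat_of_herm U ** seg_resolvent P0 (t, P))) (at P)"
proof -
  define R where "R = seg_resolvent P0 (t, P)"
  have "((\<lambda>Q. mat_of_herm Q - mat_of_herm P0) has_derivative mat_of_herm) (at P)"
    using has_derivative_diff[OF has_derivative_mat_of_herm[OF has_derivative_ident]
        has_derivative_const[of "mat_of_herm P0"]] by simp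
  from has_derivative_matrix_mult[OF this has_derivative_seg_resolvent[OF assms]]
  have "((\<lambda>Q. log_integrand P0 (t, Q)) has_derivative
      (\<lambda>U. (mat_of_herm P - mat_of_herm P0) ** - (R ** (t *\<^sub>R mat_of_herm U) ** R)
        + mat_of_herm U ** R)) (at P)"
    by (simp add: log_integrand_def R_def)
  moreover have "(mat_of_herm P - mat_of_herm P0) ** - (R ** (t *\<^sub>R mat_of_herm U) ** R)
        + mat_of_herm U ** R = mat_of_herm P0 ** R ** mat_of_herm U ** R" for U
  proof -
    \<comment> \<open>The left-hand side is \<open>(1 - t (P - P0) R) U R\<close>, and \<open>1 - t (P - P0) R = P0 R\<close>.\<close>
    have "t *\<^sub>R (mat_of_herm P - mat_of_herm P0) = segment_mat P0 (t, P) - mat_of_herm P0"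
      by (simp add: segment_mat_def algebra_simps)
    moreover have "segment_mat P0 (t, P) ** R = mat 1"
      unfolding R_def seg_resolvent_def by (rule matrix_inv_right[OF invertible_segment_mat[OF assms]])
    ultimately have "t *\<^sub>R ((mat_of_herm P - mat_of_herm P0) ** R) = mat 1 - mat_of_herm P0 ** R"
      by (metis mm.diff_left mm.scaleR_left)
    then have "t *\<^sub>R ((mat_of_herm P - mat_of_herm P0) ** R) ** (mat_of_herm U ** R)
        = mat_of_herm U ** R - mat_of_herm P0 ** R ** (mat_of_herm U ** R)"
      by (simp add: mm.diff_left)
    then show ?thesis
      by (simp add: mm.minus_right mm.scaleR_left mm.scaleR_right matrix_mul_assoc)
  qed
  ultimately show ?thesis
    by (simp add: R_def)
qed

definition rel_log_deriv :: "'n::finite herm \<Rightarrow> 'n herm \<Rightarrow> 'n herm \<Rightarrow> complex^'n^'n" where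
  "rel_log_deriv P0 P U = integral {0..1}
     (\<lambda>t. mat_of_herm P0 ** seg_resolvent P0 (t, P) ** mat_of_herm U ** seg_resolvent P0 (t, P))"

lemma has_derivative_rel_log:
  assumes "P0 \<in> PD" "P \<in> PD"
  shows "(rel_log P0 has_derivative rel_log_deriv P0 P) (at P)"
  unfolding rel_log_def[abs_def] rel_log_deriv_def[abs_def]
  by (rule has_derivative_integral_partial[OF open_PD seg_dom_superset[OF assms(1)]
      Ck_on_log_integrand assms(2) has_derivative_log_integrand[OF assms]])

lemma has_derivative_sqdist_raw:
  assumes "P0 \<in> PD" "P \<in> PD"
  shows "(sqdist P0 has_derivative (\<lambda>U. 2 * rtr (rel_log P0 P ** rel_log_deriv P0 P U))) (at P)"
proof -
  note L = has_derivative_rel_log[OF assms]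
  have "(sqdist P0 has_derivative (\<lambda>U. rtr (rel_log P0 P ** rel_log_deriv P0 P U
      + rel_log_deriv P0 P U ** rel_log P0 P))) (at P)"
    unfolding sqdist_def[abs_def]
    by (rule bounded_linear.has_derivative[OF bounded_linear_Re_trace has_derivative_matrix_mult[OF L L]])
  then show ?thesis
    unfolding rtr_add rtr_cyclic[of "rel_log_deriv P0 P _"] by simp
qed

lemma continuous_on_seg_resolvent:
  assumes "P0 \<in> PD" "P \<in> PD"
  shows "continuous_on {0..1} (\<lambda>t. seg_resolvent P0 (t, P))"
proof -
  have "continuous_on (seg_dom P0) (seg_resolvent P0)"
    using Ck_on_seg_resolvent[of 0 P0] by simp
  then show ?thesis
    by (rule continuous_on_compose2) (use seg_dom_superset[OF assms(1)] assms(2) in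
        \<open>auto intro!: continuous_intros\<close>)
qed

lemma continuous_on_matrix_mult:
  fixes f g :: "'a::topological_space \<Rightarrow> complex^'n::finite^'n"
  shows "continuous_on S f \<Longrightarrow> continuous_on S g \<Longrightarrow> continuous_on S (\<lambda>x. f x ** g x)"
  by (rule bounded_bilinear.continuous_on[OF bounded_bilinear_matrix_mult])

lemma rtr_rel_log_deriv:
  assumes "P0 \<in> PD" "P \<in> PD"
  shows "rtr (A ** rel_log_deriv P0 P U ** B) = integral {0..1}
    (\<lambda>t. rtr (A ** (mat_of_herm P0 ** seg_resolvent P0 (t, P) ** mat_of_herm U ** seg_resolvent P0 (t, P)) ** B))"
proof -
  have "bounded_linear (\<lambda>X. rtr (A ** X ** B))"
    by (rule bounded_linear_compose[OF bounded_linear_Re_trace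
        bounded_linear_compose[OF mm.bounded_linear_left mm.bounded_linear_right]])
  moreover have "(\<lambda>t. mat_of_herm P0 ** seg_resolvent P0 (t, P) ** mat_of_herm U ** seg_resolvent P0 (t, P))
      integrable_on {0..1}"
    by (intro integrable_continuous_real continuous_on_matrix_mult continuous_on_const
        continuous_on_seg_resolvent assms)
  ultimately show ?thesis
    unfolding rel_log_deriv_def using integral_linear by (fastforce simp: o_def)
qed

lemma has_derivative_hess_integrand:
  assumes "P0 \<in> PD" "P \<in> PD" "t \<in> {0..1}"
  defines "R \<equiv> seg_resolvent P0 (t, P)" and "m \<equiv> mat_of_herm"
  shows "((\<lambda>Q. hess_integrand P0 V W (t, Q)) has_derivative (\<lambda>U. - 2 * (
      rtr (hinv P ** m U ** hinv P ** m P0 ** R ** m V ** R ** m W)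
    + t * rtr (hinv P ** m P0 ** R ** m U ** R ** m V ** R ** m W)
    + t * rtr (hinv P ** m P0 ** R ** m V ** R ** m U ** R ** m W)))) (at P)"
proof -
  note R' = has_derivative_seg_resolvent[OF assms(1-3), folded R_def m_def]
  note I' = has_derivative_hinv[OF assms(2), folded m_def]
  note mult = has_derivative_matrix_mult
  have "((\<lambda>Q. hess_integrand P0 V W (t, Q)) has_derivative (\<lambda>U. 2 * rtr (
     (hinv P ** m P0 ** R ** m V ** R) ** 0 +
     ((hinv P ** m P0 ** R ** m V) ** - (R ** (t *\<^sub>R m U) ** R) +
      ((hinv P ** m P0 ** R) ** 0 +
       ((hinv P ** m P0) ** - (R ** (t *\<^sub>R m U) ** R) +
        (hinv P ** 0 + - (hinv P ** m U ** hinv P) ** m P0) ** R) ** m V) ** R) ** m W))) (at P)"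
    unfolding hess_integrand_def fst_conv snd_conv R_def m_def
    by (rule bounded_linear.has_derivative[OF bounded_linear_const_mult[OF bounded_linear_Re_trace]
       mult[OF mult[OF mult[OF mult[OF mult[OF I' has_derivative_const] R'] has_derivative_const] R']
         has_derivative_const], unfolded R_def m_def])
  then show ?thesis
    by (rule has_derivative_eq_rhs)
      (simp add: fun_eq_iff mm_simps rtr_simps matrix_mul_assoc algebra_simps)
qed

lemma has_derivative_hess_integral:
  assumes "P0 \<in> PD" "P \<in> PD"
  shows "((\<lambda>Q. integral {0..1} (\<lambda>t. hess_integrand P0 V W (t, Q))) has_derivative
    (\<lambda>U. integral {0..1} (\<lambda>t. - 2 * (
      rtr (hinv P ** mat_of_herm U ** hinv P ** mat_of_herm P0 ** seg_resolvent P0 (t, P)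
        ** mat_of_herm V ** seg_resolvent P0 (t, P) ** mat_of_herm W)
    + t * rtr (hinv P ** mat_of_herm P0 ** seg_resolvent P0 (t, P) ** mat_of_herm U ** seg_resolvent P0 (t, P)
        ** mat_of_herm V ** seg_resolvent P0 (t, P) ** mat_of_herm W)
    + t * rtr (hinv P ** mat_of_herm P0 ** seg_resolvent P0 (t, P) ** mat_of_herm V ** seg_resolvent P0 (t, P)
        ** mat_of_herm U ** seg_resolvent P0 (t, P) ** mat_of_herm W))))) (at P)"
  by (rule has_derivative_integral_partial[OF open_PD seg_dom_superset[OF assms(1)]
      Ck_on_hess_integrand assms(2) has_derivative_hess_integrand[OF assms]])

section \<open>Scalar estimates\<close>

text \<open>
  The eigenvalue of \<open>seg_resolvent P0 (t, P)\<close> for an eigenvalue \<open>x\<close> of \<open>P\<close> relative to \<open>P0\<close>.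
\<close>

definition seg_inv :: "real \<Rightarrow> real \<Rightarrow> real" where
  "seg_inv t x = 1 / (1 - t + t * x)"

text \<open>
  The difference quotient of \<open>ln\<close> between \<open>x\<close> and \<open>y\<close>, which is the reciprocal of their logarithmic
  mean; as an integral it covers the case \<open>x = y\<close>, where it is the derivative \<open>1 / x\<close>.
\<close>

definition log_slope :: "real \<Rightarrow> real \<Rightarrow> real" where
  "log_slope x y = integral {0..1} (\<lambda>t. seg_inv t x * seg_inv t y)"

lemma segment_pos:
  fixes t x :: real
  assumes "t \<in> {0..1}" "x > 0"
  shows "0 < 1 - t + t * x"
proof (cases "t = 0")
  case False
  then have "t * x > 0"
    using assms by simp
  then show ?thesis
    using assms by auto
qed simp

lemma seg_inv_pos: "t \<in> {0..1} \<Longrightarrow> x > 0 \<Longrightarrow> seg_inv t x > 0"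
  using segment_pos by (simp add: seg_inv_def)

lemma continuous_on_seg_inv: "x > 0 \<Longrightarrow> continuous_on {0..1} (\<lambda>t. seg_inv t x)"
  unfolding seg_inv_def by (intro continuous_intros) (use segment_pos in fastforce)

lemma has_integral_seg_inv_ln:
  assumes x: "x > 0"
  shows "((\<lambda>t. (x - 1) * seg_inv t x) has_integral ln x) {0..1}"
proof -
  have "((\<lambda>t. (x - 1) * seg_inv t x) has_integral ln (1 - 1 + 1 * x) - ln (1 - 0 + 0 * x)) {0..1}"
  proof (rule fundamental_theorem_of_calculus)
    fix t :: real assume t: "t \<in> {0..1}"
    note pos = segment_pos[OF t x]
    have "((\<lambda>t. ln (1 - t + t * x)) has_real_derivative (x - 1) * seg_inv t x) (at t within {0..1})"
      using pos by (auto intro!: derivative_eq_intros simp: seg_inv_def)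
    then show "((\<lambda>t. ln (1 - t + t * x)) has_vector_derivative (x - 1) * seg_inv t x) (at t within {0..1})"
      by (simp add: has_real_derivative_iff_has_vector_derivative)
  qed simp
  then show ?thesis by simp
qed

lemma log_slope_same:
  assumes x: "x > 0"
  shows "log_slope x x = 1 / x"
proof -
  have "((\<lambda>t. seg_inv t x * seg_inv t x) has_integral 1 * seg_inv 1 x - 0 * seg_inv 0 x) {0..1}"
  proof (rule fundamental_theorem_of_calculus)
    fix t :: real assume t: "t \<in> {0..1}"
    note pos = segment_pos[OF t x]
    have d: "((\<lambda>t. 1 - t + t * x) has_real_derivative x - 1) (at t within {0..1})"
      by (auto intro!: derivative_eq_intros)
    have "((\<lambda>t. t / (1 - t + t * x)) has_real_derivative
        1 / ((1 - t + t * x) * (1 - t + t * x))) (at t within {0..1})"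
      by (rule DERIV_cong[OF DERIV_divide[OF DERIV_ident d]])
        (use pos in \<open>auto simp: algebra_simps\<close>)
    then have "((\<lambda>t. t * seg_inv t x) has_real_derivative seg_inv t x * seg_inv t x) (at t within {0..1})"
      by (simp add: seg_inv_def)
    then show "((\<lambda>t. t * seg_inv t x) has_vector_derivative seg_inv t x * seg_inv t x) (at t within {0..1})"
      by (simp add: has_real_derivative_iff_has_vector_derivative)
  qed simp
  then show ?thesis
    by (simp add: log_slope_def seg_inv_def integral_unique)
qed

lemma log_slope_distinct:
  assumes x: "x > 0" and y: "y > 0" and "x \<noteq> y"
  shows "log_slope x y = (ln x - ln y) / (x - y)"
proof -
  have "((\<lambda>t. ((x - 1) * seg_inv t x - (y - 1) * seg_inv t y) / (x - y)) has_integral (ln x - ln y) / (x - y)) {0..1}"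
    by (intro has_integral_divide has_integral_diff has_integral_seg_inv_ln x y)
  moreover have "((x - 1) * seg_inv t x - (y - 1) * seg_inv t y) / (x - y) = seg_inv t x * seg_inv t y"
    if t: "t \<in> {0..1}" for t
  proof -
    have "(x - 1) * seg_inv t x - (y - 1) * seg_inv t y = (x - y) * (seg_inv t x * seg_inv t y)"
      using segment_pos[OF t x] segment_pos[OF t y]
      by (simp add: seg_inv_def divide_simps) (simp add: algebra_simps)
    then show ?thesis
      using \<open>x \<noteq> y\<close> by simp
  qed
  ultimately have "((\<lambda>t. seg_inv t x * seg_inv t y) has_integral (ln x - ln y) / (x - y)) {0..1}"
    using has_integral_cong[of "{0..1}"] by (metis (no_types, lifting))
  then show ?thesis
    by (simp add: log_slope_def integral_unique)
qed

lemma log_slope_commute: "log_slope x y = log_slope y x"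
  by (simp add: log_slope_def mult.commute)

text \<open>
  The difference of the two sides vanishes at \<open>1\<close> and has derivative \<open>ln s - (1 - 1 / s)\<close>.
\<close>

lemma ln_lower_bound:
  fixes s :: real
  assumes "s \<ge> 1"
  shows "2 * (s - 1) \<le> (s + 1) * ln s"
proof -
  have "(1 + 1) * ln 1 - 2 * (1 - 1) \<le> (s + 1) * ln s - 2 * (s - 1)"
  proof (rule DERIV_nonneg_imp_nondecreasing[OF assms])
    fix x :: real assume x: "1 \<le> x" "x \<le> s"
    have "ln (1 / x) \<le> 1 / x - 1"
      using x by (intro ln_le_minus_one) simp
    then have "0 \<le> ln x + (x + 1) / x - 2"
      using x by (simp add: ln_div field_simps)
    moreover have "((\<lambda>s. (s + 1) * ln s - 2 * (s - 1)) has_real_derivative ln x + (x + 1) / x - 2) (at x)"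
      using x by (auto intro!: derivative_eq_intros)
    ultimately show "\<exists>y. ((\<lambda>s. (s + 1) * ln s - 2 * (s - 1)) has_real_derivative y) (at x) \<and> 0 \<le> y"
      by blast
  qed
  then show ?thesis by simp
qed

text \<open>
  In terms of \<open>\<tau> = ln x - ln y\<close> the quantity \<open>(x + y) * log_slope x y\<close> is \<open>\<tau> coth (\<tau>/2)\<close>. It
  depends only on the quotient \<open>s = x / y\<close>, and the bounds reduce to
  \<open>2 (s - 1) / (s + 1) \<le> ln s \<le> s - 1\<close>.
\<close>

lemma coth_bounds:
  assumes x: "x > 0" and y: "y > 0"
  shows "2 \<le> (x + y) * log_slope x y" "\<bar>ln x - ln y\<bar> \<le> (x + y) * log_slope x y"
    "(x + y) * log_slope x y \<le> \<bar>ln x - ln y\<bar> + 2"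
proof -
  have *: "2 \<le> (x + y) * log_slope x y \<and> \<bar>ln x - ln y\<bar> \<le> (x + y) * log_slope x y
    \<and> (x + y) * log_slope x y \<le> \<bar>ln x - ln y\<bar> + 2" if y: "y > 0" and xy: "x > y" for x y
  proof -
    define s where "s = x / y"
    have s: "s > 1" "x = s * y"
      using that by (simp_all add: s_def)
    have ln: "ln x - ln y = ln s"
      using s y by (simp add: ln_mult)
    have "x > 0" "x \<noteq> y"
      using that by auto
    then have e: "(x + y) * log_slope x y = (s + 1) * ln s / (s - 1)"
      using y s(1) unfolding log_slope_distinct[OF \<open>x > 0\<close> y \<open>x \<noteq> y\<close>] ln
      by (simp add: s(2) divide_simps) (simp add: algebra_simps)
    have l: "0 \<le> ln s" "ln s \<le> s - 1" "2 * (s - 1) \<le> (s + 1) * ln s"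
      using s(1) ln_le_minus_one[of s] ln_lower_bound[of s] by auto
    show ?thesis
      unfolding e ln using l s(1) by (auto simp: divide_simps) (auto simp: algebra_simps)
  qed
  consider "x > y" | "y > x" | "x = y" by linarith
  then have "2 \<le> (x + y) * log_slope x y \<and> \<bar>ln x - ln y\<bar> \<le> (x + y) * log_slope x y
    \<and> (x + y) * log_slope x y \<le> \<bar>ln x - ln y\<bar> + 2"
  proof cases
    case 1
    then show ?thesis using *[OF y] by simp
  next
    case 2
    then show ?thesis
      using *[OF x 2] unfolding log_slope_commute[of y x] by (simp add: add.commute abs_minus_commute)
  next
    case 3
    then show ?thesis using x by (simp add: log_slope_same)
  qed
  then show "2 \<le> (x + y) * log_slope x y" "\<bar>ln x - ln y\<bar> \<le> (x + y) * log_slope x y"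
    "(x + y) * log_slope x y \<le> \<bar>ln x - ln y\<bar> + 2"
    by auto
qed

text \<open>
  With \<open>X\<close> and \<open>Y\<close> the two factors on the right, the left-hand side is at most \<open>X + Y + 2\<close> by the
  triangle inequality for the logarithms, and \<open>X + Y + 2 \<le> 2 X Y\<close> because \<open>X, Y \<ge> 2\<close>.
\<close>

lemma coth_product_bound:
  assumes "x > 0" "y > 0" "z > 0"
  shows "(x + y) * log_slope x y \<le> 2 * ((y + z) * log_slope y z) * ((z + x) * log_slope z x)"
proof -
  define X where "X = (y + z) * log_slope y z"
  define Y where "Y = (z + x) * log_slope z x"
  have X: "2 \<le> X" "\<bar>ln y - ln z\<bar> \<le> X" and Y: "2 \<le> Y" "\<bar>ln z - ln x\<bar> \<le> Y"
    using coth_bounds assms by (simp_all add: X_def Y_def)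
  have "(x + y) * log_slope x y \<le> X + Y + 2"
    using coth_bounds(3)[OF assms(1,2)] X(2) Y(2) by linarith
  moreover have "0 \<le> (X - 2) * (Y - 2)" "0 \<le> (X - 2) * Y" "0 \<le> X * (Y - 2)"
    using X(1) Y(1) by simp_all
  then have "X + Y + 2 \<le> 2 * X * Y"
    using X(1) Y(1) by (simp add: algebra_simps)
  ultimately show ?thesis
    by (simp add: X_def Y_def)
qed

text \<open>
  The Cauchy-Schwarz inequality is used for the sum over the pairs \<open>(a, b)\<close> and then for the inner
  sum over \<open>c\<close>.
\<close>

lemma triple_sum_bound:
  fixes x y z :: "'n::finite \<Rightarrow> 'n \<Rightarrow> real"
  shows "(\<Sum>a\<in>UNIV. \<Sum>b\<in>UNIV. \<Sum>c\<in>UNIV. x a b * y b c * z c a)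
    \<le> sqrt (\<Sum>a\<in>UNIV. \<Sum>b\<in>UNIV. (x a b)\<^sup>2) * sqrt (\<Sum>a\<in>UNIV. \<Sum>b\<in>UNIV. (y a b)\<^sup>2)
      * sqrt (\<Sum>a\<in>UNIV. \<Sum>b\<in>UNIV. (z a b)\<^sup>2)"
proof -
  define v where "v a b = (\<Sum>c\<in>UNIV. y b c * z c a)" for a b
  let ?U = "UNIV :: ('n \<times> 'n) set"
  have pairs: "(\<Sum>a\<in>UNIV. \<Sum>b\<in>UNIV. f a b) = (\<Sum>(a, b)\<in>?U. f a b)" for f :: "'n \<Rightarrow> 'n \<Rightarrow> real"
    by (simp add: sum.cartesian_product)
  define s where "s = (\<Sum>a\<in>UNIV. \<Sum>b\<in>UNIV. \<Sum>c\<in>UNIV. x a b * y b c * z c a)"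
  have s: "s = (\<Sum>(a, b)\<in>?U. x a b * v a b)"
    unfolding s_def pairs[symmetric] v_def by (simp add: sum_distrib_left mult.assoc)
  have "s\<^sup>2 \<le> (\<Sum>(a, b)\<in>?U. (x a b)\<^sup>2) * (\<Sum>(a, b)\<in>?U. (v a b)\<^sup>2)"
    unfolding s using Cauchy_Schwarz_ineq_sum[of "\<lambda>(a, b). x a b" "\<lambda>(a, b). v a b" ?U]
    by (simp add: case_prod_beta)
  also have "(\<Sum>(a, b)\<in>?U. (v a b)\<^sup>2)
      \<le> (\<Sum>a\<in>UNIV. \<Sum>b\<in>UNIV. (\<Sum>c\<in>UNIV. (y b c)\<^sup>2) * (\<Sum>c\<in>UNIV. (z c a)\<^sup>2))"
    unfolding pairs[symmetric] v_def by (intro sum_mono Cauchy_Schwarz_ineq_sum)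
  also have "\<dots> = (\<Sum>b\<in>UNIV. \<Sum>c\<in>UNIV. (y b c)\<^sup>2) * (\<Sum>a\<in>UNIV. \<Sum>c\<in>UNIV. (z c a)\<^sup>2)"
    by (subst sum.swap) (simp only: sum_product)
  also have "(\<Sum>a\<in>UNIV. \<Sum>c\<in>UNIV. (z c a)\<^sup>2) = (\<Sum>a\<in>UNIV. \<Sum>b\<in>UNIV. (z a b)\<^sup>2)"
    by (rule sum.swap)
  finally have "s\<^sup>2 \<le> (\<Sum>a\<in>UNIV. \<Sum>b\<in>UNIV. (x a b)\<^sup>2) * ((\<Sum>a\<in>UNIV. \<Sum>b\<in>UNIV. (y a b)\<^sup>2)
      * (\<Sum>a\<in>UNIV. \<Sum>b\<in>UNIV. (z a b)\<^sup>2))"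
    unfolding pairs by (simp add: mult_left_mono sum_nonneg case_prod_beta)
  then have "\<bar>s\<bar> \<le> sqrt ((\<Sum>a\<in>UNIV. \<Sum>b\<in>UNIV. (x a b)\<^sup>2) * ((\<Sum>a\<in>UNIV. \<Sum>b\<in>UNIV. (y a b)\<^sup>2)
      * (\<Sum>a\<in>UNIV. \<Sum>b\<in>UNIV. (z a b)\<^sup>2)))"
    by (metis real_sqrt_abs real_sqrt_le_iff)
  then show ?thesis
    unfolding s_def[symmetric] real_sqrt_mult by (simp add: mult.assoc)
qed

section \<open>Coordinates in a simultaneous frame\<close>

lemma trace_mult3:
  fixes A B C :: "complex^'n::finite^'n"
  shows "trace (A ** B ** C) = (\<Sum>a\<in>UNIV. \<Sum>b\<in>UNIV. \<Sum>c\<in>UNIV. A $ a $ b * B $ b $ c * C $ c $ a)"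
proof -
  have "trace (A ** B ** C) = (\<Sum>a\<in>UNIV. \<Sum>c\<in>UNIV. \<Sum>b\<in>UNIV. A $ a $ b * B $ b $ c * C $ c $ a)"
    by (simp add: trace_def matrix_matrix_mult_def sum_distrib_right)
  also have "\<dots> = (\<Sum>a\<in>UNIV. \<Sum>b\<in>UNIV. \<Sum>c\<in>UNIV. A $ a $ b * B $ b $ c * C $ c $ a)"
    by (rule sum.cong[OF refl], rule sum.swap)
  finally show ?thesis .
qed

text \<open>
  The map \<open>diagm\<close> is the combination of fixed diagonal units with the entries as coefficients.
\<close>

lemma has_integral_diagm:
  assumes "\<And>i. ((\<lambda>t. x t i) has_integral X i) S"
  shows "((\<lambda>t. diagm (x t) :: complex^'n::finite^'n) has_integral diagm X) S"
proof -
  define e :: "'n \<Rightarrow> complex^'n^'n" where "e i = diagm (\<lambda>j. if i = j then 1 else 0)" for i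
  have *: "diagm y = (\<Sum>i\<in>UNIV. y i *\<^sub>R e i)" for y
    unfolding vec_eq_iff
  proof (intro allI)
    fix a b
    have "(\<Sum>i\<in>UNIV. y i *\<^sub>R e i) $ a $ b = (\<Sum>i\<in>UNIV. if i = a then (diagm y :: complex^'n^'n) $ a $ b else 0)"
      unfolding sum_component by (rule sum.cong) (auto simp: e_def diagm_nth scaleR_conv_of_real[where 'a = complex])
    then show "(diagm y :: complex^'n^'n) $ a $ b = (\<Sum>i\<in>UNIV. y i *\<^sub>R e i) $ a $ b"
      by simp
  qed
  show ?thesis
    unfolding * by (intro has_integral_sum has_integral_scaleR_left assms) auto
qed

context simultaneous_frame
begin

abbreviation frame_diag :: "('n \<Rightarrow> real) \<Rightarrow> complex^'n^'n" where
  "frame_diag \<alpha> \<equiv> h ** diagm \<alpha> ** ctranspose h"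

text \<open>
  The matrix \<open>u\<close> with \<open>U = k u k\<^sup>*\<close>.
\<close>

definition frame_coords :: "'n herm \<Rightarrow> complex^'n^'n" where
  "frame_coords U = ctranspose h ** mat_of_herm U ** h"

text \<open>
  Every trace word that occurs in the third derivative has this form, for a kernel \<open>K\<close> that is a
  product of eigenvalues.
\<close>

definition cubic_sum :: "('n \<Rightarrow> 'n \<Rightarrow> 'n \<Rightarrow> real) \<Rightarrow> 'n herm \<Rightarrow> 'n herm \<Rightarrow> 'n herm \<Rightarrow> real" where
  "cubic_sum K U V W = (\<Sum>a\<in>UNIV. \<Sum>b\<in>UNIV. \<Sum>c\<in>UNIV.
     K a b c * Re (frame_coords U $ a $ b * frame_coords V $ b $ c * frame_coords W $ c $ a))"

lemma p_neq_0: "p i \<noteq> 0"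
  using p_pos[of i] by simp

lemma ctranspose_frame_diag: "ctranspose (frame_diag \<alpha>) = frame_diag \<alpha>"
  by (simp add: ctranspose_mult matrix_mul_assoc)

lemma cancel_hk:
  "ctranspose h ** (k ** X) = X" "ctranspose k ** (h ** X) = X"
  "k ** (ctranspose h ** X) = X" "h ** (ctranspose k ** X) = X"
  for X :: "complex^'n^'n"
  by (simp_all add: matrix_mul_assoc hk)

lemma diagm_mult_left: "diagm \<alpha> ** (diagm \<beta> ** X) = diagm (\<lambda>i :: 'n. \<alpha> i * \<beta> i) ** X"
  for X :: "complex^'n^'n"
  by (simp add: matrix_mul_assoc diagm_mult)

lemma frame_coords_hermitian: "cnj (frame_coords U $ a $ b) = frame_coords U $ b $ a"
proof -
  have "ctranspose (frame_coords U) = frame_coords U"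
    by (simp add: frame_coords_def ctranspose_mult matrix_mul_assoc)
  then show ?thesis
    by (simp add: ctranspose_def vec_eq_iff)
qed

lemma hinv_frame_diag: "hinv P = frame_diag (\<lambda>i. 1 / p i)"
  by (rule hinv_P)

lemma seg_resolvent_frame_diag:
  assumes t: "t \<in> {0..1}"
  shows "seg_resolvent P0 (t, P) = frame_diag (\<lambda>i. seg_inv t (p i))"
  unfolding seg_resolvent_def
proof (rule matrix_inv_unique)
  have "segment_mat P0 (t, P) = k ** diagm (\<lambda>i. 1 - t + t * p i) ** ctranspose k"
  proof -
    have "diagm (\<lambda>i. 1 - t + t * p i) = (1 - t) *\<^sub>R mat 1 + t *\<^sub>R (diagm p :: complex^'n^'n)"
      by (auto simp: vec_eq_iff diagm_nth mat_def complex_eq_iff)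
    then show ?thesis
      by (simp add: segment_mat_def P0_eq P_eq mm_simps)
  qed
  then have "segment_mat P0 (t, P) ** frame_diag (\<lambda>i. seg_inv t (p i))
      = k ** diagm (\<lambda>i. (1 - t + t * p i) * seg_inv t (p i)) ** ctranspose h"
    by (simp add: matrix_mul_assoc[symmetric] cancel_hk diagm_mult_left)
  also have "(\<lambda>i. (1 - t + t * p i) * seg_inv t (p i)) = (\<lambda>i. 1)"
  proof
    fix i
    show "(1 - t + t * p i) * seg_inv t (p i) = 1"
      using segment_pos[OF t p_pos[of i]] by (simp add: seg_inv_def)
  qed
  finally show "segment_mat P0 (t, P) ** frame_diag (\<lambda>i. seg_inv t (p i)) = mat 1"
    by (simp add: diagm_one hk)
qed

lemma hinv_P0_seg_resolvent:
  assumes t: "t \<in> {0..1}"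
  shows "hinv P ** mat_of_herm P0 ** seg_resolvent P0 (t, P) = frame_diag (\<lambda>i. 1 / p i * seg_inv t (p i))"
  unfolding seg_resolvent_frame_diag[OF t] hinv_frame_diag P0_eq
  by (simp add: matrix_mul_assoc[symmetric] cancel_hk diagm_mult_left)

text \<open>
  Since \<open>h\<^sup>* = k\<^sup>-\<^sup>1\<close>, this says that \<open>rel_log P0 P\<close> is the logarithm of
  \<open>P P0\<^sup>-\<^sup>1 = k diag(p) k\<^sup>-\<^sup>1\<close>.
\<close>

lemma rel_log_frame: "rel_log P0 P = k ** diagm (\<lambda>i. ln (p i)) ** ctranspose h"
proof -
  have bl: "bounded_linear (\<lambda>X. k ** X ** ctranspose h)"
    by (rule bounded_linear_compose[OF mm.bounded_linear_left mm.bounded_linear_right])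
  have D: "((\<lambda>t. diagm (\<lambda>i. (p i - 1) * seg_inv t (p i)) :: complex^'n^'n)
      has_integral diagm (\<lambda>i. ln (p i))) {0..1}"
    by (rule has_integral_diagm) (rule has_integral_seg_inv_ln[OF p_pos])
  have "((\<lambda>t. k ** diagm (\<lambda>i. (p i - 1) * seg_inv t (p i)) ** ctranspose h) has_integral
      k ** diagm (\<lambda>i. ln (p i)) ** ctranspose h) {0..1}"
    using has_integral_linear[OF D bl] unfolding o_def .
  moreover have "log_integrand P0 (t, P) = k ** diagm (\<lambda>i. (p i - 1) * seg_inv t (p i)) ** ctranspose h"
    if t: "t \<in> {0..1}" for t
  proof -
    have "diagm (\<lambda>i. p i - 1) = diagm p - (mat 1 :: complex^'n^'n)"
      by (auto simp: vec_eq_iff diagm_nth mat_def)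
    then have "mat_of_herm P - mat_of_herm P0 = k ** diagm (\<lambda>i. p i - 1) ** ctranspose k"
      by (simp add: P_eq P0_eq mm_simps)
    then show ?thesis
      unfolding log_integrand_def seg_resolvent_frame_diag[OF t] snd_conv
      by (simp add: matrix_mul_assoc[symmetric] cancel_hk diagm_mult_left)
  qed
  ultimately show ?thesis
    unfolding rel_log_def
    by (metis (no_types, lifting) has_integral_cong integral_unique)
qed

lemma sqdist_frame: "sqdist P0 P = (\<Sum>i\<in>UNIV. (ln (p i))\<^sup>2)"
proof -
  have "sqdist P0 P = rtr (k ** (diagm (\<lambda>i. ln (p i) * ln (p i)) ** ctranspose h))"
    unfolding sqdist_def rel_log_frame
    by (simp add: matrix_mul_assoc[symmetric] cancel_hk diagm_mult_left)
  also have "\<dots> = rtr (diagm (\<lambda>i. ln (p i) * ln (p i)))"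
    by (subst rtr_cyclic) (simp add: matrix_mul_assoc[symmetric] hk)
  also have "\<dots> = (\<Sum>i\<in>UNIV. (ln (p i))\<^sup>2)"
    by (simp add: trace_diagm power2_eq_square)
  finally show ?thesis .
qed

lemma trace_word1: "rtr (frame_diag \<alpha> ** mat_of_herm U) = (\<Sum>a\<in>UNIV. \<alpha> a * Re (frame_coords U $ a $ a))"
proof -
  have "rtr (frame_diag \<alpha> ** mat_of_herm U) = rtr (h ** (diagm \<alpha> ** (ctranspose h ** mat_of_herm U)))"
    by (simp add: matrix_mul_assoc)
  also have "\<dots> = rtr (diagm \<alpha> ** frame_coords U)"
    by (subst rtr_cyclic) (simp add: frame_coords_def matrix_mul_assoc)
  finally show ?thesis
    by (simp add: trace_def diagm_mult_nth)
qed

lemma trace_word2: "rtr (frame_diag \<alpha> ** mat_of_herm U ** frame_diag \<beta> ** mat_of_herm V)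
    = (\<Sum>a\<in>UNIV. \<Sum>b\<in>UNIV. \<alpha> a * \<beta> b * Re (frame_coords U $ a $ b * frame_coords V $ b $ a))"
proof -
  have "rtr (frame_diag \<alpha> ** mat_of_herm U ** frame_diag \<beta> ** mat_of_herm V)
      = rtr (h ** (diagm \<alpha> ** frame_coords U ** diagm \<beta> ** ctranspose h ** mat_of_herm V))"
    by (simp add: frame_coords_def matrix_mul_assoc)
  also have "\<dots> = rtr ((diagm \<alpha> ** frame_coords U) ** (diagm \<beta> ** frame_coords V))"
    by (subst rtr_cyclic) (simp add: frame_coords_def matrix_mul_assoc)
  also have "\<dots> = (\<Sum>a\<in>UNIV. \<Sum>b\<in>UNIV. \<alpha> a * \<beta> b * Re (frame_coords U $ a $ b * frame_coords V $ b $ a))"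
    by (simp add: trace_def matrix_matrix_mult_def[of "diagm \<alpha> ** frame_coords U"] diagm_mult_nth algebra_simps)
  finally show ?thesis .
qed

lemma trace_word3: "rtr (frame_diag \<alpha> ** mat_of_herm U ** frame_diag \<beta> ** mat_of_herm V ** frame_diag \<gamma> ** mat_of_herm W)
    = cubic_sum (\<lambda>a b c. \<alpha> a * \<beta> b * \<gamma> c) U V W"
proof -
  have "rtr (frame_diag \<alpha> ** mat_of_herm U ** frame_diag \<beta> ** mat_of_herm V ** frame_diag \<gamma> ** mat_of_herm W)
      = rtr (h ** (diagm \<alpha> ** frame_coords U ** diagm \<beta> ** frame_coords V ** diagm \<gamma> ** ctranspose h ** mat_of_herm W))"
    by (simp add: frame_coords_def matrix_mul_assoc)
  also have "\<dots> = rtr ((diagm \<alpha> ** frame_coords U) ** (diagm \<beta> ** frame_coords V) ** (diagm \<gamma> ** frame_coords W))"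
    by (subst rtr_cyclic) (simp add: frame_coords_def matrix_mul_assoc)
  also have "\<dots> = cubic_sum (\<lambda>a b c. \<alpha> a * \<beta> b * \<gamma> c) U V W"
    by (simp add: trace_mult3 diagm_mult_nth cubic_sum_def algebra_simps)
  finally show ?thesis .
qed

text \<open>
  The words in which \<open>V\<close> precedes \<open>U\<close> are brought to the order \<open>U, V, W\<close> by taking the adjoint,
  which does not change the real part of the trace.
\<close>

lemma trace_word3_VUW: "rtr (frame_diag \<alpha> ** mat_of_herm V ** frame_diag \<beta> ** mat_of_herm U ** frame_diag \<gamma> ** mat_of_herm W)
    = cubic_sum (\<lambda>a b c. \<gamma> a * \<beta> b * \<alpha> c) U V W"
proof -
  have "rtr (frame_diag \<alpha> ** mat_of_herm V ** frame_diag \<beta> ** mat_of_herm U ** frame_diag \<gamma> ** mat_of_herm W)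
    = rtr (ctranspose (frame_diag \<alpha> ** mat_of_herm V ** frame_diag \<beta> ** mat_of_herm U ** frame_diag \<gamma> ** mat_of_herm W))"
    by (simp only: rtr_ctranspose)
  also have "\<dots> = rtr (mat_of_herm W ** (frame_diag \<gamma> ** mat_of_herm U ** frame_diag \<beta> ** mat_of_herm V ** frame_diag \<alpha>))"
    by (simp add: ctranspose_mult matrix_mul_assoc)
  also have "\<dots> = rtr (frame_diag \<gamma> ** mat_of_herm U ** frame_diag \<beta> ** mat_of_herm V ** frame_diag \<alpha> ** mat_of_herm W)"
    by (rule rtr_cyclic)
  finally show ?thesis
    unfolding trace_word3 .
qed

lemma trace_word3_VWU: "rtr (frame_diag \<alpha> ** mat_of_herm V ** frame_diag \<beta> ** mat_of_herm W ** frame_diag \<gamma> ** mat_of_herm U)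
    = cubic_sum (\<lambda>a b c. \<gamma> a * \<alpha> b * \<beta> c) U V W"
proof -
  have "rtr (frame_diag \<alpha> ** mat_of_herm V ** frame_diag \<beta> ** mat_of_herm W ** frame_diag \<gamma> ** mat_of_herm U)
     = rtr ((frame_diag \<alpha> ** mat_of_herm V ** frame_diag \<beta> ** mat_of_herm W) ** (frame_diag \<gamma> ** mat_of_herm U))"
    by (simp add: matrix_mul_assoc)
  also have "\<dots> = rtr ((frame_diag \<gamma> ** mat_of_herm U) ** (frame_diag \<alpha> ** mat_of_herm V ** frame_diag \<beta> ** mat_of_herm W))"
    by (rule rtr_cyclic)
  finally show ?thesis
    unfolding trace_word3[symmetric] by (simp add: matrix_mul_assoc)
qed

lemma log_slope_has_integral: "((\<lambda>t. seg_inv t (p a) * seg_inv t (p b)) has_integral log_slope (p a) (p b)) {0..1}"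
  unfolding log_slope_def
  by (intro integrable_integral integrable_continuous_real continuous_on_mult continuous_on_seg_inv p_pos)

text \<open>
  In the frame the resolvents commute with the logarithm under the trace, and the integral of the
  square of \<open>1 / (1 - t + t p)\<close> is \<open>1 / p\<close>.
\<close>

lemma rtr_rel_log_deriv_frame:
  assumes "P0 \<in> PD" "P \<in> PD"
  shows "rtr (rel_log P0 P ** rel_log_deriv P0 P U) = rtr (hinv P ** rel_log P0 P ** mat_of_herm U)"
proof -
  have "rtr (rel_log P0 P ** (mat_of_herm P0 ** seg_resolvent P0 (t, P) ** mat_of_herm U ** seg_resolvent P0 (t, P)))
      = (\<Sum>a\<in>UNIV. seg_inv t (p a) * seg_inv t (p a) * (ln (p a) * Re (frame_coords U $ a $ a)))"
    if t: "t \<in> {0..1}" for t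
  proof -
    let ?r = "\<lambda>i. seg_inv t (p i)"
    have "rtr (rel_log P0 P ** (mat_of_herm P0 ** seg_resolvent P0 (t, P) ** mat_of_herm U ** seg_resolvent P0 (t, P)))
        = rtr ((k ** (diagm (\<lambda>i. ln (p i) * ?r i) ** (ctranspose h ** mat_of_herm U))) ** frame_diag ?r)"
      unfolding rel_log_frame seg_resolvent_frame_diag[OF t] P0_eq
      by (simp add: matrix_mul_assoc[symmetric] cancel_hk diagm_mult_left)
    also have "\<dots> = rtr (frame_diag ?r ** (k ** (diagm (\<lambda>i. ln (p i) * ?r i) ** (ctranspose h ** mat_of_herm U))))"
      by (rule rtr_cyclic)
    also have "\<dots> = rtr (frame_diag (\<lambda>i. ?r i * (ln (p i) * ?r i)) ** mat_of_herm U)"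
      by (simp add: matrix_mul_assoc[symmetric] cancel_hk diagm_mult_left)
    finally show ?thesis
      by (simp add: trace_word1 mult_ac)
  qed
  then have "integral {0..1} (\<lambda>t. rtr (rel_log P0 P ** (mat_of_herm P0 ** seg_resolvent P0 (t, P)
        ** mat_of_herm U ** seg_resolvent P0 (t, P))))
      = integral {0..1} (\<lambda>t. \<Sum>a\<in>UNIV. seg_inv t (p a) * seg_inv t (p a) * (ln (p a) * Re (frame_coords U $ a $ a)))"
    by (intro integral_cong)
  also have "\<dots> = (\<Sum>a\<in>UNIV. log_slope (p a) (p a) * (ln (p a) * Re (frame_coords U $ a $ a)))"
    by (intro integral_unique has_integral_sum has_integral_mult_left log_slope_has_integral) auto
  also have "\<dots> = rtr (frame_diag (\<lambda>i. 1 / p i * ln (p i)) ** mat_of_herm U)"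
    by (simp add: trace_word1 log_slope_same[OF p_pos] mult_ac)
  also have "\<dots> = rtr (hinv P ** rel_log P0 P ** mat_of_herm U)"
    unfolding rel_log_frame hinv_frame_diag
    by (simp add: matrix_mul_assoc[symmetric] cancel_hk diagm_mult_left)
  finally show ?thesis
    using rtr_rel_log_deriv[OF assms, of "rel_log P0 P" U "mat 1"] by simp
qed

lemma ctranspose_hinv_rel_log: "ctranspose (hinv P ** rel_log P0 P) = hinv P ** rel_log P0 P"
proof -
  have "hinv P ** rel_log P0 P = frame_diag (\<lambda>i. 1 / p i * ln (p i))"
    unfolding rel_log_frame hinv_frame_diag
    by (simp add: matrix_mul_assoc[symmetric] cancel_hk diagm_mult_left)
  then show ?thesis
    by (simp only: ctranspose_frame_diag)
qed

text \<open>
  Exchanging \<open>a\<close> and \<open>b\<close> conjugates the products of entries of the Hermitian matrices, so under the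
  real part the weight may be symmetrised.
\<close>

lemma hess_integrand_frame:
  assumes t: "t \<in> {0..1}"
  shows "hess_integrand P0 U V (t, P) = (\<Sum>a\<in>UNIV. \<Sum>b\<in>UNIV.
    (1 / p a + 1 / p b) * (seg_inv t (p a) * seg_inv t (p b)) * Re (frame_coords U $ a $ b * frame_coords V $ b $ a))"
proof -
  let ?f = "\<lambda>a b. 1 / p a * seg_inv t (p a) * seg_inv t (p b) * Re (frame_coords U $ a $ b * frame_coords V $ b $ a)"
  have "Re (frame_coords U $ b $ a * frame_coords V $ a $ b) = Re (frame_coords U $ a $ b * frame_coords V $ b $ a)" for a b
    using frame_coords_hermitian[of U a b] frame_coords_hermitian[of V b a]
    by (metis complex_cnj_mult cnj.simps(1))
  then have swap: "(\<Sum>a\<in>UNIV. \<Sum>b\<in>UNIV. ?f a b)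
      = (\<Sum>a\<in>UNIV. \<Sum>b\<in>UNIV. 1 / p b * seg_inv t (p b) * seg_inv t (p a) * Re (frame_coords U $ a $ b * frame_coords V $ b $ a))"
    by (subst sum.swap) simp
  have "hess_integrand P0 U V (t, P) = (\<Sum>a\<in>UNIV. \<Sum>b\<in>UNIV. ?f a b) + (\<Sum>a\<in>UNIV. \<Sum>b\<in>UNIV. ?f a b)"
    unfolding hess_integrand_def snd_conv hinv_P0_seg_resolvent[OF t]
    unfolding seg_resolvent_frame_diag[OF t] trace_word2 by simp
  also have "\<dots> = (\<Sum>a\<in>UNIV. \<Sum>b\<in>UNIV. ?f a b)
      + (\<Sum>a\<in>UNIV. \<Sum>b\<in>UNIV. 1 / p b * seg_inv t (p b) * seg_inv t (p a) * Re (frame_coords U $ a $ b * frame_coords V $ b $ a))"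
    by (simp only: swap)
  finally show ?thesis
    by (simp add: sum.distrib[symmetric] algebra_simps)
qed

lemma hess_integral_diagonal:
  "integral {0..1} (\<lambda>t. hess_integrand P0 U U (t, P)) = (\<Sum>a\<in>UNIV. \<Sum>b\<in>UNIV.
    (1 / p a + 1 / p b) * log_slope (p a) (p b) * (cmod (frame_coords U $ a $ b))\<^sup>2)"
proof -
  have sq: "Re (frame_coords U $ a $ b * frame_coords U $ b $ a) = (cmod (frame_coords U $ a $ b))\<^sup>2" for a b
    unfolding frame_coords_hermitian[of U a b, symmetric] complex_norm_square[symmetric] by simp
  have "integral {0..1} (\<lambda>t. hess_integrand P0 U U (t, P)) = integral {0..1} (\<lambda>t. \<Sum>a\<in>UNIV. \<Sum>b\<in>UNIV.
    (1 / p a + 1 / p b) * (seg_inv t (p a) * seg_inv t (p b)) * (cmod (frame_coords U $ a $ b))\<^sup>2)"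
    by (rule integral_cong) (simp only: hess_integrand_frame sq)
  also have "\<dots> = (\<Sum>a\<in>UNIV. \<Sum>b\<in>UNIV. (1 / p a + 1 / p b) * log_slope (p a) (p b) * (cmod (frame_coords U $ a $ b))\<^sup>2)"
    by (intro integral_unique has_integral_sum has_integral_mult_left has_integral_mult_right
        log_slope_has_integral) auto
  finally show ?thesis .
qed

end

section \<open>The Hessian\<close>

lemma pd_dist_eq_sqdist:
  fixes P0 P :: "'n::finite herm"
  assumes "P0 \<in> PD" "P \<in> PD"
  shows "(pd_dist P P0)\<^sup>2 = sqdist P0 P"
proof -
  obtain h k p where fr: "simultaneous_frame h k p P P0"
    using PD_simultaneous_frame[OF assms] .
  show ?thesis
    using simultaneous_frame.pd_dist_power2[OF fr assms(2)] simultaneous_frame.sqdist_frame[OF fr]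
    by simp
qed

text \<open>
  Half of the differential of the squared distance is the trace pairing with this matrix.
\<close>

definition grad_mat :: "'n::finite herm \<Rightarrow> 'n herm \<Rightarrow> complex^'n^'n" where
  "grad_mat P0 P = hinv P ** rel_log P0 P"

lemma has_derivative_pd_dist:
  fixes P0 P :: "'n::finite herm"
  assumes P0: "P0 \<in> PD" and P: "P \<in> PD"
  shows "((\<lambda>P. (pd_dist P P0)\<^sup>2) has_derivative (\<lambda>U. 2 * rtr (grad_mat P0 P ** mat_of_herm U))) (at P)"
proof -
  obtain h k p where fr: "simultaneous_frame h k p P P0"
    using PD_simultaneous_frame[OF assms] .
  have "(sqdist P0 has_derivative (\<lambda>U. 2 * rtr (grad_mat P0 P ** mat_of_herm U))) (at P)"
    using has_derivative_sqdist_raw[OF assms]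
    unfolding simultaneous_frame.rtr_rel_log_deriv_frame[OF fr assms] grad_mat_def .
  then show ?thesis
    by (rule has_derivative_transform_within_open[OF _ open_PD P])
      (simp add: pd_dist_eq_sqdist[OF P0])
qed

lemma has_derivative_grad_mat:
  assumes "P0 \<in> PD" "P \<in> PD"
  shows "(grad_mat P0 has_derivative (\<lambda>U. hinv P ** rel_log_deriv P0 P U
    + - (hinv P ** mat_of_herm U ** hinv P) ** rel_log P0 P)) (at P)"
  unfolding grad_mat_def[abs_def]
  by (rule has_derivative_matrix_mult[OF has_derivative_hinv[OF assms(2)] has_derivative_rel_log[OF assms]])

text \<open>
  The left-hand side is the second derivative of the squared distance, corrected by the Christoffel
  term. As \<open>P\<^sup>-\<^sup>1 log (P P0\<^sup>-\<^sup>1)\<close> is Hermitian, the trace words that contain the logarithm have the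
  same real part and cancel; only the derivative of the logarithm remains.
\<close>

lemma hessian_integral_formula:
  fixes P0 P :: "'n::finite herm"
  assumes P0: "P0 \<in> PD" and P: "P \<in> PD"
  shows "2 * rtr ((hinv P ** rel_log_deriv P0 P U
        + - (hinv P ** mat_of_herm U ** hinv P) ** rel_log P0 P) ** mat_of_herm V)
      - 2 * rtr (grad_mat P0 P ** mat_of_herm (pd_christoffel P U V))
    = integral {0..1} (\<lambda>t. hess_integrand P0 U V (t, P))"
proof -
  obtain h k p where fr: "simultaneous_frame h k p P P0"
    using PD_simultaneous_frame[OF assms] .
  let ?I = "hinv P" and ?N = "grad_mat P0 P" and ?U = "mat_of_herm U" and ?V = "mat_of_herm V"
  have N: "ctranspose ?N = ?N"
    unfolding grad_mat_def by (rule simultaneous_frame.ctranspose_hinv_rel_log[OF fr])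
  have 1: "rtr (?I ** ?U ** ?N ** ?V) = rtr (?N ** ?V ** ?I ** ?U)"
    using rtr_cyclic[of "?I ** ?U" "?N ** ?V"] by (simp add: matrix_mul_assoc)
  have "rtr (?N ** ?V ** ?I ** ?U) = rtr (ctranspose (?N ** ?V ** ?I ** ?U))"
    by (simp only: rtr_ctranspose)
  also have "\<dots> = rtr ((?U ** ?I ** ?V) ** ?N)"
    by (simp add: ctranspose_mult N ctranspose_hinv[OF P] matrix_mul_assoc)
  also have "\<dots> = rtr (?N ** (?U ** ?I ** ?V))"
    by (rule rtr_cyclic)
  finally have 2: "rtr (?N ** ?V ** ?I ** ?U) = rtr (?N ** ?U ** ?I ** ?V)"
    by (simp add: matrix_mul_assoc)
  have "rtr (?N ** mat_of_herm (pd_christoffel P U V))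
      = - 1/2 * (rtr (?N ** ?U ** ?I ** ?V) + rtr (?N ** ?V ** ?I ** ?U))"
    unfolding mat_of_christoffel[OF P]
    by (simp add: mm_simps rtr_simps matrix_mul_assoc)
  moreover have "rtr ((?I ** rel_log_deriv P0 P U + - (?I ** ?U ** ?I) ** rel_log P0 P) ** ?V)
      = rtr (?I ** rel_log_deriv P0 P U ** ?V) - rtr (?I ** ?U ** ?N ** ?V)"
    by (simp add: mm_simps rtr_simps grad_mat_def matrix_mul_assoc)
  ultimately have "2 * rtr ((?I ** rel_log_deriv P0 P U + - (?I ** ?U ** ?I) ** rel_log P0 P) ** ?V)
      - 2 * rtr (?N ** mat_of_herm (pd_christoffel P U V)) = 2 * rtr (?I ** rel_log_deriv P0 P U ** ?V)"
    using 1 2 by simp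
  also have "\<dots> = integral {0..1} (\<lambda>t. hess_integrand P0 U V (t, P))"
    unfolding rtr_rel_log_deriv[OF assms] integral_mult_right[symmetric] hess_integrand_def snd_conv
    by (simp add: matrix_mul_assoc)
  finally show ?thesis .
qed

lemma hessian_pd_dist:
  fixes P0 P :: "'n::finite herm"
  assumes P0: "P0 \<in> PD" and P: "P \<in> PD"
  shows "hessian PD affine_inv_metric (\<lambda>P. (pd_dist P P0)\<^sup>2) P U V
    = integral {0..1} (\<lambda>t. hess_integrand P0 U V (t, P))"
proof -
  let ?f = "\<lambda>P. (pd_dist P P0)\<^sup>2"
  have D: "frechet_derivative ?f (at Q) V = 2 * rtr (grad_mat P0 Q ** mat_of_herm V)"
    if "Q \<in> PD" for Q V
    using frechet_derivative_at[OF has_derivative_pd_dist[OF P0 that]] by metis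
  have "frechet_derivative (\<lambda>Q. frechet_derivative ?f (at Q) V) (at P)
      = frechet_derivative (\<lambda>Q. 2 * rtr (grad_mat P0 Q ** mat_of_herm V)) (at P)"
    by (rule frechet_derivative_cong_open[OF open_PD P D])
  moreover have "((\<lambda>Q. 2 * rtr (grad_mat P0 Q ** mat_of_herm V)) has_derivative
      (\<lambda>U. 2 * rtr (grad_mat P0 P ** 0 + (hinv P ** rel_log_deriv P0 P U
    + - (hinv P ** mat_of_herm U ** hinv P) ** rel_log P0 P) ** mat_of_herm V))) (at P)"
    by (rule bounded_linear.has_derivative[OF bounded_linear_const_mult[OF bounded_linear_Re_trace]
        has_derivative_matrix_mult[OF has_derivative_grad_mat[OF assms] has_derivative_const]])
  ultimately have "frechet_derivative (\<lambda>Q. frechet_derivative ?f (at Q) V) (at P) U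
      = 2 * rtr ((hinv P ** rel_log_deriv P0 P U
        + - (hinv P ** mat_of_herm U ** hinv P) ** rel_log P0 P) ** mat_of_herm V)"
    using frechet_derivative_at by (metis (no_types, lifting) add_0 times0_right)
  then show ?thesis
    unfolding hessian_def cov_deriv1_def levi_civita_PD[OF P] D[OF P]
    using hessian_integral_formula[OF assms, of U V] by simp
qed

section \<open>The third covariant derivative\<close>

context simultaneous_frame
begin

lemma cubic_sum_add: "cubic_sum K U V W + cubic_sum K' U V W = cubic_sum (\<lambda>a b c. K a b c + K' a b c) U V W"
  by (simp only: cubic_sum_def sum.distrib[symmetric] distrib_right)

lemma cubic_sum_scale: "r * cubic_sum K U V W = cubic_sum (\<lambda>a b c. r * K a b c) U V W"
  by (simp only: cubic_sum_def sum_distrib_left mult.assoc)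

text \<open>
  The integrand of the weight \<open>hess_weight a b\<close> times \<open>1 / p c\<close>, multiplied by
  \<open>(1 - t - t p\<^sub>c) / (1 - t + t p\<^sub>c)\<close>.
\<close>

definition third_kernel :: "real \<Rightarrow> 'n \<Rightarrow> 'n \<Rightarrow> 'n \<Rightarrow> real" where
  "third_kernel t a b c = (1 / p a + 1 / p b) * (1 / p c) * (seg_inv t (p a) * seg_inv t (p b))
     * (seg_inv t (p c) * (1 - t - t * p c))"

text \<open>
  On the right, the terms with factor \<open>-2\<close> come from differentiating \<open>P\<^sup>-\<^sup>1\<close> and the two resolvents
  in the Hessian, and the other four come from the Christoffel symbols. All are brought to the common
  factor \<open>r\<^sub>a r\<^sub>b r\<^sub>c\<close> by means of \<open>q = r (q (1 - t) + t)\<close>, which restates \<open>p q = 1\<close> and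
  \<open>r (1 - t + t p) = 1\<close>.
\<close>

lemma third_kernel_identity:
  assumes t: "t \<in> {0..1}"
  defines "q \<equiv> \<lambda>i. 1 / p i" and "r \<equiv> \<lambda>i. seg_inv t (p i)"
  shows "third_kernel t a b c
    = - 2 * (q a * (q b * r b) * r c + t * ((q a * r a) * r b * r c) + t * (r a * r b * (q c * r c)))
      + ((q a * r a) * q b * r c + r a * q b * (q c * r c))
      + (q a * r b * (q c * r c) + q a * (q b * r b) * r c)"
proof -
  have q: "q i * p i = 1" for i
    by (simp add: q_def p_neq_0)
  have r: "r i * (1 - t + t * p i) = 1" for i
    using segment_pos[OF t p_pos[of i]] by (simp add: r_def seg_inv_def)
  have rq: "q i = r i * (q i * (1 - t) + t)" for i
  proof -
    have "r i * (q i * (1 - t) + t) = q i * (r i * (1 - t + t * p i)) + r i * t * (1 - q i * p i)"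
      by (simp add: algebra_simps)
    then show ?thesis
      by (simp add: q r)
  qed
  define \<rho> where "\<rho> = r a * r b * r c"
  have a: "q a * r b * r c = \<rho> * (q a * (1 - t) + t)"
    by (subst rq) (simp add: \<rho>_def)
  have b: "q b * r a * r c = \<rho> * (q b * (1 - t) + t)"
    by (subst rq) (simp add: \<rho>_def)
  have c: "q c * (1 - t - t * p c) = q c * (1 - t) - t"
    using q[of c] by (simp add: algebra_simps)
  have "third_kernel t a b c = (q a + q b) * \<rho> * (q c * (1 - t - t * p c))"
    by (simp add: third_kernel_def q_def r_def \<rho>_def)
  also have "\<dots> = - q b * (\<rho> * (q a * (1 - t) + t)) + q a * (\<rho> * (q b * (1 - t) + t))
      + q c * (\<rho> * (q b * (1 - t) + t)) + q c * (\<rho> * (q a * (1 - t) + t)) - 2 * t * (q a + q c) * \<rho>"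
    unfolding c by (simp add: algebra_simps)
  finally have "third_kernel t a b c = - q b * (q a * r b * r c) + q a * (q b * r a * r c)
      + q c * (q b * r a * r c) + q c * (q a * r b * r c) - 2 * t * (q a + q c) * \<rho>"
    unfolding a b .
  then show ?thesis
    by (simp add: \<rho>_def algebra_simps)
qed

lemma third_integrand_frame:
  assumes P: "P \<in> PD" and t: "t \<in> {0..1}"
  defines "R \<equiv> seg_resolvent P0 (t, P)"
  shows "- 2 * (
      rtr (hinv P ** mat_of_herm U ** hinv P ** mat_of_herm P0 ** R ** mat_of_herm V ** R ** mat_of_herm W)
    + t * rtr (hinv P ** mat_of_herm P0 ** R ** mat_of_herm U ** R ** mat_of_herm V ** R ** mat_of_herm W)
    + t * rtr (hinv P ** mat_of_herm P0 ** R ** mat_of_herm V ** R ** mat_of_herm U ** R ** mat_of_herm W))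
    - hess_integrand P0 (pd_christoffel P U V) W (t, P)
    - hess_integrand P0 V (pd_christoffel P U W) (t, P)
    = cubic_sum (third_kernel t) U V W"
proof -
  let ?q = "\<lambda>i. 1 / p i" and ?r = "\<lambda>i. seg_inv t (p i)" and ?m = mat_of_herm
  let ?qr = "\<lambda>i. 1 / p i * seg_inv t (p i)"
  have A: "hinv P ** ?m P0 ** R = frame_diag ?qr"
    unfolding R_def by (rule hinv_P0_seg_resolvent[OF t])
  have I: "hinv P = frame_diag ?q"
    by (rule hinv_frame_diag)
  have R: "R = frame_diag ?r"
    unfolding R_def by (rule seg_resolvent_frame_diag[OF t])
  have "rtr (hinv P ** ?m U ** hinv P ** ?m P0 ** R ** ?m V ** R ** ?m W)
      = rtr (hinv P ** ?m U ** (hinv P ** ?m P0 ** R) ** ?m V ** R ** ?m W)"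
    by (simp only: matrix_mul_assoc)
  also have "\<dots> = cubic_sum (\<lambda>a b c. ?q a * ?qr b * ?r c) U V W"
    unfolding A unfolding I R trace_word3 ..
  finally have 1: "rtr (hinv P ** ?m U ** hinv P ** ?m P0 ** R ** ?m V ** R ** ?m W)
      = cubic_sum (\<lambda>a b c. ?q a * ?qr b * ?r c) U V W" .
  have 2: "rtr (hinv P ** ?m P0 ** R ** ?m U ** R ** ?m V ** R ** ?m W)
      = cubic_sum (\<lambda>a b c. ?qr a * ?r b * ?r c) U V W"
    unfolding A unfolding R trace_word3 ..
  have 3: "rtr (hinv P ** ?m P0 ** R ** ?m V ** R ** ?m U ** R ** ?m W)
      = cubic_sum (\<lambda>a b c. ?r a * ?r b * ?qr c) U V W"
    unfolding A unfolding R trace_word3_VUW ..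
  have "rtr (hinv P ** ?m P0 ** R ** ?m U ** hinv P ** ?m V ** R ** ?m W)
      = cubic_sum (\<lambda>a b c. ?qr a * ?q b * ?r c) U V W"
    unfolding A unfolding I R by (rule trace_word3)
  moreover have "rtr (hinv P ** ?m P0 ** R ** ?m V ** hinv P ** ?m U ** R ** ?m W)
      = cubic_sum (\<lambda>a b c. ?r a * ?q b * ?qr c) U V W"
    unfolding A unfolding I R by (rule trace_word3_VUW)
  moreover have "hess_integrand P0 (pd_christoffel P U V) W (t, P)
      = - (rtr (hinv P ** ?m P0 ** R ** ?m U ** hinv P ** ?m V ** R ** ?m W)
        + rtr (hinv P ** ?m P0 ** R ** ?m V ** hinv P ** ?m U ** R ** ?m W))"
    unfolding hess_integrand_def snd_conv mat_of_christoffel[OF P] R_def[symmetric]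
    by (simp add: mm_simps rtr_simps matrix_mul_assoc add_divide_distrib)
  ultimately have 4: "hess_integrand P0 (pd_christoffel P U V) W (t, P)
      = - (cubic_sum (\<lambda>a b c. ?qr a * ?q b * ?r c) U V W + cubic_sum (\<lambda>a b c. ?r a * ?q b * ?qr c) U V W)"
    by (simp only:)
  have "rtr (hinv P ** ?m P0 ** R ** ?m V ** R ** ?m U ** hinv P ** ?m W)
      = cubic_sum (\<lambda>a b c. ?q a * ?r b * ?qr c) U V W"
    unfolding A unfolding I R by (rule trace_word3_VUW)
  moreover have "rtr (hinv P ** ?m P0 ** R ** ?m V ** R ** ?m W ** hinv P ** ?m U)
      = cubic_sum (\<lambda>a b c. ?q a * ?qr b * ?r c) U V W"
    unfolding A unfolding I R by (rule trace_word3_VWU)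
  moreover have "hess_integrand P0 V (pd_christoffel P U W) (t, P)
      = - (rtr (hinv P ** ?m P0 ** R ** ?m V ** R ** ?m U ** hinv P ** ?m W)
        + rtr (hinv P ** ?m P0 ** R ** ?m V ** R ** ?m W ** hinv P ** ?m U))"
    unfolding hess_integrand_def snd_conv mat_of_christoffel[OF P] R_def[symmetric]
    by (simp add: mm_simps rtr_simps matrix_mul_assoc add_divide_distrib)
  ultimately have 5: "hess_integrand P0 V (pd_christoffel P U W) (t, P)
      = - (cubic_sum (\<lambda>a b c. ?q a * ?r b * ?qr c) U V W + cubic_sum (\<lambda>a b c. ?q a * ?qr b * ?r c) U V W)"
    by (simp only:)
  show ?thesis
    unfolding 1 2 3 4 5 diff_minus_eq_add cubic_sum_scale cubic_sum_add
    by (rule arg_cong[where f = "\<lambda>K. cubic_sum K U V W"], intro ext third_kernel_identity[OF t, symmetric])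
qed

text \<open>
  The quantity \<open>\<tau> coth (\<tau>/2)\<close> for \<open>\<tau> = ln (p a) - ln (p b)\<close>, divided by \<open>p a * p b\<close>; the division
  accounts for coordinates that are orthonormal for \<open>P0\<close> rather than for \<open>P\<close>.
\<close>

definition hess_weight :: "'n \<Rightarrow> 'n \<Rightarrow> real" where
  "hess_weight a b = (1 / p a + 1 / p b) * log_slope (p a) (p b)"

lemma hess_weight_nonneg: "hess_weight a b \<ge> 0"
proof -
  have "(p a + p b) * log_slope (p a) (p b) \<ge> 2"
    by (rule coth_bounds) (rule p_pos)+
  then have "log_slope (p a) (p b) \<ge> 0"
    using p_pos[of a] p_pos[of b] by (smt (verit) mult_pos_neg)
  then show ?thesis
    using p_pos[of a] p_pos[of b] by (simp add: hess_weight_def)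
qed

text \<open>
  This is \<open>coth_product_bound\<close> in unnormalised coordinates: multiplied by \<open>hess_weight a b\<close>, it bounds
  the square of the left-hand side.
\<close>

lemma hess_weight_product_bound: "hess_weight a b * (1 / p c) \<le> sqrt 2 * (sqrt (hess_weight a b) * sqrt (hess_weight b c) * sqrt (hess_weight c a))"
proof -
  let ?\<phi> = "\<lambda>a b. (p a + p b) * log_slope (p a) (p b)"
  have hess_weight: "hess_weight a b = ?\<phi> a b * ((1 / p a) * (1 / p b))" for a b
    using p_neq_0[of a] p_neq_0[of b] by (simp add: hess_weight_def field_simps)
  have "?\<phi> a b * ((1 / p a) * (1 / p b) * (1 / p c)\<^sup>2)
      \<le> 2 * ?\<phi> b c * ?\<phi> c a * ((1 / p a) * (1 / p b) * (1 / p c)\<^sup>2)"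
    using coth_product_bound[OF p_pos p_pos p_pos, of a b c] p_pos
    by (intro mult_right_mono) (simp_all add: less_imp_le)
  then have "hess_weight a b * (1 / p c)\<^sup>2 \<le> 2 * (hess_weight b c * hess_weight c a)"
    unfolding hess_weight by (simp add: power2_eq_square mult_ac)
  then have "hess_weight a b * (hess_weight a b * (1 / p c)\<^sup>2) \<le> hess_weight a b * (2 * (hess_weight b c * hess_weight c a))"
    by (rule mult_left_mono) (rule hess_weight_nonneg)
  then have "(hess_weight a b * (1 / p c))\<^sup>2 \<le> 2 * (hess_weight a b * hess_weight b c * hess_weight c a)"
    by (simp add: power2_eq_square mult_ac)
  then have "hess_weight a b * (1 / p c) \<le> sqrt (2 * (hess_weight a b * hess_weight b c * hess_weight c a))"
    by (rule real_le_rsqrt)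
  then show ?thesis
    by (simp add: real_sqrt_mult)
qed

lemma hess_integral_weighted:
  "integral {0..1} (\<lambda>t. hess_integrand P0 U U (t, P))
    = (\<Sum>a\<in>UNIV. \<Sum>b\<in>UNIV. (sqrt (hess_weight a b) * cmod (frame_coords U $ a $ b))\<^sup>2)"
  unfolding hess_integral_diagonal by (simp add: hess_weight_def[symmetric] power_mult_distrib hess_weight_nonneg)

lemma third_kernel_bound:
  assumes t: "t \<in> {0..1}"
  shows "\<bar>third_kernel t a b c\<bar> \<le> (1 / p a + 1 / p b) * (1 / p c) * (seg_inv t (p a) * seg_inv t (p b))"
proof -
  have "\<bar>1 - t - t * p c\<bar> \<le> 1 - t + t * p c"
    using t p_pos[of c] by (auto simp: abs_le_iff)
  then have le1: "\<bar>seg_inv t (p c) * (1 - t - t * p c)\<bar> \<le> 1"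
    using segment_pos[OF t p_pos[of c]] by (simp add: seg_inv_def abs_mult divide_simps)
  have nonneg: "0 \<le> (1 / p a + 1 / p b) * (1 / p c) * (seg_inv t (p a) * seg_inv t (p b))"
    using p_pos seg_inv_pos[OF t p_pos] by (simp add: less_imp_le)
  show ?thesis
    unfolding third_kernel_def abs_mult[of _ "seg_inv t (p c) * (1 - t - t * p c)"] abs_of_nonneg[OF nonneg]
    using mult_left_mono[OF le1 nonneg] by (simp only: mult_1_right)
qed

lemma abs_integral_cubic_sum_le:
  "\<bar>integral {0..1} (\<lambda>t. cubic_sum (third_kernel t) U V W)\<bar>
    \<le> sqrt 2 * sqrt (integral {0..1} (\<lambda>t. hess_integrand P0 U U (t, P)))
      * sqrt (integral {0..1} (\<lambda>t. hess_integrand P0 V V (t, P)))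
      * sqrt (integral {0..1} (\<lambda>t. hess_integrand P0 W W (t, P)))"
proof -
  let ?u = "\<lambda>a b. cmod (frame_coords U $ a $ b)" and ?v = "\<lambda>a b. cmod (frame_coords V $ a $ b)"
  let ?w = "\<lambda>a b. cmod (frame_coords W $ a $ b)"
  define B where "B t = (\<Sum>a\<in>UNIV. \<Sum>b\<in>UNIV. \<Sum>c\<in>UNIV.
    seg_inv t (p a) * seg_inv t (p b) * ((1 / p a + 1 / p b) * (1 / p c) * (?u a b * ?v b c * ?w c a)))" for t
  have cont: "continuous_on {0..1} (\<lambda>t. cubic_sum (third_kernel t) U V W)"
    unfolding cubic_sum_def third_kernel_def
    by (intro continuous_intros continuous_on_seg_inv p_pos)
  have B: "(B has_integral (\<Sum>a\<in>UNIV. \<Sum>b\<in>UNIV. \<Sum>c\<in>UNIV.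
      log_slope (p a) (p b) * ((1 / p a + 1 / p b) * (1 / p c) * (?u a b * ?v b c * ?w c a)))) {0..1}"
    unfolding B_def by (intro has_integral_sum has_integral_mult_left log_slope_has_integral) auto
  have "\<bar>cubic_sum (third_kernel t) U V W\<bar> \<le> B t" if t: "t \<in> {0..1}" for t
  proof -
    have bnd: "\<bar>third_kernel t a b c * Re (frame_coords U $ a $ b * frame_coords V $ b $ c * frame_coords W $ c $ a)\<bar>
      \<le> seg_inv t (p a) * seg_inv t (p b) * ((1 / p a + 1 / p b) * (1 / p c) * (?u a b * ?v b c * ?w c a))" for a b c
    proof -
      have "\<bar>Re (frame_coords U $ a $ b * frame_coords V $ b $ c * frame_coords W $ c $ a)\<bar> \<le> ?u a b * ?v b c * ?w c a"
        using abs_Re_le_cmod[of "frame_coords U $ a $ b * frame_coords V $ b $ c * frame_coords W $ c $ a"]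
        unfolding norm_mult .
      then have "\<bar>third_kernel t a b c\<bar> * \<bar>Re (frame_coords U $ a $ b * frame_coords V $ b $ c * frame_coords W $ c $ a)\<bar>
        \<le> ((1 / p a + 1 / p b) * (1 / p c) * (seg_inv t (p a) * seg_inv t (p b))) * (?u a b * ?v b c * ?w c a)"
        using third_kernel_bound[OF t, of a b c] by (intro mult_mono) auto
      then show ?thesis
        by (simp only: abs_mult mult_ac)
    qed
    show ?thesis
      unfolding cubic_sum_def B_def
      by (rule order_trans[OF sum_abs sum_mono])+ (rule bnd)
  qed
  then have "\<bar>integral {0..1} (\<lambda>t. cubic_sum (third_kernel t) U V W)\<bar> \<le> integral {0..1} B"
    by (rule integral_norm_bound_integral[OF integrable_continuous_real[OF cont]
        has_integral_integrable[OF B], unfolded real_norm_def])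
  also have "integral {0..1} B = (\<Sum>a\<in>UNIV. \<Sum>b\<in>UNIV. \<Sum>c\<in>UNIV.
      hess_weight a b * (1 / p c) * (?u a b * ?v b c * ?w c a))"
    unfolding integral_unique[OF B] hess_weight_def by (simp only: mult_ac)
  also have "\<dots> \<le> (\<Sum>a\<in>UNIV. \<Sum>b\<in>UNIV. \<Sum>c\<in>UNIV.
      sqrt 2 * (sqrt (hess_weight a b) * sqrt (hess_weight b c) * sqrt (hess_weight c a)) * (?u a b * ?v b c * ?w c a))"
    by (intro sum_mono mult_right_mono hess_weight_product_bound) simp
  also have "\<dots> = sqrt 2 * (\<Sum>a\<in>UNIV. \<Sum>b\<in>UNIV. \<Sum>c\<in>UNIV.
      (sqrt (hess_weight a b) * ?u a b) * (sqrt (hess_weight b c) * ?v b c) * (sqrt (hess_weight c a) * ?w c a))"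
    by (simp only: sum_distrib_left mult_ac)
  also have "\<dots> \<le> sqrt 2 * (sqrt (integral {0..1} (\<lambda>t. hess_integrand P0 U U (t, P)))
      * sqrt (integral {0..1} (\<lambda>t. hess_integrand P0 V V (t, P)))
      * sqrt (integral {0..1} (\<lambda>t. hess_integrand P0 W W (t, P))))"
    unfolding hess_integral_weighted by (intro mult_left_mono triple_sum_bound) simp
  finally show ?thesis
    by (simp only: mult.assoc)
qed

end

lemma continuous_on_rtr: "continuous_on S f \<Longrightarrow> continuous_on S (\<lambda>x. rtr (f x))"
  by (rule bounded_linear.continuous_on[OF bounded_linear_Re_trace])

lemma hess_integrand_integrable:
  assumes "P0 \<in> PD" "P \<in> PD"
  shows "(\<lambda>t. hess_integrand P0 U V (t, P)) integrable_on {0..1}"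
  unfolding hess_integrand_def snd_conv
  by (intro integrable_continuous_real continuous_on_mult continuous_on_const continuous_on_rtr
      continuous_on_matrix_mult continuous_on_seg_resolvent assms)

lemma third_cov_deriv_pd_dist:
  fixes P0 P :: "'n::finite herm"
  assumes P0: "P0 \<in> PD" and P: "P \<in> PD" and fr: "simultaneous_frame h k p P P0"
  shows "third_cov_deriv PD affine_inv_metric (\<lambda>P. (pd_dist P P0)\<^sup>2) P U V W
    = integral {0..1} (\<lambda>t. simultaneous_frame.cubic_sum h (simultaneous_frame.third_kernel p t) U V W)"
proof -
  interpret simultaneous_frame h k p P P0 by (rule fr)
  let ?H = "hessian PD affine_inv_metric (\<lambda>P. (pd_dist P P0)\<^sup>2)"
  define D where "D t = - 2 * (
      rtr (hinv P ** mat_of_herm U ** hinv P ** mat_of_herm P0 ** seg_resolvent P0 (t, P)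
        ** mat_of_herm V ** seg_resolvent P0 (t, P) ** mat_of_herm W)
    + t * rtr (hinv P ** mat_of_herm P0 ** seg_resolvent P0 (t, P) ** mat_of_herm U ** seg_resolvent P0 (t, P)
        ** mat_of_herm V ** seg_resolvent P0 (t, P) ** mat_of_herm W)
    + t * rtr (hinv P ** mat_of_herm P0 ** seg_resolvent P0 (t, P) ** mat_of_herm V ** seg_resolvent P0 (t, P)
        ** mat_of_herm U ** seg_resolvent P0 (t, P) ** mat_of_herm W))" for t
  have "D integrable_on {0..1}"
    unfolding D_def
    by (intro integrable_continuous_real continuous_on_mult continuous_on_add continuous_on_const
        continuous_on_id continuous_on_rtr continuous_on_matrix_mult continuous_on_seg_resolvent assms)
  have "frechet_derivative (\<lambda>Q. ?H Q V W) (at P)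
      = frechet_derivative (\<lambda>Q. integral {0..1} (\<lambda>t. hess_integrand P0 V W (t, Q))) (at P)"
    by (rule frechet_derivative_cong_open[OF open_PD P hessian_pd_dist[OF P0]])
  then have "frechet_derivative (\<lambda>Q. ?H Q V W) (at P) U = integral {0..1} D"
    unfolding frechet_derivative_at[OF has_derivative_hess_integral[OF P0 P], symmetric] D_def
    by (rule fun_cong)
  then have "third_cov_deriv PD affine_inv_metric (\<lambda>P. (pd_dist P P0)\<^sup>2) P U V W
      = integral {0..1} D - integral {0..1} (\<lambda>t. hess_integrand P0 (pd_christoffel P U V) W (t, P))
        - integral {0..1} (\<lambda>t. hess_integrand P0 V (pd_christoffel P U W) (t, P))"
    unfolding third_cov_deriv_def cov_deriv2_def levi_civita_PD[OF P] hessian_pd_dist[OF P0 P]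
    by simp
  also have "\<dots> = integral {0..1} (\<lambda>t. D t - hess_integrand P0 (pd_christoffel P U V) W (t, P)
        - hess_integrand P0 V (pd_christoffel P U W) (t, P))"
    using \<open>D integrable_on {0..1}\<close> hess_integrand_integrable[OF P0 P]
    by (simp add: integral_diff integrable_diff)
  also have "\<dots> = integral {0..1} (\<lambda>t. cubic_sum (third_kernel t) U V W)"
    unfolding D_def by (rule integral_cong) (rule third_integrand_frame[OF P])
  finally show ?thesis .
qed

section \<open>Geodesic convexity and self-concordance\<close>

text \<open>
  The derivatives at the end points are one-sided, as for a geodesic defined on a closed interval.
  The mean value theorem makes \<open>f'\<close> increasing and puts the graph of \<open>f\<close> above its tangents.
\<close>

lemma convex_on_second_derivative_nonneg:
  fixes f :: "real \<Rightarrow> real"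
  assumes f': "\<And>t. t \<in> {a..b} \<Longrightarrow> (f has_real_derivative f' t) (at t within {a..b})"
    and f'': "\<And>t. t \<in> {a..b} \<Longrightarrow> (f' has_real_derivative f'' t) (at t within {a..b})"
    and nonneg: "\<And>t. t \<in> {a..b} \<Longrightarrow> f'' t \<ge> 0"
  shows "convex_on {a..b} f"
proof -
  have mvt: "\<exists>z\<in>{x<..<y}. g y - g x = g' z * (y - x)"
    if "\<And>t. t \<in> {a..b} \<Longrightarrow> (g has_real_derivative g' t) (at t within {a..b})"
      "x \<in> {a..b}" "y \<in> {a..b}" "x < y" for g g' x y
  proof (rule mvt_simple[OF \<open>x < y\<close>])
    fix t assume "x \<le> t" "t \<le> y"
    then have "(g has_real_derivative g' t) (at t within {x..y})"
      using that by (intro has_field_derivative_subset[OF that(1)]) auto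
    then show "(g has_derivative (\<lambda>h. g' t * h)) (at t within {x..y})"
      by (simp add: has_field_derivative_def)
  qed
  have mono: "f' x \<le> f' y" if xy: "x \<in> {a..b}" "y \<in> {a..b}" "x \<le> y" for x y
  proof (cases "x = y")
    case False
    then obtain z where "z \<in> {x<..<y}" "f' y - f' x = f'' z * (y - x)"
      using mvt[OF f'' xy(1,2)] xy(3) by force
    moreover from this have "f'' z * (y - x) \<ge> 0"
      using xy nonneg[of z] by auto
    ultimately show ?thesis by simp
  qed simp
  have "f' x * (y - x) \<le> f y - f x" if xy: "x \<in> {a..b}" "y \<in> {a..b}" for x y
  proof (rule linorder_cases[of x y])
    assume "x < y"
    then obtain z where z: "z \<in> {x<..<y}" "f y - f x = f' z * (y - x)"
      using mvt[OF f' xy] by force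
    then have "f' x \<le> f' z"
      using xy by (intro mono) auto
    then show ?thesis
      unfolding z(2) using \<open>x < y\<close> by (intro mult_right_mono) auto
  next
    assume "y < x"
    then obtain z where z: "z \<in> {y<..<x}" "f x - f y = f' z * (x - y)"
      using mvt[OF f' xy(2,1)] by force
    then have "f' z \<le> f' x"
      using xy by (intro mono) auto
    then have "f' z * (x - y) \<le> f' x * (x - y)"
      using \<open>y < x\<close> by (intro mult_right_mono) auto
    then show ?thesis
      using z(2) by (simp add: algebra_simps)
  qed simp
  then show ?thesis
    by (intro pos_convex_function[of _ f']) auto
qed

text \<open>
  Along a geodesic the second derivative of the squared distance is its Hessian at the velocity,
  because the geodesic equation turns the acceleration into the Christoffel term.
\<close>

lemma geodesically_convex_pd_dist:
  fixes P0 :: "'n::finite herm"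
  assumes P0: "P0 \<in> PD"
  shows "geodesically_convex_on PD affine_inv_metric (\<lambda>P. (pd_dist P P0)\<^sup>2)"
  unfolding geodesically_convex_on_def
proof (intro allI impI)
  fix \<gamma> :: "real \<Rightarrow> 'n herm"
  let ?I = "{0..1} :: real set" and ?m = mat_of_herm
  assume "geodesic_on ?I PD affine_inv_metric \<gamma>"
  then obtain \<gamma>' where PD: "\<And>t. t \<in> ?I \<Longrightarrow> \<gamma> t \<in> PD"
    and \<gamma>': "\<And>t. t \<in> ?I \<Longrightarrow> (\<gamma> has_vector_derivative \<gamma>' t) (at t within ?I)"
    and \<gamma>'': "\<And>t. t \<in> ?I \<Longrightarrow> (\<gamma>' has_vector_derivative
        - levi_civita PD affine_inv_metric (\<gamma> t) (\<gamma>' t) (\<gamma>' t)) (at t within ?I)"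
    unfolding geodesic_on_def by blast
  define G where "G t = grad_mat P0 (\<gamma> t)" for t
  define DG where "DG t = hinv (\<gamma> t) ** rel_log_deriv P0 (\<gamma> t) (\<gamma>' t)
    + - (hinv (\<gamma> t) ** ?m (\<gamma>' t) ** hinv (\<gamma> t)) ** rel_log P0 (\<gamma> t)" for t
  have f': "((\<lambda>t. (pd_dist (\<gamma> t) P0)\<^sup>2) has_real_derivative 2 * rtr (G t ** ?m (\<gamma>' t))) (at t within ?I)"
    if t: "t \<in> ?I" for t
    using has_derivative_compose[OF \<gamma>'[OF t, unfolded has_vector_derivative_def]
        has_derivative_pd_dist[OF P0 PD[OF t]]]
    unfolding has_field_derivative_def G_def
    by (rule has_derivative_eq_rhs) (simp add: mat_of_herm_simps mm_simps rtr_simps fun_eq_iff)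
  have f'': "((\<lambda>t. 2 * rtr (G t ** ?m (\<gamma>' t))) has_real_derivative
      integral ?I (\<lambda>s. hess_integrand P0 (\<gamma>' t) (\<gamma>' t) (s, \<gamma> t))) (at t within ?I)"
    if t: "t \<in> ?I" for t
  proof -
    let ?\<Gamma> = "pd_christoffel (\<gamma> t) (\<gamma>' t) (\<gamma>' t)"
    have "(G has_derivative (\<lambda>r. r *\<^sub>R DG t)) (at t within ?I)"
    proof -
      have lin: "linear (\<lambda>U. hinv (\<gamma> t) ** rel_log_deriv P0 (\<gamma> t) U
          + - (hinv (\<gamma> t) ** ?m U ** hinv (\<gamma> t)) ** rel_log P0 (\<gamma> t))"
        using has_derivative_grad_mat[OF P0 PD[OF t]] by (rule has_derivative_linear)
      show ?thesis
        using has_derivative_compose[OF \<gamma>'[OF t, unfolded has_vector_derivative_def]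
            has_derivative_grad_mat[OF P0 PD[OF t]]]
        unfolding G_def DG_def linear_scale[OF lin] .
    qed
    moreover have "((\<lambda>t. ?m (\<gamma>' t)) has_derivative (\<lambda>r. ?m (r *\<^sub>R - ?\<Gamma>))) (at t within ?I)"
      using has_derivative_mat_of_herm[OF \<gamma>''[OF t, unfolded has_vector_derivative_def]]
      unfolding levi_civita_PD[OF PD[OF t]] .
    ultimately have "((\<lambda>t. 2 * rtr (G t ** ?m (\<gamma>' t))) has_derivative
        (\<lambda>r. 2 * rtr (G t ** ?m (r *\<^sub>R - ?\<Gamma>) + (r *\<^sub>R DG t) ** ?m (\<gamma>' t)))) (at t within ?I)"
      by (rule bounded_linear.has_derivative[OF bounded_linear_const_mult[OF bounded_linear_Re_trace]
          has_derivative_matrix_mult])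
    then have "((\<lambda>t. 2 * rtr (G t ** ?m (\<gamma>' t))) has_real_derivative
        2 * rtr (DG t ** ?m (\<gamma>' t)) - 2 * rtr (G t ** ?m ?\<Gamma>)) (at t within ?I)"
      unfolding has_field_derivative_def
      by (rule has_derivative_eq_rhs)
        (simp add: mat_of_herm_simps mm_simps rtr_simps fun_eq_iff algebra_simps)
    then show ?thesis
      unfolding G_def DG_def hessian_integral_formula[OF P0 PD[OF t]] .
  qed
  have "integral ?I (\<lambda>s. hess_integrand P0 (\<gamma>' t) (\<gamma>' t) (s, \<gamma> t)) \<ge> 0" if t: "t \<in> ?I" for t
  proof -
    obtain h k p where fr: "simultaneous_frame h k p (\<gamma> t) P0"
      using PD_simultaneous_frame[OF P0 PD[OF t]] .
    show ?thesis
      unfolding simultaneous_frame.hess_integral_weighted[OF fr] by (intro sum_nonneg) simp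
  qed
  with f' f'' show "convex_on ?I (\<lambda>t. (pd_dist (\<gamma> t) P0)\<^sup>2)"
    by (rule convex_on_second_derivative_nonneg)
qed

theorem theorem1p4:
  fixes P0 :: "'n::finite herm"
  assumes "P0 \<in> PD"
  shows "self_concordant_on PD affine_inv_metric 2 (\<lambda>P. (pd_dist P P0)\<^sup>2)"
proof -
  let ?f = "\<lambda>P. (pd_dist P P0)\<^sup>2"
  have "smooth_on PD ?f"
    using smooth_on_sqdist[OF assms] unfolding smooth_on_def
    by (auto intro: Ck_on_cong[OF open_PD] simp: pd_dist_eq_sqdist[OF assms])
  moreover have "\<bar>third_cov_deriv PD affine_inv_metric ?f P U V W\<bar>
      \<le> 2 / sqrt 2 * sqrt (hessian PD affine_inv_metric ?f P U U)
        * sqrt (hessian PD affine_inv_metric ?f P V V)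
        * sqrt (hessian PD affine_inv_metric ?f P W W)" if P: "P \<in> PD" for P U V W
  proof -
    obtain h k p where fr: "simultaneous_frame h k p P P0"
      using PD_simultaneous_frame[OF assms P] .
    show ?thesis
      unfolding third_cov_deriv_pd_dist[OF assms P fr] hessian_pd_dist[OF assms P] real_div_sqrt[of 2, simplified]
      by (rule simultaneous_frame.abs_integral_cubic_sum_le[OF fr])
  qed
  ultimately show ?thesis
    using geodesically_convex_pd_dist[OF assms] by (simp add: self_concordant_on_def)
qed

end
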